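(* Let $(\mathcal{X},e)$ be a unital operator space and $\mathcal{K}\subseteq\mathcal{X}$ the kernel of a unital complete contraction. Let $\{\|\cdot\|_n^{osp}\}$ and $\{\|\cdot\|_n^{usp}\}$ denote the operator space quotient and unital operator space quotient norms, respectively, on $\mathcal{X}/\mathcal{K}$. Then for all $n$ and all $A\in M_n(\mathcal{X})$, \[ \|A+M_n(\mathcal{K})\|_n^{usp}=\|A+M_n(\mathcal{K})\|_n^{e+\mathcal{K}}, \] where $\|\cdot\|_n^{e+\mathcal{K}}$ is the factorization norm on the operator space $(\mathcal{X}/\mathcal{K},\{\|\cdot\|^{osp}\})$ associated with the trivial product for the unit vector $e+\mathcal{K}$; that is, $\|X\|_n^{e+\mathcal{K}}=\inf\{\|X_1\|^{osp}\cdots\|X_N\|^{osp}:X=X_1\odot_m\cdots\odot_mX_N\}$ over all permissible factorizations of $X$ ($N\ge1$ arbitrary) into rectangular matrices over $\mathcal{X}/\mathcal{K}$.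
   Context: An operator space $\mathcal{X}$ with a distinguished element $e$, $\|e\|=1$, is a unital operator space with unit $e$ if there is a complete isometry $\varphi:\mathcal{X}\to\mathbb{B}(\mathcal{H})$ with $\varphi(e)=I$. Ucc means unital completely contractive. The operator space quotient norms are $\|x+\mathcal{K}\|^{osp}_{n,k}=\inf\{\|x+y\|_{n,k}:y\in M_{n,k}(\mathcal{K})\}$. The unital operator space quotient norms are $\|x+\mathcal{K}\|^{usp}_{n,k}=\sup\{\|\varphi(x)\|:\varphi:\mathcal{X}\to\mathbb{B}(\mathcal{H})\text{ ucc},\ \mathcal{K}\subseteq\ker\varphi\}$ ($\varphi$ applied entrywise). Factorizations: for a vector space $\mathcal{W}$ with distinguished nonzero vector $f$ (here $\mathcal{W}=\mathcal{X}/\mathcal{K}$, $f=e+\mathcal{K}$), the trivial product is $m(\lambda f,x)=m(x,\lambda f)=\lambda x$. Let $\mathcal{F}_m(\mathcal{W})$ be the quotient of the free (tensor) algebra over $\mathcal{W}$ by the relations $f\cdot x=x\cdot f=x$ for $x\in\mathcal{W}$, i.e. the free unital algebra over $\mathcal{W}$ in which $f$ is identified with the unit; $\mathcal{W}$ embeds in it. A tuple $(X_1,\dots,X_N)$ of matrices over $\mathcal{W}$ is permissible if the number of columns of $X_k$ equals the number of rows of $X_{k+1}$ for all $k$ and all entries of the matrix product $X_1\odot_m\cdots\odot_mX_N$, computed in $\mathcal{F}_m(\mathcal{W})$, lie in $\mathcal{W}$. *)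

theory Defs
  imports
    Complex_Main
    "HOL-Library.Poly_Mapping"
    "HOL-Library.Set_Algebras"
    "Jordan_Normal_Form.Matrix"
begin

section \<open>Complex vector spaces\<close>

text \<open>The complex analogue of the class \<open>real_vector\<close>.\<close>

class complex_vector = ab_group_add +
  fixes scaleC :: "complex \<Rightarrow> 'a \<Rightarrow> 'a"  (infixr \<open>*\<^sub>C\<close> 75)
  assumes scaleC_add_right: "a *\<^sub>C (x + y) = a *\<^sub>C x + a *\<^sub>C y"
    and scaleC_add_left: "(a + b) *\<^sub>C x = a *\<^sub>C x + b *\<^sub>C x"
    and scaleC_scaleC: "a *\<^sub>C (b *\<^sub>C x) = (a * b) *\<^sub>C x"
    and scaleC_one: "1 *\<^sub>C x = x"

global_interpretation complex_vector:
  vector_space "scaleC :: complex \<Rightarrow> 'a \<Rightarrow> 'a::complex_vector"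
  defines csubspace = complex_vector.subspace
    and cindependent = complex_vector.independent
  by unfold_locales
    (simp_all add: scaleC_add_right scaleC_add_left scaleC_scaleC scaleC_one)

definition infinite_cdim :: "'h::complex_vector itself \<Rightarrow> bool" where
  "infinite_cdim TYPE('h) \<longleftrightarrow> (\<exists>B :: 'h set. infinite B \<and> cindependent B)"


section \<open>Hilbert spaces and matrices of bounded operators\<close>

text \<open>
  HOL cannot quantify over all types inside a formula, so a Hilbert space is a linear
  subspace \<open>H\<close> of an ambient complex vector space \<open>'h\<close> together with an
  inner product \<open>ip\<close> on \<open>H\<close> (linear in the first argument) for which
  \<open>H\<close> is complete. The ambient type carries no norm; it only provides the vectors and
  the linear operations, and every Hilbert space arises in this way from some ambient type.
  The zero space is excluded, so that the identity operator has norm \<open>1\<close>.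
\<close>

definition hnorm :: "('h \<Rightarrow> 'h \<Rightarrow> complex) \<Rightarrow> 'h \<Rightarrow> real" where
  "hnorm ip v = sqrt (Re (ip v v))"

locale complex_hilbert_space =
  fixes H :: "'h::complex_vector set" and ip :: "'h \<Rightarrow> 'h \<Rightarrow> complex"
  assumes subspace: "csubspace H"
    and nontrivial: "H \<noteq> {0}"
    and ip_add: "\<lbrakk>u \<in> H; v \<in> H; w \<in> H\<rbrakk> \<Longrightarrow> ip (u + v) w = ip u w + ip v w"
    and ip_scale: "\<lbrakk>u \<in> H; w \<in> H\<rbrakk> \<Longrightarrow> ip (c *\<^sub>C u) w = c * ip u w"
    and ip_commute: "\<lbrakk>u \<in> H; w \<in> H\<rbrakk> \<Longrightarrow> ip w u = cnj (ip u w)"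
    and ip_pos: "\<lbrakk>u \<in> H; u \<noteq> 0\<rbrakk> \<Longrightarrow> 0 < Re (ip u u)"
    and complete:
      "\<lbrakk>\<And>k :: nat. s k \<in> H;
        \<And>\<epsilon>. 0 < \<epsilon> \<Longrightarrow> \<exists>N. \<forall>i\<ge>N. \<forall>j\<ge>N. hnorm ip (s i - s j) < \<epsilon>\<rbrakk>
       \<Longrightarrow> \<exists>l\<in>H. (\<lambda>k. hnorm ip (s k - l)) \<longlonglongrightarrow> 0"

text \<open>
  An operator on \<open>H\<close> is given by a function on the ambient type, of which only the
  values on \<open>H\<close> matter.
\<close>

definition bounded_op :: "'h::complex_vector set \<Rightarrow> ('h \<Rightarrow> 'h \<Rightarrow> complex) \<Rightarrow> ('h \<Rightarrow> 'h) \<Rightarrow> bool" where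
  "bounded_op H ip T \<longleftrightarrow>
     (\<forall>v\<in>H. T v \<in> H) \<and>
     (\<forall>u\<in>H. \<forall>v\<in>H. T (u + v) = T u + T v) \<and>
     (\<forall>c. \<forall>v\<in>H. T (c *\<^sub>C v) = c *\<^sub>C T v) \<and>
     (\<exists>C. \<forall>v\<in>H. hnorm ip (T v) \<le> C * hnorm ip v)"

text \<open>
  The norm of an \<open>n \<times> k\<close> matrix of operators, as an operator from the Hilbert
  direct sum \<open>H\<^sup>k\<close> to \<open>H\<^sup>n\<close>.
\<close>

definition op_mat_norm ::
  "'h::complex_vector set \<Rightarrow> ('h \<Rightarrow> 'h \<Rightarrow> complex) \<Rightarrow> ('h \<Rightarrow> 'h) mat \<Rightarrow> real" where
  "op_mat_norm H ip T =
     Sup {sqrt (\<Sum>i<dim_row T. (hnorm ip (\<Sum>j<dim_col T. (T $$ (i, j)) (\<xi> j)))\<^sup>2) | \<xi>.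
           (\<forall>j<dim_col T. \<xi> j \<in> H) \<and> (\<Sum>j<dim_col T. (hnorm ip (\<xi> j))\<^sup>2) \<le> 1}"


section \<open>Unital operator spaces\<close>

definition op_linear ::
  "'h::complex_vector set \<Rightarrow> ('h \<Rightarrow> 'h \<Rightarrow> complex) \<Rightarrow> ('x::complex_vector \<Rightarrow> 'h \<Rightarrow> 'h) \<Rightarrow> bool" where
  "op_linear H ip \<phi> \<longleftrightarrow>
     (\<forall>x. bounded_op H ip (\<phi> x)) \<and>
     (\<forall>x y. \<forall>v\<in>H. \<phi> (x + y) v = \<phi> x v + \<phi> y v) \<and>
     (\<forall>c x. \<forall>v\<in>H. \<phi> (c *\<^sub>C x) v = c *\<^sub>C \<phi> x v)"

definition op_unital :: "'h set \<Rightarrow> 'x \<Rightarrow> ('x \<Rightarrow> 'h \<Rightarrow> 'h) \<Rightarrow> bool" where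
  "op_unital H e \<phi> \<longleftrightarrow> (\<forall>v\<in>H. \<phi> e v = v)"

definition op_kernel :: "'h::complex_vector set \<Rightarrow> ('x \<Rightarrow> 'h \<Rightarrow> 'h) \<Rightarrow> 'x set" where
  "op_kernel H \<phi> = {x. \<forall>v\<in>H. \<phi> x v = 0}"

text \<open>
  All matrix norms \<open>\<parallel>\<cdot>\<parallel>\<^bsub>n,k\<^esub>\<close> on a space are collected in one
  function \<open>nrm\<close> on matrices, since a matrix determines its size. Sizes are positive.
\<close>

definition completely_isometric ::
  "'h::complex_vector set \<Rightarrow> ('h \<Rightarrow> 'h \<Rightarrow> complex) \<Rightarrow> ('x mat \<Rightarrow> real) \<Rightarrow> ('x \<Rightarrow> 'h \<Rightarrow> 'h) \<Rightarrow> bool" where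
  "completely_isometric H ip nrm \<phi> \<longleftrightarrow>
     (\<forall>A. 0 < dim_row A \<longrightarrow> 0 < dim_col A \<longrightarrow> op_mat_norm H ip (map_mat \<phi> A) = nrm A)"

definition completely_contractive ::
  "'h::complex_vector set \<Rightarrow> ('h \<Rightarrow> 'h \<Rightarrow> complex) \<Rightarrow> ('x mat \<Rightarrow> real) \<Rightarrow> ('x \<Rightarrow> 'h \<Rightarrow> 'h) \<Rightarrow> bool" where
  "completely_contractive H ip nrm \<phi> \<longleftrightarrow>
     (\<forall>A. 0 < dim_row A \<longrightarrow> 0 < dim_col A \<longrightarrow> op_mat_norm H ip (map_mat \<phi> A) \<le> nrm A)"

text \<open>
  The existence of \<open>\<phi>\<close> contains the axioms of an operator space and
  \<open>\<parallel>e\<parallel> = 1\<close>. The type argument is the ambient space of the Hilbert space.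
\<close>

definition unital_operator_space ::
  "'h::complex_vector itself \<Rightarrow> ('x::complex_vector mat \<Rightarrow> real) \<Rightarrow> 'x \<Rightarrow> bool" where
  "unital_operator_space TYPE('h) nrm e \<longleftrightarrow>
     (\<exists>(H :: 'h set) ip \<phi>. complex_hilbert_space H ip \<and> op_linear H ip \<phi> \<and>
        completely_isometric H ip nrm \<phi> \<and> op_unital H e \<phi>)"

definition ucc ::
  "'h::complex_vector set \<Rightarrow> ('h \<Rightarrow> 'h \<Rightarrow> complex) \<Rightarrow> ('x::complex_vector mat \<Rightarrow> real) \<Rightarrow> 'x \<Rightarrow>
     ('x \<Rightarrow> 'h \<Rightarrow> 'h) \<Rightarrow> bool" where
  "ucc H ip nrm e \<phi> \<longleftrightarrow> complex_hilbert_space H ip \<and> op_linear H ip \<phi> \<and>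
     completely_contractive H ip nrm \<phi> \<and> op_unital H e \<phi>"

definition ucc_kernel ::
  "'h::complex_vector itself \<Rightarrow> ('x::complex_vector mat \<Rightarrow> real) \<Rightarrow> 'x \<Rightarrow> 'x set \<Rightarrow> bool" where
  "ucc_kernel TYPE('h) nrm e K \<longleftrightarrow>
     (\<exists>(H :: 'h set) ip \<phi>. ucc H ip nrm e \<phi> \<and> K = op_kernel H \<phi>)"


section \<open>Quotients\<close>

record 'w vspace =
  vcarrier :: "'w set"
  vadd :: "'w \<Rightarrow> 'w \<Rightarrow> 'w"
  vscale :: "complex \<Rightarrow> 'w \<Rightarrow> 'w"

text \<open>
  Elements of the quotient are cosets \<open>x +o K\<close>; sums of cosets are sums of sets.
  The summand \<open>K\<close> in the scalar multiplication matters only for the scalar \<open>0\<close>.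
\<close>

definition quotient_space :: "'x::complex_vector set \<Rightarrow> 'x set vspace" where
  "quotient_space K =
     \<lparr>vcarrier = range (\<lambda>x. x +o K), vadd = (\<lambda>S T. S + T), vscale = (\<lambda>c S. (scaleC c ` S) + K)\<rparr>"

definition coset_mat :: "'x::plus set \<Rightarrow> 'x mat \<Rightarrow> 'x set mat" where
  "coset_mat K = map_mat (\<lambda>x. x +o K)"

text \<open>
  The operator space quotient norm of a matrix \<open>Z\<close> over the quotient: the infimum of the
  norms over all representatives of \<open>Z\<close>, i.e. over all \<open>A + Y\<close> with
  \<open>Y\<close> a matrix over \<open>K\<close> when \<open>Z = coset_mat K A\<close>; see
  \<open>osp_norm_coset_mat\<close> below.
\<close>

definition osp_norm :: "('x::plus mat \<Rightarrow> real) \<Rightarrow> 'x set \<Rightarrow> 'x set mat \<Rightarrow> real" where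
  "osp_norm nrm K Z = Inf {nrm A | A. coset_mat K A = Z}"

text \<open>
  The unital quotient norm is a supremum over all ucc maps into \<open>B(H)\<close>, with
  \<open>H\<close> ranging over all Hilbert spaces inside the ambient space \<open>'h\<close>,
  which plays the role of a universe. The ambient space should be infinite-dimensional, so
  that it contains Hilbert spaces of every finite dimension. Enlarging it further does not
  change the supremum: compressing a ucc map to finite-dimensional subspaces of \<open>H\<close>
  gives ucc maps whose norms at a fixed matrix approximate that of the original map.
\<close>

definition usp_norm ::
  "'h::complex_vector itself \<Rightarrow> ('x::complex_vector mat \<Rightarrow> real) \<Rightarrow> 'x \<Rightarrow> 'x set \<Rightarrow> 'x mat \<Rightarrow> real" where
  "usp_norm TYPE('h) nrm e K A =
     Sup {op_mat_norm H ip (map_mat \<phi> A) | (H :: 'h set) ip \<phi>.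
            ucc H ip nrm e \<phi> \<and> K \<subseteq> op_kernel H \<phi>}"

lemma coset_eq_iff:
  fixes K :: "'x::complex_vector set"
  assumes "csubspace K"
  shows "y +o K = x +o K \<longleftrightarrow> y - x \<in> K"
proof
  assume *: "y +o K = x +o K"
  have "y + 0 \<in> y +o K"
    using complex_vector.subspace_0[OF assms] by (rule set_plus_intro2)
  with * obtain k where "k \<in> K" "y = x + k"
    by (auto simp: elt_set_plus_def)
  then show "y - x \<in> K" by simp
next
  assume *: "y - x \<in> K"
  show "y +o K = x +o K"
  proof (intro Set.set_eqI iffI)
    fix z assume "z \<in> y +o K"
    then obtain k where "k \<in> K" "z = y + k" by (auto simp: elt_set_plus_def)
    moreover from this have "(y - x) + k \<in> K"
      using * complex_vector.subspace_add[OF assms] by blast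
    ultimately show "z \<in> x +o K"
      unfolding elt_set_plus_def by (intro CollectI bexI[of _ "(y - x) + k"]) simp_all
  next
    fix z assume "z \<in> x +o K"
    then obtain k where "k \<in> K" "z = x + k" by (auto simp: elt_set_plus_def)
    moreover from this have "k - (y - x) \<in> K"
      using * complex_vector.subspace_diff[OF assms] by blast
    ultimately show "z \<in> y +o K"
      unfolding elt_set_plus_def by (intro CollectI bexI[of _ "k - (y - x)"]) simp_all
  qed
qed

lemma osp_norm_coset_mat:
  assumes K: "csubspace K" and A: "A \<in> carrier_mat n k"
  shows "osp_norm nrm K (coset_mat K A) =
    Inf {nrm (A + Y) | Y. Y \<in> carrier_mat n k \<and> (\<forall>i<n. \<forall>j<k. Y $$ (i, j) \<in> K)}"
proof -
  have "{nrm B | B. coset_mat K B = coset_mat K A} =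
    {nrm (A + Y) | Y. Y \<in> carrier_mat n k \<and> (\<forall>i<n. \<forall>j<k. Y $$ (i, j) \<in> K)}"
    (is "?L = ?R")
  proof (intro subset_antisym subsetI)
    fix r assume "r \<in> ?L"
    then obtain B where r: "r = nrm B" and B: "coset_mat K B = coset_mat K A" by blast
    have dims: "dim_row B = n" "dim_col B = k"
      using arg_cong[OF B, of dim_row] arg_cong[OF B, of dim_col] A
      by (auto simp: coset_mat_def)
    define Y where "Y = mat n k (\<lambda>ij. B $$ ij - A $$ ij)"
    have "B $$ (i, j) - A $$ (i, j) \<in> K" if "i < n" "j < k" for i j
    proof -
      have "coset_mat K B $$ (i, j) = coset_mat K A $$ (i, j)" using B by simp
      then have "B $$ (i, j) +o K = A $$ (i, j) +o K"
        using that dims A by (simp add: coset_mat_def)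
      then show ?thesis using coset_eq_iff[OF K] by blast
    qed
    then have "Y \<in> carrier_mat n k" "\<forall>i<n. \<forall>j<k. Y $$ (i, j) \<in> K"
      by (simp_all add: Y_def)
    moreover have "B = A + Y"
      by (rule eq_matI) (use dims A in \<open>auto simp: Y_def\<close>)
    ultimately show "r \<in> ?R" unfolding r by blast
  next
    fix r assume "r \<in> ?R"
    then obtain Y where r: "r = nrm (A + Y)" and Y: "Y \<in> carrier_mat n k"
      and YK: "\<forall>i<n. \<forall>j<k. Y $$ (i, j) \<in> K" by blast
    have "(A $$ (i, j) + Y $$ (i, j)) +o K = A $$ (i, j) +o K" if "i < n" "j < k" for i j
      using coset_eq_iff[OF K, of "A $$ (i, j) + Y $$ (i, j)" "A $$ (i, j)"] YK that by simp
    then have "coset_mat K (A + Y) = coset_mat K A"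
      using A Y by (intro eq_matI) (simp_all add: coset_mat_def)
    then show "r \<in> ?L" using r by auto
  qed
  then show ?thesis unfolding osp_norm_def by (rule arg_cong)
qed


section \<open>The free unital algebra with \<open>f\<close> identified with the unit\<close>

text \<open>
  Words, i.e. the free monoid on the type \<open>'w\<close>. With index type \<open>'w word\<close>, the
  type \<open>'w word \<Rightarrow>\<^sub>0 complex\<close> with the (convolution) multiplication of
  \<open>HOL-Library.Poly_Mapping\<close> is the free unital complex algebra on the set \<open>'w\<close>.
\<close>

datatype 'w word = Word (letters: "'w list")

instantiation word :: (type) monoid_add
begin

definition zero_word :: "'a word" where
  "0 = Word []"

definition plus_word :: "'a word \<Rightarrow> 'a word \<Rightarrow> 'a word" where
  "u + v = Word (letters u @ letters v)"

instance
  by standard (simp_all add: zero_word_def plus_word_def)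

end

type_synonym 'w free_algebra = "'w word \<Rightarrow>\<^sub>0 complex"

definition free_algebra_on :: "'w set \<Rightarrow> 'w free_algebra set" where
  "free_algebra_on S = {p. \<forall>u \<in> Poly_Mapping.keys p. set (letters u) \<subseteq> S}"

definition gen :: "'w \<Rightarrow> 'w free_algebra" where
  "gen w = Poly_Mapping.single (Word [w]) 1"

definition scalar :: "complex \<Rightarrow> 'w free_algebra" where
  "scalar c = Poly_Mapping.single 0 c"

text \<open>
  The first two families of relators turn the free algebra on the set \<open>vcarrier W\<close> into
  the unital tensor algebra of the vector space \<open>W\<close>; the last one identifies
  \<open>f\<close> with the unit, and thereby yields \<open>f \<cdot> x = x \<cdot> f = x\<close>.
\<close>

definition relators :: "'w vspace \<Rightarrow> 'w \<Rightarrow> 'w free_algebra set" where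
  "relators W f =
     {gen (vadd W x y) - (gen x + gen y) | x y. x \<in> vcarrier W \<and> y \<in> vcarrier W} \<union>
     {gen (vscale W c x) - scalar c * gen x | c x. x \<in> vcarrier W} \<union>
     {gen f - 1}"

inductive_set two_sided_ideal :: "'r::ring_1 set \<Rightarrow> 'r set \<Rightarrow> 'r set"
  for R :: "'r::ring_1 set" and G :: "'r set" where
  zero: "0 \<in> two_sided_ideal R G"
| step: "\<lbrakk>s \<in> two_sided_ideal R G; a \<in> R; g \<in> G; b \<in> R\<rbrakk> \<Longrightarrow> s + a * g * b \<in> two_sided_ideal R G"

text \<open>Equality in \<open>\<F>\<^sub>m(W)\<close> of the classes of two elements of the free algebra.\<close>

definition Fm_eq :: "'w vspace \<Rightarrow> 'w \<Rightarrow> 'w free_algebra \<Rightarrow> 'w free_algebra \<Rightarrow> bool" where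
  "Fm_eq W f p q \<longleftrightarrow> p - q \<in> two_sided_ideal (free_algebra_on (vcarrier W)) (relators W f)"


section \<open>Permissible tuples and the factorization norm\<close>

fun mat_prod :: "'r::semiring_0 mat list \<Rightarrow> 'r mat" where
  "mat_prod [] = undefined"
| "mat_prod [X] = X"
| "mat_prod (X # Y # Xs) = X * mat_prod (Y # Xs)"

definition mats_over :: "'w set \<Rightarrow> 'w mat set" where
  "mats_over S = {X. 0 < dim_row X \<and> 0 < dim_col X \<and> elements_mat X \<subseteq> S}"

definition composable :: "'w vspace \<Rightarrow> 'w mat list \<Rightarrow> bool" where
  "composable W Xs \<longleftrightarrow> Xs \<noteq> [] \<and> set Xs \<subseteq> mats_over (vcarrier W) \<and>
     successively (\<lambda>X Y. dim_col X = dim_row Y) Xs"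

text \<open>
  \<open>Z\<close>, a matrix over \<open>W\<close>, equals the product of \<open>Xs\<close> computed in
  \<open>\<F>\<^sub>m(W)\<close>.
\<close>

definition product_is :: "'w vspace \<Rightarrow> 'w \<Rightarrow> 'w mat list \<Rightarrow> 'w mat \<Rightarrow> bool" where
  "product_is W f Xs Z \<longleftrightarrow>
     Z \<in> carrier_mat (dim_row (hd Xs)) (dim_col (last Xs)) \<and>
     (\<forall>i<dim_row Z. \<forall>j<dim_col Z.
        Fm_eq W f (mat_prod (map (map_mat gen) Xs) $$ (i, j)) (gen (Z $$ (i, j))))"

definition permissible :: "'w vspace \<Rightarrow> 'w \<Rightarrow> 'w mat list \<Rightarrow> bool" where
  "permissible W f Xs \<longleftrightarrow> composable W Xs \<and> (\<exists>Z \<in> mats_over (vcarrier W). product_is W f Xs Z)"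

definition factorization_norm ::
  "'w vspace \<Rightarrow> 'w \<Rightarrow> ('w mat \<Rightarrow> real) \<Rightarrow> 'w mat \<Rightarrow> real" where
  "factorization_norm W f nrm Z =
     Inf {prod_list (map nrm Xs) | Xs. permissible W f Xs \<and> product_is W f Xs Z}"

end

theory Submission
  imports Defs "HOL-Library.Function_Algebras"
begin

text \<open>
  A ucc map that kills \<open>K\<close> induces a unital homomorphism on words, so permissible
  factorizations bound its norm at \<open>A\<close>. For the converse let the unital quotient norm of
  \<open>A\<close> be smaller than \<open>2 c\<close>. Every functional that is positive on accretive matrices over
  \<open>X\<close> and kills \<open>K\<close> comes from a ucc map killing \<open>K\<close>, and such maps send
  \<open>[[c, A], [0, c]]\<close> to a matrix with positive real part. By separation this matrix has an accretive
  lift \<open>T\<close> modulo \<open>K\<close>. For small positive diagonal matrices \<open>D\<close> the norm of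
  \<open>I - D T D\<close> is \<open>1\<close> up to second order, while modulo \<open>K\<close> it is upper triangular
  with entries in the span of \<open>e\<close> and \<open>A\<close>. Such a triangular matrix acts on a column \<open>(x A, y I)\<close>
  by a scalar \<open>2 \<times> 2\<close> matrix. A suitable long product of them, that is a discretized
  flow, steers \<open>(0, I)\<close> to \<open>(x A, y I)\<close> with \<open>x\<close> close to \<open>- 1 / (2 c)\<close> at a
  cost close to \<open>1\<close>. Reading off the upper block factorizes \<open>A\<close> at a cost close to \<open>2 c\<close>.
\<close>

text \<open>The factor 2 comes from the fact that \<open>A\<close> has norm at most
  \<open>2 * c\<close> exactly when [[c, A], [0, c]] has nonnegative real part. The obstacle is that
  an accretive lift \<open>T\<close> bounds the norm of \<open>I - t T\<close> only by 1 + O(t^2),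
  so no single factor need be contractive. The squared step sizes must have a small sum, while the
  steps themselves add up to something large.

  The speeds \<open>p\<close> and \<open>r\<close> on the two blocks may differ, which decides the
  constant. Up to the sign of x, the flow in the limit is x' = - c p x + sqrt (p r) y, y' = - c r y,
  and 4 c^2 x^2 + y^2 has derivative - 2 c (2 c x sqrt p - y sqrt r)^2. From (0, 1) the flow
  therefore never gets beyond x = 1 / (2 c). It gets there in the limit if 2 c x sqrt p = y sqrt r
  throughout and y tends to 0. The weights used below are a discrete form of this balance.

  Separation is done without a topology, so the functional is only known to be nonpositive at the
  excluded matrix. The strict gap between the unital quotient norm of \<open>A\<close> and
  \<open>2 * c\<close> makes up for this, and also for the perturbation that makes the functional
  definite.\<close>

section \<open>Separation of a point from a cone with an order unit\<close>

text \<open>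
  A maximal convex cone that avoids \<open>- u\<close> contains \<open>Z\<close> or \<open>- Z\<close> for every
  \<open>Z\<close>, so that cutting along the line through \<open>u\<close> defines a functional.
\<close>

lemma cone_functional:
  fixes C :: "'v::complex_vector set"
  assumes add: "\<And>Z W. Z \<in> C \<Longrightarrow> W \<in> C \<Longrightarrow> Z + W \<in> C"
    and scale: "\<And>r Z. 0 \<le> r \<Longrightarrow> Z \<in> C \<Longrightarrow> complex_of_real r *\<^sub>C Z \<in> C"
    and order_unit: "\<And>Z. \<exists>t. Z + complex_of_real t *\<^sub>C u \<in> C"
    and u: "u \<in> C" and not_neg: "- u \<notin> C"
  shows "\<exists>f :: 'v \<Rightarrow> real. (\<forall>Z W. f (Z + W) = f Z + f W) \<and>
    (\<forall>r Z. f (complex_of_real r *\<^sub>C Z) = r * f Z) \<and> (\<forall>Z\<in>C. 0 \<le> f Z) \<and> f u = 1"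
proof -
  define \<A> where "\<A> = {D. C \<subseteq> D \<and> (\<forall>Z\<in>D. \<forall>W\<in>D. Z + W \<in> D) \<and>
    (\<forall>r\<ge>0. \<forall>Z\<in>D. complex_of_real r *\<^sub>C Z \<in> D) \<and> - u \<notin> D}"
  have "C \<in> \<A>" using assms by (auto simp: \<A>_def)
  have "\<exists>M\<in>\<A>. \<forall>X\<in>\<A>. M \<subseteq> X \<longrightarrow> X = M"
  proof (rule subset_Zorn_nonempty)
    show "\<A> \<noteq> {}" using \<open>C \<in> \<A>\<close> by blast
  next
    fix \<C> assume ne: "\<C> \<noteq> {}" and ch: "subset.chain \<A> \<C>"
    then have sub: "\<C> \<subseteq> \<A>" and lin: "\<And>X Y. X \<in> \<C> \<Longrightarrow> Y \<in> \<C> \<Longrightarrow> X \<subseteq> Y \<or> Y \<subseteq> X"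
      by (auto simp: subset.chain_def)
    have "Z + W \<in> \<Union>\<C>" if ZW: "Z \<in> \<Union>\<C>" "W \<in> \<Union>\<C>" for Z W
    proof -
      obtain X Y where XY: "X \<in> \<C>" "Y \<in> \<C>" "Z \<in> X" "W \<in> Y" using ZW by blast
      from lin[OF XY(1,2)] have "\<exists>D\<in>\<C>. Z \<in> D \<and> W \<in> D" using XY by blast
      then obtain D where "D \<in> \<C>" "Z \<in> D" "W \<in> D" by blast
      moreover from this have "Z + W \<in> D" using sub unfolding \<A>_def by blast
      ultimately show ?thesis by blast
    qed
    moreover have "C \<subseteq> \<Union>\<C>"
    proof -
      obtain D where "D \<in> \<C>" using ne by blast
      moreover from this have "C \<subseteq> D" using sub unfolding \<A>_def by blast
      ultimately show ?thesis by blast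
    qed
    moreover have "complex_of_real r *\<^sub>C Z \<in> \<Union>\<C>" if "0 \<le> r" "Z \<in> \<Union>\<C>" for r Z
      using that sub by (auto simp: \<A>_def)
    moreover have "- u \<notin> \<Union>\<C>" using sub by (auto simp: \<A>_def)
    ultimately show "\<Union>\<C> \<in> \<A>" unfolding \<A>_def by blast
  qed
  then obtain M where M: "M \<in> \<A>" and max: "\<And>X. X \<in> \<A> \<Longrightarrow> M \<subseteq> X \<Longrightarrow> X = M" by blast
  have CM: "C \<subseteq> M" and M_add: "\<And>Z W. Z \<in> M \<Longrightarrow> W \<in> M \<Longrightarrow> Z + W \<in> M"
    and M_scale: "\<And>r Z. 0 \<le> r \<Longrightarrow> Z \<in> M \<Longrightarrow> complex_of_real r *\<^sub>C Z \<in> M" and nu: "- u \<notin> M"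
    using M by (auto simp: \<A>_def)
  have uM: "u \<in> M" using u CM by blast
  have zM: "0 \<in> M" using M_scale[of 0 u] uM by simp
  have neg_u: "complex_of_real r *\<^sub>C u \<notin> M" if "r < 0" for r
  proof
    assume "complex_of_real r *\<^sub>C u \<in> M"
    from M_scale[OF _ this, of "- 1 / r"] that have "- u \<in> M"
      by (simp add: scaleC_scaleC divide_nonpos_nonpos)
    with nu show False ..
  qed
  have total: "- Z \<in> M" if Z: "Z \<notin> M" for Z
  proof -
    \<comment> \<open>The convex cone generated by \<open>M\<close> and \<open>Z\<close>. By
      maximality it must contain \<open>- u\<close>, and solving that relation for
      \<open>- Z\<close> exhibits \<open>- Z\<close> as a positive multiple of an element of
      \<open>M\<close>.\<close>
    define X where "X = {W + complex_of_real r *\<^sub>C Z | W r. W \<in> M \<and> 0 \<le> r}"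
    have sub: "M \<subseteq> X"
    proof
      fix W assume "W \<in> M"
      then show "W \<in> X" unfolding X_def by (intro CollectI exI[of _ W] exI[of _ 0]) simp
    qed
    have "Z \<in> X" unfolding X_def using zM
      by (intro CollectI exI[of _ 0] exI[of _ 1]) (simp add: scaleC_one)
    with Z have "X \<noteq> M" by blast
    then have "X \<notin> \<A>" using max sub by blast
    moreover have "A + B \<in> X" if AB: "A \<in> X" "B \<in> X" for A B
    proof -
      obtain W r W' r' where "A = W + complex_of_real r *\<^sub>C Z" "W \<in> M" "0 \<le> r"
        "B = W' + complex_of_real r' *\<^sub>C Z" "W' \<in> M" "0 \<le> r'"
        using AB unfolding X_def by blast
      then show ?thesis unfolding X_def using M_add
        by (intro CollectI exI[of _ "W + W'"] exI[of _ "r + r'"]) (simp add: scaleC_add_left)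
    qed
    moreover have "complex_of_real s *\<^sub>C A \<in> X" if s: "0 \<le> s" and A: "A \<in> X" for s A
    proof -
      obtain W r where "A = W + complex_of_real r *\<^sub>C Z" "W \<in> M" "0 \<le> r"
        using A unfolding X_def by blast
      then show ?thesis unfolding X_def using M_scale[OF s] s
        by (intro CollectI exI[of _ "complex_of_real s *\<^sub>C W"] exI[of _ "s * r"])
          (simp add: scaleC_add_right scaleC_scaleC)
    qed
    moreover have "C \<subseteq> X" using CM sub by blast
    ultimately have "- u \<in> X" unfolding \<A>_def by blast
    then obtain W r where W: "- u = W + complex_of_real r *\<^sub>C Z" "W \<in> M" "0 \<le> r"
      unfolding X_def by blast
    have "r \<noteq> 0" using W nu by auto
    with W have r: "0 < r" by simp
    have "- (complex_of_real r *\<^sub>C Z) = W + u" 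
    proof -
      have "complex_of_real r *\<^sub>C Z = - u - W" unfolding W(1) by simp
      then show ?thesis by simp
    qed
    then have "complex_of_real (1/r) *\<^sub>C (W + u) = complex_of_real (1/r) *\<^sub>C (- (complex_of_real r *\<^sub>C Z))" by simp
    also have "\<dots> = - Z"
      using r by (simp add: complex_vector.scale_minus_right scaleC_scaleC scaleC_one)
    finally show ?thesis using M_scale[OF _ M_add[OF W(2) uM], of "1/r"] r by simp
  qed
  \<comment> \<open>\<open>f Z\<close> is the parameter at which the line through \<open>Z\<close>
    in direction \<open>- u\<close> leaves \<open>M\<close>. The cone need not be closed, so the
    supremum may not be attained and the estimates below only use parameters strictly below
    it.\<close>
  define S where "S Z = {t. Z - complex_of_real t *\<^sub>C u \<in> M}" for Z
  define f where "f Z = Sup (S Z)" for Z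
  have S_ne: "S Z \<noteq> {}" for Z
  proof -
    obtain t where "Z + complex_of_real t *\<^sub>C u \<in> C" using order_unit by blast
    then have "- t \<in> S Z" using CM by (auto simp: S_def complex_vector.scale_minus_left)
    then show ?thesis by blast
  qed
  have S_bdd: "bdd_above (S Z)" for Z
  proof -
    obtain s where s: "- Z + complex_of_real s *\<^sub>C u \<in> C" using order_unit by blast
    have "t \<le> s" if "t \<in> S Z" for t
    proof (rule ccontr)
      assume "\<not> t \<le> s"
      moreover have "(- Z + complex_of_real s *\<^sub>C u) + (Z - complex_of_real t *\<^sub>C u) \<in> M"
        by (rule M_add) (use s CM that in \<open>auto simp: S_def\<close>)
      then have "complex_of_real (s - t) *\<^sub>C u \<in> M"
        by (simp add: complex_vector.scale_left_diff_distrib)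
      ultimately show False using neg_u[of "s - t"] by simp
    qed
    then show ?thesis by (rule bdd_aboveI)
  qed
  have upper: "t \<le> f Z" if "Z - complex_of_real t *\<^sub>C u \<in> M" for t Z
    unfolding f_def using that by (intro cSup_upper S_bdd) (simp add: S_def)
  have lower: "Z - complex_of_real t *\<^sub>C u \<in> M" if t: "t < f Z" for t Z
  proof -
    obtain s where s: "s \<in> S Z" "t < s"
      using t less_cSup_iff[OF S_ne S_bdd] unfolding f_def by blast
    have "(Z - complex_of_real s *\<^sub>C u) + complex_of_real (s - t) *\<^sub>C u \<in> M"
      using s M_scale[OF _ uM, of "s - t"] by (intro M_add) (simp_all add: S_def)
    then show ?thesis by (simp add: complex_vector.scale_left_diff_distrib)
  qed
  have super: "f Z + f W \<le> f (Z + W)" for Z W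
  proof (rule field_le_epsilon)
    fix \<epsilon> :: real assume "0 < \<epsilon>"
    then have "(Z - complex_of_real (f Z - \<epsilon>/2) *\<^sub>C u) + (W - complex_of_real (f W - \<epsilon>/2) *\<^sub>C u) \<in> M"
      by (intro M_add lower) simp_all
    also have "(Z - complex_of_real (f Z - \<epsilon>/2) *\<^sub>C u) + (W - complex_of_real (f W - \<epsilon>/2) *\<^sub>C u)
      = (Z + W) - (complex_of_real (f Z - \<epsilon>/2) + complex_of_real (f W - \<epsilon>/2)) *\<^sub>C u"
      unfolding scaleC_add_left by (simp add: algebra_simps)
    also have "complex_of_real (f Z - \<epsilon>/2) + complex_of_real (f W - \<epsilon>/2)
      = complex_of_real (f Z + f W - \<epsilon>)" 
      by (subst of_real_add[symmetric]) (rule arg_cong[of _ _ complex_of_real], simp)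
    finally show "f Z + f W \<le> f (Z + W) + \<epsilon>" using upper by fastforce
  qed
  have f_le: "f Z \<le> s" if "\<And>t. s < t \<Longrightarrow> Z - complex_of_real t *\<^sub>C u \<notin> M" for s Z
    using lower that dense by (metis not_le)
  have f0: "f 0 = 0"
  proof (rule antisym)
    show "f 0 \<le> 0"
    proof (rule f_le)
      fix t :: real assume "0 < t"
      then show "0 - complex_of_real t *\<^sub>C u \<notin> M"
        using neg_u[of "-t"] by (simp add: complex_vector.scale_minus_left)
    qed
    show "0 \<le> f 0" using upper[of 0 0] zM by simp
  qed
  have f_neg: "f (- Z) = - f Z" for Z
  proof (rule antisym)
    show "f (- Z) \<le> - f Z" using super[of Z "- Z"] f0 by simp
    \<comment> \<open>Beyond \<open>f Z\<close> the line has left \<open>M\<close>; as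
      \<open>M\<close> is total, the negatives of those points lie in \<open>M\<close>. Together
      with superadditivity this makes \<open>f\<close> additive.\<close>
    show "- f Z \<le> f (- Z)"
    proof (rule field_le_epsilon)
      fix \<epsilon> :: real assume "0 < \<epsilon>"
      then have "Z - complex_of_real (f Z + \<epsilon>) *\<^sub>C u \<notin> M" using upper[of Z "f Z + \<epsilon>"] by auto
      from total[OF this] have "- Z - complex_of_real (- (f Z + \<epsilon>)) *\<^sub>C u \<in> M"
        unfolding of_real_minus complex_vector.scale_minus_left by simp
      then show "- f Z \<le> f (- Z) + \<epsilon>" using upper by fastforce
    qed
  qed
  have f_add: "f (Z + W) = f Z + f W" for Z W
    using super[of Z W] super[of "Z + W" "- W"] f_neg[of W] by simp
  have pos_le: "r * f Z \<le> f (complex_of_real r *\<^sub>C Z)" if r: "0 < r" for r Z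
  proof (rule field_le_epsilon)
    fix \<epsilon> :: real assume \<epsilon>: "0 < \<epsilon>"
    then have "Z - complex_of_real (f Z - \<epsilon> / r) *\<^sub>C u \<in> M" using r by (intro lower) simp
    from M_scale[OF _ this, of r] r
    have "complex_of_real r *\<^sub>C Z - complex_of_real (r * (f Z - \<epsilon> / r)) *\<^sub>C u \<in> M"
      by (simp only: complex_vector.scale_right_diff_distrib scaleC_scaleC of_real_mult order_less_imp_le)
    also have "r * (f Z - \<epsilon> / r) = r * f Z - \<epsilon>" using r by (simp add: field_simps)
    finally have "complex_of_real r *\<^sub>C Z - complex_of_real (r * f Z - \<epsilon>) *\<^sub>C u \<in> M" .
    then show "r * f Z \<le> f (complex_of_real r *\<^sub>C Z) + \<epsilon>" using upper by fastforce
  qed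
  have pos: "f (complex_of_real r *\<^sub>C Z) = r * f Z" if r: "0 < r" for r Z
  proof (rule antisym)
    have "1 / r * f (complex_of_real r *\<^sub>C Z) \<le> f Z"
      using pos_le[of "1 / r" "complex_of_real r *\<^sub>C Z"] r by (simp add: scaleC_scaleC scaleC_one)
    then show "f (complex_of_real r *\<^sub>C Z) \<le> r * f Z" using r by (simp add: field_simps)
  qed (rule pos_le[OF r])
  have f_scale: "f (complex_of_real r *\<^sub>C Z) = r * f Z" for r Z
  proof (cases r "0 :: real" rule: linorder_cases)
    case less
    then have "f (complex_of_real (- r) *\<^sub>C Z) = - r * f Z" by (intro pos) simp
    then show ?thesis using f_neg[of "complex_of_real r *\<^sub>C Z"] by (simp add: complex_vector.scale_minus_left)
  qed (use f0 pos in auto)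
  have "f u = 1"
  proof (rule antisym)
    show "f u \<le> 1"
    proof (rule f_le)
      fix t :: real assume "1 < t"
      then show "u - complex_of_real t *\<^sub>C u \<notin> M"
        using neg_u[of "1 - t"] by (simp add: complex_vector.scale_left_diff_distrib scaleC_one)
    qed
    show "1 \<le> f u" using upper[of u 1] zM by (simp add: scaleC_one)
  qed
  moreover have "0 \<le> f Z" if "Z \<in> C" for Z using upper[of Z 0] that CM by auto
  ultimately show ?thesis using f_add f_scale by blast
qed

text \<open>Adding the ray through \<open>- E\<close> to the cone keeps it proper, so
  \<open>cone_functional\<close> applies to the larger cone and gives the sign at \<open>E\<close>.
  Since \<open>C\<close> need not be closed, the inequality at \<open>E\<close> cannot be made
  strict.\<close>

lemma cone_separation:
  fixes C :: "'v::complex_vector set"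
  assumes add: "\<And>Z W. Z \<in> C \<Longrightarrow> W \<in> C \<Longrightarrow> Z + W \<in> C"
    and scale: "\<And>r Z. 0 \<le> r \<Longrightarrow> Z \<in> C \<Longrightarrow> complex_of_real r *\<^sub>C Z \<in> C"
    and order_unit: "\<And>Z. \<exists>t. Z + complex_of_real t *\<^sub>C u \<in> C"
    and u: "u \<in> C" and E: "E \<notin> C"
  shows "\<exists>f :: 'v \<Rightarrow> real. (\<forall>Z W. f (Z + W) = f Z + f W) \<and>
    (\<forall>r Z. f (complex_of_real r *\<^sub>C Z) = r * f Z) \<and> (\<forall>Z\<in>C. 0 \<le> f Z) \<and> f u = 1 \<and> f E \<le> 0"
proof -
  have zC: "0 \<in> C" using scale[of 0 u] u by simp
  define D where "D = {Z - complex_of_real r *\<^sub>C E | Z r. Z \<in> C \<and> 0 \<le> r}"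
  have CD: "C \<subseteq> D"
  proof
    fix W assume "W \<in> C"
    then show "W \<in> D" unfolding D_def by (intro CollectI exI[of _ W] exI[of _ 0]) simp
  qed
  have ED: "- E \<in> D" unfolding D_def using zC
    by (intro CollectI exI[of _ 0] exI[of _ 1]) (simp add: scaleC_one)
  have "\<exists>f :: 'v \<Rightarrow> real. (\<forall>Z W. f (Z + W) = f Z + f W) \<and>
    (\<forall>r Z. f (complex_of_real r *\<^sub>C Z) = r * f Z) \<and> (\<forall>Z\<in>D. 0 \<le> f Z) \<and> f u = 1"
  proof (rule cone_functional)
    fix A B assume AB: "A \<in> D" "B \<in> D"
    obtain W r W' r' where "A = W - complex_of_real r *\<^sub>C E" "W \<in> C" "0 \<le> r"
      "B = W' - complex_of_real r' *\<^sub>C E" "W' \<in> C" "0 \<le> r'"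
      using AB unfolding D_def by blast
    then show "A + B \<in> D" unfolding D_def using add
      by (intro CollectI exI[of _ "W + W'"] exI[of _ "r + r'"]) (simp add: scaleC_add_left)
  next
    fix s :: real and A assume s: "0 \<le> s" and A: "A \<in> D"
    obtain W r where "A = W - complex_of_real r *\<^sub>C E" "W \<in> C" "0 \<le> r"
      using A unfolding D_def by blast
    then show "complex_of_real s *\<^sub>C A \<in> D" unfolding D_def using scale[OF s] s
      by (intro CollectI exI[of _ "complex_of_real s *\<^sub>C W"] exI[of _ "s * r"])
        (simp add: complex_vector.scale_right_diff_distrib scaleC_scaleC)
  next
    fix Z show "\<exists>t. Z + complex_of_real t *\<^sub>C u \<in> D" using order_unit CD by blast
  next
    show "u \<in> D" using u CD by blast
  next
    show "- u \<notin> D"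
    proof
      assume "- u \<in> D"
      then obtain Z r where Z: "- u = Z - complex_of_real r *\<^sub>C E" "Z \<in> C" "0 \<le> r"
        unfolding D_def by blast
      then have eq: "complex_of_real r *\<^sub>C E = Z + u" by (simp add: algebra_simps)
      have "E \<in> C"
      \<comment> \<open>For \<open>r = 0\<close> the cone itself contains \<open>- u\<close>, hence
        the whole line through \<open>u\<close>, and the order unit then puts every vector into
        \<open>C\<close>.\<close>
      proof (cases "r = 0")
        case True
        obtain t where t: "E + complex_of_real t *\<^sub>C u \<in> C" using order_unit by blast
        from True Z(1) have "- u = Z" by simp
        then have nu: "- u \<in> C" using Z(2) by simp
        have "complex_of_real (- t) *\<^sub>C u \<in> C"
        proof (cases "0 \<le> - t")
          case True then show ?thesis using scale u by blast
        next
          case False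
          then show ?thesis using scale[OF _ nu, of t] by (simp add: complex_vector.scale_minus_left complex_vector.scale_minus_right)
        qed
        from add[OF t this] show ?thesis by (simp add: complex_vector.scale_minus_left)
      next
        case False
        have "complex_of_real (1 / r) *\<^sub>C (Z + u) \<in> C" using Z u by (intro scale add) simp_all
        then show ?thesis using False by (simp flip: eq add: scaleC_scaleC scaleC_one)
      qed
      with E show False ..
    qed
  qed
  then obtain f :: "'v \<Rightarrow> real" where f: "\<forall>Z W. f (Z + W) = f Z + f W"
    "\<forall>r Z. f (complex_of_real r *\<^sub>C Z) = r * f Z" "\<forall>Z\<in>D. 0 \<le> f Z" "f u = 1" by blast
  have "f (- E) = - f E" using f(2)[rule_format, of "-1" E] by (simp add: complex_vector.scale_minus_left scaleC_one)
  with f ED CD show ?thesis by (intro exI[of _ f]) force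
qed

section \<open>Matrices of operators on a Hilbert space\<close>

definition sq_norm :: "('h \<Rightarrow> 'h \<Rightarrow> complex) \<Rightarrow> nat \<Rightarrow> (nat \<Rightarrow> 'h) \<Rightarrow> real" where
  "sq_norm ip k \<xi> = (\<Sum>j<k. (hnorm ip (\<xi> j))\<^sup>2)"

definition mat_act :: "('h::comm_monoid_add \<Rightarrow> 'h) mat \<Rightarrow> (nat \<Rightarrow> 'h) \<Rightarrow> nat \<Rightarrow> 'h" where
  "mat_act T \<xi> i = (\<Sum>j<dim_col T. (T $$ (i, j)) (\<xi> j))"

definition op_mat :: "'h::complex_vector set \<Rightarrow> ('h \<Rightarrow> 'h \<Rightarrow> complex) \<Rightarrow> ('h \<Rightarrow> 'h) mat \<Rightarrow> bool" where
  "op_mat H ip T \<longleftrightarrow> (\<forall>i<dim_row T. \<forall>j<dim_col T. bounded_op H ip (T $$ (i, j)))"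

lemma sq_norm_nonneg [simp]: "0 \<le> sq_norm ip k \<xi>"
  by (simp add: sq_norm_def sum_nonneg)

lemma op_mat_norm_alt:
  "op_mat_norm H ip T = Sup {sqrt (sq_norm ip (dim_row T) (mat_act T \<xi>)) | \<xi>.
     (\<forall>j<dim_col T. \<xi> j \<in> H) \<and> sq_norm ip (dim_col T) \<xi> \<le> 1}"
  unfolding op_mat_norm_def sq_norm_def mat_act_def ..

context complex_hilbert_space
begin

section \<open>Inner products and quadratic inequalities\<close>

lemma mem_zero [simp, intro]: "0 \<in> H"
  by (rule complex_vector.subspace_0[OF subspace])

lemma mem_add [intro]: "u \<in> H \<Longrightarrow> v \<in> H \<Longrightarrow> u + v \<in> H"
  by (rule complex_vector.subspace_add[OF subspace])

lemma mem_scale [intro]: "u \<in> H \<Longrightarrow> c *\<^sub>C u \<in> H"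
  by (rule complex_vector.subspace_scale[OF subspace])

lemma mem_sum [intro]: "(\<And>i. i \<in> I \<Longrightarrow> v i \<in> H) \<Longrightarrow> (\<Sum>i\<in>I. v i) \<in> H"
  by (rule complex_vector.subspace_sum[OF subspace])

lemma mem_sum_ball: "\<forall>i\<in>I. v i \<in> H \<Longrightarrow> (\<Sum>i\<in>I. v i) \<in> H"
  by (rule mem_sum) blast

lemma ip_zero_left [simp]: "w \<in> H \<Longrightarrow> ip 0 w = 0"
  using ip_scale[of 0 w 0] by simp

lemma ip_zero_right [simp]: "w \<in> H \<Longrightarrow> ip w 0 = 0"
  using ip_commute[of 0 w] by simp

lemma ip_add_right: "\<lbrakk>u \<in> H; v \<in> H; w \<in> H\<rbrakk> \<Longrightarrow> ip w (u + v) = ip w u + ip w v"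
  using ip_commute[of "u + v" w] ip_commute[of u w] ip_commute[of v w] ip_add[of u v w] by auto

lemma ip_scale_right: "\<lbrakk>u \<in> H; w \<in> H\<rbrakk> \<Longrightarrow> ip w (c *\<^sub>C u) = cnj c * ip w u"
  using ip_commute[of "c *\<^sub>C u" w] ip_commute[of u w] ip_scale[of u w c] by auto

lemma ip_sum_left:
  "\<forall>i\<in>I. v i \<in> H \<Longrightarrow> w \<in> H \<Longrightarrow> ip (\<Sum>i\<in>I. v i) w = (\<Sum>i\<in>I. ip (v i) w)"
  by (induction I rule: infinite_finite_induct) (auto simp: ip_add mem_sum)

lemma ip_sum_right:
  "\<forall>i\<in>I. v i \<in> H \<Longrightarrow> w \<in> H \<Longrightarrow> ip w (\<Sum>i\<in>I. v i) = (\<Sum>i\<in>I. ip w (v i))"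
  by (induction I rule: infinite_finite_induct) (auto simp: ip_add_right mem_sum)

lemma Re_ip_nonneg: "v \<in> H \<Longrightarrow> 0 \<le> Re (ip v v)"
  using ip_pos[of v] by (cases "v = 0") auto

lemma ip_self: "v \<in> H \<Longrightarrow> ip v v = of_real (Re (ip v v))"
  using arg_cong[OF ip_commute[of v v], of Im] by (simp add: complex_eq_iff)

lemma hnorm_sq: "v \<in> H \<Longrightarrow> (hnorm ip v)\<^sup>2 = Re (ip v v)"
  by (simp add: hnorm_def Re_ip_nonneg)

lemma hnorm_nonneg: "v \<in> H \<Longrightarrow> 0 \<le> hnorm ip v"
  by (simp add: hnorm_def Re_ip_nonneg)

lemma hnorm_zero [simp]: "hnorm ip 0 = 0"
  by (simp add: hnorm_def)

lemma hnorm_scale: "v \<in> H \<Longrightarrow> (hnorm ip (c *\<^sub>C v))\<^sup>2 = (cmod c)\<^sup>2 * (hnorm ip v)\<^sup>2"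
proof -
  assume v: "v \<in> H"
  have "ip (c *\<^sub>C v) (c *\<^sub>C v) = (c * cnj c) * ip v v"
    using v by (simp add: ip_scale ip_scale_right mem_scale)
  also have "c * cnj c = of_real ((cmod c)\<^sup>2)" using complex_norm_square[of c] by simp
  finally have "Re (ip (c *\<^sub>C v) (c *\<^sub>C v)) = (cmod c)\<^sup>2 * Re (ip v v)" by simp
  then show ?thesis using v by (simp add: hnorm_sq mem_scale)
qed

lemma hnorm_add_sq:
  "u \<in> H \<Longrightarrow> v \<in> H \<Longrightarrow> (hnorm ip (u + v))\<^sup>2 = (hnorm ip u)\<^sup>2 + (hnorm ip v)\<^sup>2 + 2 * Re (ip u v)"
  using arg_cong[OF ip_commute[of u v], of Re]
  by (simp add: hnorm_sq mem_add ip_add ip_add_right)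

text \<open>Expand the nonnegative number \<open>s\<close> times the squared norm of
  \<open>u + t v\<close>. With \<open>t\<close> left free this stands in for the Cauchy-Schwarz
  inequality below.\<close>

lemma young:
  assumes "u \<in> H" "v \<in> H" "0 \<le> s"
  shows "- (s * (hnorm ip u)\<^sup>2 + s * t\<^sup>2 * (hnorm ip v)\<^sup>2) \<le> 2 * s * t * Re (ip u v)"
proof -
  have "0 \<le> s * (hnorm ip (u + complex_of_real t *\<^sub>C v))\<^sup>2" using assms by simp
  also have "\<dots> = s * (hnorm ip u)\<^sup>2 + s * t\<^sup>2 * (hnorm ip v)\<^sup>2 + 2 * s * t * Re (ip u v)"
    using assms by (simp add: hnorm_add_sq mem_scale hnorm_scale ip_scale_right algebra_simps)
  finally show ?thesis by simp
qed

text \<open>Read \<open>a\<close> as the image \<open>B X\<close> of a column under a matrix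
  \<open>B\<close> of norm at most \<open>s\<close>, and \<open>b\<close> as the squared norm of
  \<open>X\<close>. The conclusion then says that the block matrix with \<open>s\<close> on the
  diagonal and \<open>2 B\<close> in one corner has nonnegative real part. This link between
  contractivity and positivity is used both to build ucc maps and to test them.\<close>

lemma bilinear_bound:
  assumes a: "\<And>i. a i \<in> H" and y: "\<And>i. y i \<in> H" and s: "0 \<le> s" and bound: "sq_norm ip m a \<le> s\<^sup>2 * b"
  shows "0 \<le> 2 * (\<Sum>i<m. Re (ip (a i) (y i))) + s * (b + sq_norm ip m y)"
proof (cases "s = 0")
  case True
  have "sq_norm ip m a = 0"
    using bound True by (intro antisym) simp_all
  then have z: "(hnorm ip (a i))\<^sup>2 = 0" if "i < m" for i
    using that unfolding sq_norm_def by (subst (asm) sum_nonneg_eq_0_iff) auto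
  have "a i = 0" if "i < m" for i
  proof (rule ccontr)
    assume "a i \<noteq> 0"
    from ip_pos[OF a this] show False using z[OF that] hnorm_sq[OF a] by simp
  qed
  then show ?thesis using True y by simp
next
  case False
  with s have s0: "0 < s" by simp
  have "(\<Sum>i<m. - ((1 / s) * (hnorm ip (a i))\<^sup>2 + s * (hnorm ip (y i))\<^sup>2))
    \<le> (\<Sum>i<m. 2 * Re (ip (a i) (y i)))"
  proof (rule sum_mono)
    fix i
    show "- ((1 / s) * (hnorm ip (a i))\<^sup>2 + s * (hnorm ip (y i))\<^sup>2) \<le> 2 * Re (ip (a i) (y i))"
      using young[OF a y, of "1 / s" i s i] s0 by (simp add: power2_eq_square)
  qed
  then have "- ((1 / s) * sq_norm ip m a + s * sq_norm ip m y) \<le> 2 * (\<Sum>i<m. Re (ip (a i) (y i)))"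
    unfolding sq_norm_def sum_distrib_left by (simp only: sum_negf sum.distrib)
  moreover have "(1 / s) * sq_norm ip m a \<le> (1 / s) * (s\<^sup>2 * b)"
    using s0 by (intro mult_left_mono bound) simp
  moreover have "(1 / s) * (s\<^sup>2 * b) = s * b"
    using s0 by (simp add: power2_eq_square)
  ultimately show ?thesis by (simp add: algebra_simps)
qed

lemma hnorm_sum_sq:
  "(\<And>j. j < k \<Longrightarrow> v j \<in> H) \<Longrightarrow> (hnorm ip (\<Sum>j<k. v j))\<^sup>2 \<le> 2 ^ k * (\<Sum>j<k. (hnorm ip (v j))\<^sup>2)"
proof (induction k)
  case (Suc k)
  let ?w = "\<Sum>j<k. v j"
  have w: "?w \<in> H" and v: "v k \<in> H" using Suc.prems by (auto intro!: mem_sum)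
  have "(hnorm ip (?w + v k))\<^sup>2 \<le> 2 * (hnorm ip ?w)\<^sup>2 + 2 * (hnorm ip (v k))\<^sup>2"
    using young[OF w v, of 1 "-1"] by (simp add: hnorm_add_sq[OF w v])
  also have "\<dots> \<le> 2 * (2 ^ k * (\<Sum>j<k. (hnorm ip (v j))\<^sup>2)) + 2 * (2 ^ k * (hnorm ip (v k))\<^sup>2)"
  proof (intro add_mono mult_left_mono)
    show "(hnorm ip ?w)\<^sup>2 \<le> 2 ^ k * (\<Sum>j<k. (hnorm ip (v j))\<^sup>2)" using Suc by simp
    show "(hnorm ip (v k))\<^sup>2 \<le> 2 ^ k * (hnorm ip (v k))\<^sup>2"
      using mult_right_mono[of 1 "2 ^ k" "(hnorm ip (v k))\<^sup>2"] by simp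
  qed simp_all
  finally show ?case by (simp add: algebra_simps)
qed simp

section \<open>Bounded operators and matrices of them acting on columns\<close>

lemma bounded_op_mem: "bounded_op H ip T \<Longrightarrow> v \<in> H \<Longrightarrow> T v \<in> H"
  and bounded_op_add: "bounded_op H ip T \<Longrightarrow> u \<in> H \<Longrightarrow> v \<in> H \<Longrightarrow> T (u + v) = T u + T v"
  and bounded_op_scale: "bounded_op H ip T \<Longrightarrow> v \<in> H \<Longrightarrow> T (c *\<^sub>C v) = c *\<^sub>C T v"
  by (auto simp: bounded_op_def)

lemma bounded_op_zero: "bounded_op H ip T \<Longrightarrow> T 0 = 0"
  using bounded_op_scale[of T 0 0] by simp

lemma bounded_op_sum:
  assumes T: "bounded_op H ip T"
  shows "\<forall>i\<in>I. v i \<in> H \<Longrightarrow> T (\<Sum>i\<in>I. v i) = (\<Sum>i\<in>I. T (v i))"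
proof (induction I rule: infinite_finite_induct)
  case (insert i I)
  then show ?case using bounded_op_add[OF T, of "v i" "\<Sum>i\<in>I. v i"] by (simp add: mem_sum)
qed (simp_all add: bounded_op_zero[OF T])

lemma op_mat_entry: "op_mat H ip T \<Longrightarrow> i < dim_row T \<Longrightarrow> j < dim_col T \<Longrightarrow> bounded_op H ip (T $$ (i, j))"
  by (simp add: op_mat_def)

lemma op_mat_entry_mem:
  "op_mat H ip T \<Longrightarrow> i < dim_row T \<Longrightarrow> j < dim_col T \<Longrightarrow> v \<in> H \<Longrightarrow> (T $$ (i, j)) v \<in> H"
  using bounded_op_mem[OF op_mat_entry] .

lemma mat_act_mem:
  "op_mat H ip T \<Longrightarrow> (\<forall>j<dim_col T. \<xi> j \<in> H) \<Longrightarrow> i < dim_row T \<Longrightarrow> mat_act T \<xi> i \<in> H"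
  unfolding mat_act_def by (intro mem_sum op_mat_entry_mem) auto

lemma mat_act_scale:
  "op_mat H ip T \<Longrightarrow> (\<forall>j<dim_col T. \<xi> j \<in> H) \<Longrightarrow> i < dim_row T \<Longrightarrow>
    mat_act T (\<lambda>j. c *\<^sub>C \<xi> j) i = c *\<^sub>C mat_act T \<xi> i"
  by (auto simp: mat_act_def complex_vector.scale_sum_right bounded_op_scale op_mat_entry intro!: sum.cong)

lemma sq_norm_scale:
  "(\<forall>j<k. \<xi> j \<in> H) \<Longrightarrow> sq_norm ip k (\<lambda>j. c *\<^sub>C \<xi> j) = (cmod c)\<^sup>2 * sq_norm ip k \<xi>"
  by (simp add: sq_norm_def sum_distrib_left hnorm_scale)

text \<open>A real \<open>Sup\<close> is informative only for a bounded set. The crude constant,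
  doubled for each column, is enough to make \<open>op_mat_norm\<close> a genuine supremum.\<close>

lemma mat_act_bounded:
  assumes T: "op_mat H ip T"
  shows "\<exists>C\<ge>0. \<forall>\<xi>. (\<forall>j<dim_col T. \<xi> j \<in> H) \<longrightarrow>
    sq_norm ip (dim_row T) (mat_act T \<xi>) \<le> C * sq_norm ip (dim_col T) \<xi>"
proof -
  let ?n = "dim_row T" and ?k = "dim_col T"
  have "\<exists>D\<ge>0. \<forall>v\<in>H. (hnorm ip ((T $$ (i, j)) v))\<^sup>2 \<le> D * (hnorm ip v)\<^sup>2" if ij: "i < ?n" "j < ?k" for i j
  proof -
    obtain C where C: "\<forall>v\<in>H. hnorm ip ((T $$ (i, j)) v) \<le> C * hnorm ip v"
      using op_mat_entry[OF T ij] by (auto simp: bounded_op_def)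
    have "(hnorm ip ((T $$ (i, j)) v))\<^sup>2 \<le> C\<^sup>2 * (hnorm ip v)\<^sup>2" if v: "v \<in> H" for v
      using power_mono[OF C[rule_format, OF v] hnorm_nonneg, of 2] v
        bounded_op_mem[OF op_mat_entry[OF T \<open>i < ?n\<close> \<open>j < ?k\<close>] v]
      by (simp add: power_mult_distrib)
    then show ?thesis by (intro exI[of _ "C\<^sup>2"]) auto
  qed
  then obtain D where D0: "\<And>i j. i < ?n \<Longrightarrow> j < ?k \<Longrightarrow> 0 \<le> D i j"
    and D: "\<And>i j v. i < ?n \<Longrightarrow> j < ?k \<Longrightarrow> v \<in> H \<Longrightarrow> (hnorm ip ((T $$ (i, j)) v))\<^sup>2 \<le> D i j * (hnorm ip v)\<^sup>2"
    by metis
  define S where "S = (\<Sum>i<?n. \<Sum>j<?k. D i j)"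
  have S0: "0 \<le> S" unfolding S_def by (intro sum_nonneg) (auto intro: D0)
  show ?thesis
  proof (intro exI[of _ "2 ^ ?k * S"] conjI allI impI)
    show "0 \<le> 2 ^ ?k * S" using S0 by simp
  next
    fix \<xi> assume \<xi>: "\<forall>j<?k. \<xi> j \<in> H"
    have "(hnorm ip (mat_act T \<xi> i))\<^sup>2 \<le> 2 ^ ?k * ((\<Sum>j<?k. D i j) * sq_norm ip ?k \<xi>)" if i: "i < ?n" for i
    proof -
      have "(hnorm ip (mat_act T \<xi> i))\<^sup>2 \<le> 2 ^ ?k * (\<Sum>j<?k. (hnorm ip ((T $$ (i, j)) (\<xi> j)))\<^sup>2)"
        unfolding mat_act_def using \<xi> T i by (intro hnorm_sum_sq op_mat_entry_mem) auto
      also have "(\<Sum>j<?k. (hnorm ip ((T $$ (i, j)) (\<xi> j)))\<^sup>2) \<le> (\<Sum>j<?k. D i j * sq_norm ip ?k \<xi>)"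
      proof (rule sum_mono)
        fix j assume j: "j \<in> {..<?k}"
        then have "(hnorm ip ((T $$ (i, j)) (\<xi> j)))\<^sup>2 \<le> D i j * (hnorm ip (\<xi> j))\<^sup>2"
          using D[of i j "\<xi> j"] \<xi> i by simp
        also have "\<dots> \<le> D i j * sq_norm ip ?k \<xi>"
          unfolding sq_norm_def using D0[of i j] i j by (intro mult_left_mono member_le_sum) auto
        finally show "(hnorm ip ((T $$ (i, j)) (\<xi> j)))\<^sup>2 \<le> D i j * sq_norm ip ?k \<xi>" .
      qed
      finally show ?thesis by (simp add: sum_distrib_right)
    qed
    then have "sq_norm ip ?n (mat_act T \<xi>) \<le> (\<Sum>i<?n. 2 ^ ?k * ((\<Sum>j<?k. D i j) * sq_norm ip ?k \<xi>))"
      unfolding sq_norm_def[of _ ?n] by (intro sum_mono) simp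
    also have "\<dots> = 2 ^ ?k * S * sq_norm ip ?k \<xi>"
      by (simp add: S_def sum_distrib_left sum_distrib_right mult.assoc)
    finally show "sq_norm ip ?n (mat_act T \<xi>) \<le> 2 ^ ?k * S * sq_norm ip ?k \<xi>" .
  qed
qed

lemma op_mat_norm_bdd:
  assumes "op_mat H ip T"
  shows "bdd_above {sqrt (sq_norm ip (dim_row T) (mat_act T \<xi>)) | \<xi>.
     (\<forall>j<dim_col T. \<xi> j \<in> H) \<and> sq_norm ip (dim_col T) \<xi> \<le> 1}"
proof -
  obtain C where C: "C \<ge> 0" "\<forall>\<xi>. (\<forall>j<dim_col T. \<xi> j \<in> H) \<longrightarrow>
    sq_norm ip (dim_row T) (mat_act T \<xi>) \<le> C * sq_norm ip (dim_col T) \<xi>"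
    using mat_act_bounded[OF assms] by blast
  show ?thesis
  proof (rule bdd_aboveI[of _ "sqrt C"], clarify)
    fix \<xi> assume \<xi>: "\<forall>j<dim_col T. \<xi> j \<in> H" "sq_norm ip (dim_col T) \<xi> \<le> 1"
    have "sq_norm ip (dim_row T) (mat_act T \<xi>) \<le> C * sq_norm ip (dim_col T) \<xi>" using C \<xi> by blast
    also have "\<dots> \<le> C" using C(1) \<xi>(2) by (simp add: mult_left_le)
    finally show "sqrt (sq_norm ip (dim_row T) (mat_act T \<xi>)) \<le> sqrt C" by simp
  qed
qed

lemma mat_act_zero: "op_mat H ip T \<Longrightarrow> i < dim_row T \<Longrightarrow> mat_act T (\<lambda>_. 0) i = 0"
  unfolding mat_act_def by (intro sum.neutral) (auto simp: bounded_op_zero[OF op_mat_entry])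

lemma op_mat_norm_nonneg: "op_mat H ip T \<Longrightarrow> 0 \<le> op_mat_norm H ip T"
proof -
  assume T: "op_mat H ip T"
  have "0 = sqrt (sq_norm ip (dim_row T) (mat_act T (\<lambda>_. 0)))"
    by (simp add: sq_norm_def mat_act_zero[OF T])
  then show ?thesis unfolding op_mat_norm_alt
    by (intro cSup_upper[OF _ op_mat_norm_bdd[OF T]] CollectI exI[of _ "\<lambda>_. 0"]) (simp add: sq_norm_def)
qed

lemma op_mat_norm_le:
  assumes "0 \<le> c"
    and "\<And>\<xi>. (\<forall>j<dim_col T. \<xi> j \<in> H) \<Longrightarrow>
      sq_norm ip (dim_row T) (mat_act T \<xi>) \<le> c\<^sup>2 * sq_norm ip (dim_col T) \<xi>"
  shows "op_mat_norm H ip T \<le> c"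
  unfolding op_mat_norm_alt
proof (rule cSup_least)
  show "{sqrt (sq_norm ip (dim_row T) (mat_act T \<xi>)) | \<xi>.
     (\<forall>j<dim_col T. \<xi> j \<in> H) \<and> sq_norm ip (dim_col T) \<xi> \<le> 1} \<noteq> {}"
    unfolding Collect_empty_eq by (simp add: sq_norm_def exI[of _ "\<lambda>_. 0"])
next
  fix r assume "r \<in> {sqrt (sq_norm ip (dim_row T) (mat_act T \<xi>)) | \<xi>.
     (\<forall>j<dim_col T. \<xi> j \<in> H) \<and> sq_norm ip (dim_col T) \<xi> \<le> 1}"
  then obtain \<xi> where r: "r = sqrt (sq_norm ip (dim_row T) (mat_act T \<xi>))"
    and \<xi>: "\<forall>j<dim_col T. \<xi> j \<in> H" "sq_norm ip (dim_col T) \<xi> \<le> 1" by blast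
  have "sq_norm ip (dim_row T) (mat_act T \<xi>) \<le> c\<^sup>2 * sq_norm ip (dim_col T) \<xi>" using assms \<xi> by blast
  also have "\<dots> \<le> c\<^sup>2" using \<xi>(2) by (simp add: mult_left_le)
  finally show "r \<le> c" unfolding r using assms(1) by (simp add: real_le_lsqrt)
qed

lemma mat_act_le:
  assumes T: "op_mat H ip T" and \<xi>: "\<forall>j<dim_col T. \<xi> j \<in> H"
  shows "sq_norm ip (dim_row T) (mat_act T \<xi>) \<le> (op_mat_norm H ip T)\<^sup>2 * sq_norm ip (dim_col T) \<xi>"
\<comment> \<open>A column of norm zero cannot be normalized; the crude bound already forces its
  image to have norm zero.\<close>
proof (cases "sq_norm ip (dim_col T) \<xi> = 0")
  case True
  obtain C where C: "C \<ge> 0" "\<forall>\<xi>. (\<forall>j<dim_col T. \<xi> j \<in> H) \<longrightarrow>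
    sq_norm ip (dim_row T) (mat_act T \<xi>) \<le> C * sq_norm ip (dim_col T) \<xi>"
    using mat_act_bounded[OF T] by blast
  then have "sq_norm ip (dim_row T) (mat_act T \<xi>) \<le> C * sq_norm ip (dim_col T) \<xi>" using \<xi> by blast
  with True show ?thesis by simp
next
  case False
  define s where "s = sqrt (sq_norm ip (dim_col T) \<xi>)"
  have s2: "s\<^sup>2 = sq_norm ip (dim_col T) \<xi>" by (simp add: s_def)
  have s: "0 < s" using False by (simp add: s_def order_less_le)
  let ?\<eta> = "\<lambda>j. complex_of_real (1 / s) *\<^sub>C \<xi> j"
  have \<eta>: "\<forall>j<dim_col T. ?\<eta> j \<in> H" using \<xi> by auto
  have "sq_norm ip (dim_col T) ?\<eta> = 1"
    using sq_norm_scale[OF \<xi>, of "complex_of_real (1 / s)"] s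
    by (simp add: norm_divide power_divide flip: s2)
  then have "sqrt (sq_norm ip (dim_row T) (mat_act T ?\<eta>)) \<le> op_mat_norm H ip T"
    unfolding op_mat_norm_alt using \<eta> by (intro cSup_upper[OF _ op_mat_norm_bdd[OF T]]) auto
  then have "sq_norm ip (dim_row T) (mat_act T ?\<eta>) \<le> (op_mat_norm H ip T)\<^sup>2"
    by (simp add: sqrt_le_D)
  moreover have "sq_norm ip (dim_row T) (mat_act T ?\<eta>)
    = sq_norm ip (dim_row T) (\<lambda>i. complex_of_real (1 / s) *\<^sub>C mat_act T \<xi> i)"
    unfolding sq_norm_def by (rule sum.cong) (simp_all add: mat_act_scale[OF T \<xi>])
  moreover have "\<dots> = sq_norm ip (dim_row T) (mat_act T \<xi>) / s\<^sup>2"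
    using sq_norm_scale[of "dim_row T" "mat_act T \<xi>" "complex_of_real (1 / s)"] mat_act_mem[OF T \<xi>] s
    by (simp add: norm_divide power_divide)
  ultimately show ?thesis using s by (simp add: divide_le_eq flip: s2)
qed

end

section \<open>Accretive matrices\<close>

instantiation complex :: complex_vector
begin
definition scaleC_complex :: "complex \<Rightarrow> complex \<Rightarrow> complex" where [simp]: "scaleC_complex a x = a * x"
instance by standard (simp_all add: algebra_simps)
end

text \<open>Matrices are handled as functions of two indices, because those form a complex vector
  space to which cone separation applies. The price is that entries outside the intended range
  exist, so functionals have to be shown insensitive to them.\<close>

instantiation "fun" :: (type, complex_vector) complex_vector
begin
definition scaleC_fun :: "complex \<Rightarrow> ('a \<Rightarrow> 'b) \<Rightarrow> 'a \<Rightarrow> 'b" where "scaleC_fun a f = (\<lambda>x. a *\<^sub>C f x)"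
instance by standard
  (simp_all add: scaleC_fun_def fun_eq_iff scaleC_add_left scaleC_add_right scaleC_scaleC scaleC_one)
end

lemma scaleC_fun_apply [simp]: "(a *\<^sub>C f) x = a *\<^sub>C f x"
  by (simp add: scaleC_fun_def)

lemma sum_fun_apply: "(\<Sum>i\<in>I. f i) x = (\<Sum>i\<in>I. f i x)"
  by (induction I rule: infinite_finite_induct) simp_all

abbreviation unit_mat :: "'x::zero \<Rightarrow> nat \<Rightarrow> nat \<Rightarrow> 'x" where
  "unit_mat e \<equiv> \<lambda>i j. if i = j then e else 0"

abbreviation to_mat :: "nat \<Rightarrow> nat \<Rightarrow> (nat \<Rightarrow> nat \<Rightarrow> 'x) \<Rightarrow> 'x mat" where
  "to_mat m k Z \<equiv> mat m k (\<lambda>(i, j). Z i j)"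

definition fun_act :: "('x \<Rightarrow> 'h::comm_monoid_add \<Rightarrow> 'h) \<Rightarrow> nat \<Rightarrow> (nat \<Rightarrow> nat \<Rightarrow> 'x) \<Rightarrow> (nat \<Rightarrow> 'h) \<Rightarrow> nat \<Rightarrow> 'h" where
  "fun_act \<phi> k Z \<xi> i = (\<Sum>j<k. \<phi> (Z i j) (\<xi> j))"

definition quad :: "('h \<Rightarrow> 'h \<Rightarrow> complex) \<Rightarrow> ('x \<Rightarrow> 'h \<Rightarrow> 'h) \<Rightarrow> nat \<Rightarrow> (nat \<Rightarrow> nat \<Rightarrow> 'x) \<Rightarrow> (nat \<Rightarrow> 'h) \<Rightarrow> real" where
  "quad ip \<phi> d Z \<xi> = (\<Sum>i<d. \<Sum>j<d. Re (ip (\<phi> (Z i j) (\<xi> j)) (\<xi> i)))"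

text \<open>Nonnegativity of the real part takes the place of positivity, since a unital operator
  space need not contain adjoints of its elements.\<close>

definition accretive :: "'h set \<Rightarrow> ('h \<Rightarrow> 'h \<Rightarrow> complex) \<Rightarrow> ('x \<Rightarrow> 'h \<Rightarrow> 'h) \<Rightarrow> nat \<Rightarrow> (nat \<Rightarrow> nat \<Rightarrow> 'x) \<Rightarrow> bool" where
  "accretive H ip \<phi> d Z \<longleftrightarrow> (\<forall>\<xi>. (\<forall>j<d. \<xi> j \<in> H) \<longrightarrow> 0 \<le> quad ip \<phi> d Z \<xi>)"

locale op_map = complex_hilbert_space H ip for H :: "'h::complex_vector set" and ip +
  fixes \<phi> :: "'x::complex_vector \<Rightarrow> 'h \<Rightarrow> 'h"
  assumes linear: "op_linear H ip \<phi>"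
begin

lemma map_bounded: "bounded_op H ip (\<phi> x)"
  and map_add: "v \<in> H \<Longrightarrow> \<phi> (x + y) v = \<phi> x v + \<phi> y v"
  and map_scale: "v \<in> H \<Longrightarrow> \<phi> (c *\<^sub>C x) v = c *\<^sub>C \<phi> x v"
  using linear by (auto simp: op_linear_def)

lemma map_mem: "v \<in> H \<Longrightarrow> \<phi> x v \<in> H"
  using bounded_op_mem[OF map_bounded] .

lemma map_zero: "v \<in> H \<Longrightarrow> \<phi> 0 v = 0"
  using map_scale[of v 0 0] by simp

lemma map_neg: "v \<in> H \<Longrightarrow> \<phi> (- x) v = - \<phi> x v"
  using map_scale[of v "-1" x] by (simp add: complex_vector.scale_minus_left scaleC_one)

lemma map_diff: "v \<in> H \<Longrightarrow> \<phi> (x - y) v = \<phi> x v - \<phi> y v"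
  using map_add[of v x "- y"] map_neg[of v y] by simp

lemma map_vec_scale: "v \<in> H \<Longrightarrow> \<phi> x (c *\<^sub>C v) = c *\<^sub>C \<phi> x v"
  using bounded_op_scale[OF map_bounded] .

lemma map_vec_sum: "\<forall>i\<in>I. v i \<in> H \<Longrightarrow> \<phi> x (\<Sum>i\<in>I. v i) = (\<Sum>i\<in>I. \<phi> x (v i))"
  using bounded_op_sum[OF map_bounded] .

lemma op_mat_map: "op_mat H ip (map_mat \<phi> A)"
  by (simp add: op_mat_def map_bounded)

lemma mat_act_map: "i < dim_row A \<Longrightarrow> mat_act (map_mat \<phi> A) \<xi> i = fun_act \<phi> (dim_col A) (\<lambda>i j. A $$ (i, j)) \<xi> i"
  by (simp add: mat_act_def fun_act_def)

lemma fun_act_mem: "(\<forall>j<k. \<xi> j \<in> H) \<Longrightarrow> fun_act \<phi> k Z \<xi> i \<in> H"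
  unfolding fun_act_def by (intro mem_sum map_mem) auto

lemma sq_norm_mat_act:
  "sq_norm ip (dim_row A) (mat_act (map_mat \<phi> A) \<xi>) =
    sq_norm ip (dim_row A) (fun_act \<phi> (dim_col A) (\<lambda>i j. A $$ (i, j)) \<xi>)"
  by (simp add: sq_norm_def mat_act_map)

lemma sq_norm_mat_act_to_mat:
  "sq_norm ip m (mat_act (map_mat \<phi> (to_mat m k Z)) \<xi>) = sq_norm ip m (fun_act \<phi> k Z \<xi>)"
  unfolding sq_norm_def by (rule sum.cong) (simp_all add: mat_act_def fun_act_def)

lemma quad_alt: "(\<forall>j<d. \<xi> j \<in> H) \<Longrightarrow> quad ip \<phi> d Z \<xi> = (\<Sum>i<d. Re (ip (fun_act \<phi> d Z \<xi> i) (\<xi> i)))"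
  unfolding quad_def fun_act_def by (rule sum.cong) (simp_all add: ip_sum_left map_mem)

lemma quad_add:
  "(\<forall>j<d. \<xi> j \<in> H) \<Longrightarrow> quad ip \<phi> d (Z + W) \<xi> = quad ip \<phi> d Z \<xi> + quad ip \<phi> d W \<xi>"
  by (simp add: quad_def map_add ip_add map_mem sum.distrib)

lemma quad_scale:
  "(\<forall>j<d. \<xi> j \<in> H) \<Longrightarrow> quad ip \<phi> d (complex_of_real r *\<^sub>C Z) \<xi> = r * quad ip \<phi> d Z \<xi>"
  by (simp add: quad_def map_scale ip_scale map_mem sum_distrib_left)

lemma quad_zero: "(\<forall>j<d. \<xi> j \<in> H) \<Longrightarrow> quad ip \<phi> d 0 \<xi> = 0"
  by (simp add: quad_def map_zero)

lemma quad_sum: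
  "(\<forall>j<d. \<xi> j \<in> H) \<Longrightarrow> quad ip \<phi> d (\<Sum>i\<in>I. Z i) \<xi> = (\<Sum>i\<in>I. quad ip \<phi> d (Z i) \<xi>)"
  by (induction I rule: infinite_finite_induct) (simp_all add: quad_zero quad_add)

text \<open>A lower bound on the real part by norms; it makes the identity matrix an order unit for
  the accretive cone.\<close>

lemma quad_ge:
  assumes \<xi>: "\<forall>j<d. \<xi> j \<in> H"
  shows "- (sq_norm ip d (fun_act \<phi> d Z \<xi>) + sq_norm ip d \<xi>) \<le> 2 * quad ip \<phi> d Z \<xi>"
proof -
  have "(\<Sum>i<d. - ((hnorm ip (fun_act \<phi> d Z \<xi> i))\<^sup>2 + (hnorm ip (\<xi> i))\<^sup>2))
    \<le> (\<Sum>i<d. 2 * Re (ip (fun_act \<phi> d Z \<xi> i) (\<xi> i)))"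
    using young[of _ _ 1 1] \<xi> by (intro sum_mono) (auto simp: fun_act_mem)
  then show ?thesis 
    by (simp add: sq_norm_def quad_alt[OF \<xi>] sum_negf sum.distrib sum_subtractf sum_distrib_left)
qed

text \<open>A coefficient matrix of rank one collapses the form to one inner product between two
  combined vectors. This turns functionals on matrices into sesquilinear forms in coefficient
  vectors.\<close>

lemma quad_rank_one:
  assumes \<zeta>: "\<forall>j<d. \<zeta> j \<in> H"
  shows "quad ip \<phi> d (\<lambda>i j. (cnj (w i) * u j) *\<^sub>C x) \<zeta>
    = Re (ip (\<phi> x (\<Sum>j<d. u j *\<^sub>C \<zeta> j)) (\<Sum>i<d. w i *\<^sub>C \<zeta> i))"
proof -
  have "ip (\<phi> x (\<Sum>j<d. u j *\<^sub>C \<zeta> j)) (\<Sum>i<d. w i *\<^sub>C \<zeta> i)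
    = (\<Sum>i<d. \<Sum>j<d. cnj (w i) * (u j * ip (\<phi> x (\<zeta> j)) (\<zeta> i)))"
    using \<zeta> by (simp add: ip_sum_right ip_scale_right mem_scale mem_sum_ball map_mem map_vec_sum ip_sum_left
        map_vec_scale ip_scale sum_distrib_left)
  then show ?thesis using \<zeta> by (simp add: quad_def map_scale ip_scale map_mem mult.assoc)
qed

lemma quad_congruence:
  assumes \<xi>: "\<forall>j<d. \<xi> j \<in> H"
  shows "quad ip \<phi> d (\<lambda>i j. complex_of_real (s i * s j) *\<^sub>C T i j) \<xi>
    = quad ip \<phi> d T (\<lambda>j. complex_of_real (s j) *\<^sub>C \<xi> j)"
  unfolding quad_def using \<xi>
  by (intro sum.cong refl) (simp add: map_scale ip_scale ip_scale_right map_vec_scale map_mem mem_scale ac_simps)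

lemma fun_act_congruence:
  assumes \<xi>: "\<forall>j<d. \<xi> j \<in> H"
  shows "fun_act \<phi> d (\<lambda>i j. complex_of_real (s i * s j) *\<^sub>C T i j) \<xi> i
    = complex_of_real (s i) *\<^sub>C fun_act \<phi> d T (\<lambda>j. complex_of_real (s j) *\<^sub>C \<xi> j) i"
  unfolding fun_act_def using \<xi>
  by (simp add: complex_vector.scale_sum_right map_scale map_vec_scale scaleC_scaleC)

end

locale unital_op_map = op_map +
  fixes e
  assumes unital: "op_unital H e \<phi>"
begin

lemma map_unit: "v \<in> H \<Longrightarrow> \<phi> e v = v"
  using unital by (simp add: op_unital_def)

lemma quad_unit: "(\<forall>j<d. \<xi> j \<in> H) \<Longrightarrow> quad ip \<phi> d (unit_mat e) \<xi> = sq_norm ip d \<xi>"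
proof -
  assume \<xi>: "\<forall>j<d. \<xi> j \<in> H"
  have "Re (ip (\<phi> (unit_mat e i j) (\<xi> j)) (\<xi> i)) = (if j = i then Re (ip (\<xi> i) (\<xi> i)) else 0)"
    if "i < d" "j < d" for i j using that \<xi> by (auto simp: map_unit map_zero)
  then show ?thesis using \<xi> unfolding quad_def sq_norm_def by (simp add: hnorm_sq)
qed

lemma fun_act_unit_diff:
  assumes "\<forall>j<d. \<xi> j \<in> H" "i < d"
  shows "fun_act \<phi> d (unit_mat e - Z) \<xi> i = \<xi> i - fun_act \<phi> d Z \<xi> i"
proof -
  have "\<phi> ((unit_mat e - Z) i j) (\<xi> j) = (if j = i then \<xi> i else 0) - \<phi> (Z i j) (\<xi> j)" if "j < d" for j
    using that assms by (auto simp: map_diff map_unit map_neg map_zero)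
  then show ?thesis using assms(2) unfolding fun_act_def by (simp add: sum_subtractf)
qed

text \<open>The first order term is minus twice the real part, so for accretive \<open>Z\<close>
  only the second order term can push the norm of \<open>I - Z\<close> above 1.\<close>

lemma sq_norm_unit_diff:
  assumes \<xi>: "\<forall>j<d. \<xi> j \<in> H"
  shows "sq_norm ip d (fun_act \<phi> d (unit_mat e - Z) \<xi>)
    = sq_norm ip d \<xi> - 2 * quad ip \<phi> d Z \<xi> + sq_norm ip d (fun_act \<phi> d Z \<xi>)"
proof -
  have "(hnorm ip (fun_act \<phi> d (unit_mat e - Z) \<xi> i))\<^sup>2 =
    (hnorm ip (\<xi> i))\<^sup>2 - 2 * Re (ip (fun_act \<phi> d Z \<xi> i) (\<xi> i)) + (hnorm ip (fun_act \<phi> d Z \<xi> i))\<^sup>2"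
    if i: "i < d" for i
  proof -
    have m: "\<xi> i \<in> H" "fun_act \<phi> d Z \<xi> i \<in> H" using \<xi> i by (auto simp: fun_act_mem)
    have re: "Re (ip (\<xi> i) (fun_act \<phi> d Z \<xi> i)) = Re (ip (fun_act \<phi> d Z \<xi> i) (\<xi> i))"
      using arg_cong[OF ip_commute[OF m], of Re] by simp
    have minus: "- fun_act \<phi> d Z \<xi> i = (-1) *\<^sub>C fun_act \<phi> d Z \<xi> i"
      by (simp add: complex_vector.scale_minus_left scaleC_one)
    have "fun_act \<phi> d (unit_mat e - Z) \<xi> i = \<xi> i + (-1) *\<^sub>C fun_act \<phi> d Z \<xi> i"
      unfolding minus[symmetric] using fun_act_unit_diff[OF \<xi> i] by simp
    then show ?thesis
      using hnorm_add_sq[OF m(1) mem_scale[OF m(2), of "-1"]] hnorm_scale[OF m(2), of "-1"] re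
        ip_scale_right[OF m(2,1), of "-1"] by simp
  qed
  then show ?thesis
    by (simp add: sq_norm_def quad_alt[OF \<xi>] sum.distrib sum_subtractf sum_distrib_left)
qed

end

locale ucc_map = unital_op_map +
  fixes nrm
  assumes contractive: "completely_contractive H ip nrm \<phi>"
begin

lemma op_mat_norm_le_nrm:
  "0 < dim_row A \<Longrightarrow> 0 < dim_col A \<Longrightarrow> op_mat_norm H ip (map_mat \<phi> A) \<le> nrm A"
  using contractive by (simp add: completely_contractive_def)

lemma nrm_nonneg: "0 < dim_row A \<Longrightarrow> 0 < dim_col A \<Longrightarrow> 0 \<le> nrm A"
  by (rule order_trans[OF op_mat_norm_nonneg[OF op_mat_map[of A]] op_mat_norm_le_nrm])

lemma fun_act_le:
  assumes "0 < m" "0 < k" and \<xi>: "\<forall>j<k. \<xi> j \<in> H"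
  shows "sq_norm ip m (fun_act \<phi> k Z \<xi>) \<le> (nrm (to_mat m k Z))\<^sup>2 * sq_norm ip k \<xi>"
proof -
  have "sq_norm ip m (fun_act \<phi> k Z \<xi>) \<le> (op_mat_norm H ip (map_mat \<phi> (to_mat m k Z)))\<^sup>2 * sq_norm ip k \<xi>"
    using mat_act_le[OF op_mat_map, of "to_mat m k Z" \<xi>] \<xi> by (simp add: sq_norm_mat_act_to_mat)
  also have "\<dots> \<le> (nrm (to_mat m k Z))\<^sup>2 * sq_norm ip k \<xi>"
    using assms by (intro mult_right_mono power_mono op_mat_norm_le_nrm op_mat_norm_nonneg op_mat_map) auto
  finally show ?thesis .
qed

end

section \<open>Completely isometric representations and the norm description of accretivity\<close>

locale uci_map = unital_op_map +
  fixes nrm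
  assumes isometric: "completely_isometric H ip nrm \<phi>"

sublocale uci_map \<subseteq> ucc_map
  using isometric by unfold_locales (simp add: completely_isometric_def completely_contractive_def)

context uci_map
begin

lemma nrm_le:
  assumes "0 < m" "0 < k" "0 \<le> c"
    and "\<And>\<xi>. (\<forall>j<k. \<xi> j \<in> H) \<Longrightarrow> sq_norm ip m (fun_act \<phi> k Z \<xi>) \<le> c\<^sup>2 * sq_norm ip k \<xi>"
  shows "nrm (to_mat m k Z) \<le> c"
proof -
  have "nrm (to_mat m k Z) = op_mat_norm H ip (map_mat \<phi> (to_mat m k Z))"
    using isometric assms(1,2) by (simp add: completely_isometric_def)
  also have "\<dots> \<le> c" using assms(3,4) by (intro op_mat_norm_le) (auto simp: sq_norm_mat_act_to_mat)
  finally show ?thesis .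
qed

lemma nrm_unit_diff:
  assumes d: "0 < d" and acc: "accretive H ip \<phi> d Z" and b: "0 \<le> b"
    and Z: "\<And>\<xi>. (\<forall>j<d. \<xi> j \<in> H) \<Longrightarrow> sq_norm ip d (fun_act \<phi> d Z \<xi>) \<le> b * sq_norm ip d \<xi>"
  shows "nrm (to_mat d d (unit_mat e - Z)) \<le> sqrt (1 + b)"
proof (rule nrm_le[OF d d])
  fix \<xi> assume \<xi>: "\<forall>j<d. \<xi> j \<in> H"
  have "0 \<le> quad ip \<phi> d Z \<xi>" using acc \<xi> by (simp add: accretive_def)
  then show "sq_norm ip d (fun_act \<phi> d (unit_mat e - Z) \<xi>) \<le> (sqrt (1 + b))\<^sup>2 * sq_norm ip d \<xi>"
    using Z[OF \<xi>] b by (simp add: sq_norm_unit_diff[OF \<xi>] algebra_simps)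
qed (use b in simp)

text \<open>Accretivity can be read off the matrix norms and the unit: \<open>Z\<close> is accretive
  when the norm of \<open>I - t Z\<close> is at most 1 + O(t^2) for small positive t. Unital
  complete contractions preserve such estimates, and letting t tend to 0 recovers the sign of the
  real part in the target.\<close>

lemma accretive_ucc:
  assumes acc: "accretive H ip \<phi> d Z" and \<theta>: "ucc_map H' ip' \<theta> e nrm"
  shows "accretive H' ip' \<theta> d Z"
proof (cases "d = 0")
  case True then show ?thesis by (simp add: accretive_def quad_def)
next
  case False
  then have d: "0 < d" by simp
  interpret \<theta>: ucc_map H' ip' \<theta> e nrm by (rule \<theta>)
  define N where "N = nrm (to_mat d d Z)"
  have key: "nrm (to_mat d d (unit_mat e - complex_of_real t *\<^sub>C Z)) \<le> sqrt (1 + t\<^sup>2 * N\<^sup>2)" if t: "0 < t" for t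
  proof (rule nrm_unit_diff[OF d])
    show "accretive H ip \<phi> d (complex_of_real t *\<^sub>C Z)"
      using acc t by (auto simp: accretive_def quad_scale)
    fix \<xi> assume \<xi>: "\<forall>j<d. \<xi> j \<in> H"
    have "sq_norm ip d (fun_act \<phi> d (complex_of_real t *\<^sub>C Z) \<xi>)
      = sq_norm ip d (\<lambda>i. complex_of_real t *\<^sub>C fun_act \<phi> d Z \<xi> i)"
      using \<xi> by (simp add: sq_norm_def fun_act_def map_scale complex_vector.scale_sum_right)
    also have "\<dots> = t\<^sup>2 * sq_norm ip d (fun_act \<phi> d Z \<xi>)"
      using sq_norm_scale[of d "fun_act \<phi> d Z \<xi>"] fun_act_mem[OF \<xi>] by simp
    also have "\<dots> \<le> t\<^sup>2 * (N\<^sup>2 * sq_norm ip d \<xi>)"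
      unfolding N_def by (intro mult_left_mono fun_act_le d \<xi>) simp
    finally show "sq_norm ip d (fun_act \<phi> d (complex_of_real t *\<^sub>C Z) \<xi>) \<le> t\<^sup>2 * N\<^sup>2 * sq_norm ip d \<xi>"
      by (simp add: mult.assoc)
  qed simp
  show ?thesis unfolding accretive_def
  proof (intro allI impI)
    fix \<xi> assume \<xi>: "\<forall>j<d. \<xi> j \<in> H'"
    let ?q = "quad ip' \<theta> d Z \<xi>" and ?B = "N\<^sup>2 * sq_norm ip' d \<xi>"
    have le: "- (2 * ?q) \<le> t * ?B" if t: "0 < t" for t
    proof -
      let ?Z = "complex_of_real t *\<^sub>C Z"
      have "sq_norm ip' d \<xi> - 2 * (t * ?q) \<le> sq_norm ip' d (fun_act \<theta> d (unit_mat e - ?Z) \<xi>)"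
        using \<xi> by (simp add: \<theta>.sq_norm_unit_diff \<theta>.quad_scale)
      also have "\<dots> \<le> (nrm (to_mat d d (unit_mat e - ?Z)))\<^sup>2 * sq_norm ip' d \<xi>"
        by (rule \<theta>.fun_act_le[OF d d \<xi>])
      also have "\<dots> \<le> (sqrt (1 + t\<^sup>2 * N\<^sup>2))\<^sup>2 * sq_norm ip' d \<xi>"
        using d by (intro mult_right_mono power_mono key t nrm_nonneg) simp_all
      also have "(sqrt (1 + t\<^sup>2 * N\<^sup>2))\<^sup>2 = 1 + t\<^sup>2 * N\<^sup>2" by (rule real_sqrt_pow2) simp
      also have "\<dots> * sq_norm ip' d \<xi> = sq_norm ip' d \<xi> + t * (t * ?B)"
        by (simp add: algebra_simps power2_eq_square)
      finally have "t * (- (2 * ?q)) \<le> t * (t * ?B)" by simp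
      then show ?thesis using t by (simp only: mult_le_cancel_left_pos)
    qed
    have B: "0 \<le> ?B" by simp
    have "- (2 * ?q) \<le> 0"
    proof (rule field_le_epsilon)
      fix \<epsilon> :: real assume \<epsilon>: "0 < \<epsilon>"
      \<comment> \<open>The step \<open>t\<close> is chosen so that \<open>t * ?B\<close> stays
        below \<epsilon>; the added 1 covers a vanishing \<open>?B\<close>.\<close>
      have "- (2 * ?q) \<le> \<epsilon> / (?B + 1) * ?B"
        by (rule le, rule divide_pos_pos[OF \<epsilon>]) (use B in linarith)
      also have "\<epsilon> / (b + 1) * b \<le> \<epsilon>" if "0 \<le> b" for b
        using \<epsilon> that by (simp add: divide_le_eq algebra_simps)
      note this[OF B]
      finally show "- (2 * ?q) \<le> 0 + \<epsilon>" by simp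
    qed
    then show "0 \<le> ?q" by simp
  qed
qed

text \<open>With D the diagonal matrix of the \<open>s i\<close>, the matrix subtracted from the
  identity is D T D. It is accretive because D can be moved into the vector, and as D has norm at
  most sqrt g on either side, its norm is at most \<open>g\<close> times that of
  \<open>T\<close>.\<close>

lemma nrm_step:
  assumes d: "0 < d" and acc: "accretive H ip \<phi> d T" and g: "\<And>i. i < d \<Longrightarrow> (s i)\<^sup>2 \<le> g" "0 \<le> g"
  shows "nrm (to_mat d d (unit_mat e - (\<lambda>i j. complex_of_real (s i * s j) *\<^sub>C T i j)))
    \<le> sqrt (1 + (g * nrm (to_mat d d T))\<^sup>2)"
proof (rule nrm_unit_diff[OF d])
  let ?s = "\<lambda>\<xi> j. complex_of_real (s j) *\<^sub>C \<xi> j"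
  show "accretive H ip \<phi> d (\<lambda>i j. complex_of_real (s i * s j) *\<^sub>C T i j)"
    unfolding accretive_def
  proof (intro allI impI)
    fix \<xi> assume \<xi>: "\<forall>j<d. \<xi> j \<in> H"
    then have "\<forall>j<d. ?s \<xi> j \<in> H" by (auto intro: mem_scale)
    then show "0 \<le> quad ip \<phi> d (\<lambda>i j. complex_of_real (s i * s j) *\<^sub>C T i j) \<xi>"
      using acc quad_congruence[OF \<xi>, of s T] by (simp add: accretive_def)
  qed
  have s_le: "sq_norm ip d (?s \<xi>) \<le> g * sq_norm ip d \<xi>" if \<xi>: "\<forall>j<d. \<xi> j \<in> H" for \<xi>
    unfolding sq_norm_def sum_distrib_left using g \<xi>
    by (intro sum_mono) (auto simp: hnorm_scale intro!: mult_right_mono)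
  fix \<xi> assume \<xi>: "\<forall>j<d. \<xi> j \<in> H"
  then have s\<xi>: "\<forall>j<d. ?s \<xi> j \<in> H" by (auto intro: mem_scale)
  have "sq_norm ip d (fun_act \<phi> d (\<lambda>i j. complex_of_real (s i * s j) *\<^sub>C T i j) \<xi>)
    = sq_norm ip d (?s (fun_act \<phi> d T (?s \<xi>)))"
    unfolding sq_norm_def by (intro sum.cong refl arg_cong[of _ _ "\<lambda>v. (hnorm ip v)\<^sup>2"] fun_act_congruence \<xi>)
  also have "\<dots> \<le> g * sq_norm ip d (fun_act \<phi> d T (?s \<xi>))" using fun_act_mem[OF s\<xi>] by (intro s_le) simp
  also have "\<dots> \<le> g * ((nrm (to_mat d d T))\<^sup>2 * sq_norm ip d (?s \<xi>))"
    by (intro mult_left_mono fun_act_le d s\<xi> g)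
  also have "\<dots> \<le> g * ((nrm (to_mat d d T))\<^sup>2 * (g * sq_norm ip d \<xi>))"
    by (intro mult_left_mono s_le \<xi> g) simp
  finally show "sq_norm ip d (fun_act \<phi> d (\<lambda>i j. complex_of_real (s i * s j) *\<^sub>C T i j) \<xi>)
    \<le> (g * nrm (to_mat d d T))\<^sup>2 * sq_norm ip d \<xi>" by (simp add: power2_eq_square ac_simps)
qed simp

end

section \<open>Hilbert spaces inside the ambient space\<close>

text \<open>The target space for the representation of a functional on d by d matrices. It is the
  span of d independent vectors of the ambient space, with the inner product that makes them
  orthonormal; completeness is inherited from the coordinates.\<close>

lemma finite_dim_hilbert_space:
  fixes d :: nat
  assumes inf: "infinite_cdim TYPE('h::complex_vector)" and d: "0 < d"
  obtains H :: "'h::complex_vector set" and ip \<beta> co where "complex_hilbert_space H ip"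
    and "\<And>i. i < d \<Longrightarrow> \<beta> i \<in> H"
    and "\<And>i j. i < d \<Longrightarrow> j < d \<Longrightarrow> co (\<beta> i) j = (if i = j then 1 else 0)"
    and "\<And>v. v \<in> H \<Longrightarrow> (\<Sum>i<d. co v i *\<^sub>C \<beta> i) = v"
    and "\<And>v w. v \<in> H \<Longrightarrow> w \<in> H \<Longrightarrow> ip v w = (\<Sum>i<d. co v i * cnj (co w i))"
    and "\<And>v w i. v \<in> H \<Longrightarrow> w \<in> H \<Longrightarrow> co (v + w) i = co v i + co w i"
    and "\<And>c v i. v \<in> H \<Longrightarrow> co (c *\<^sub>C v) i = c * co v i"
proof -
  obtain B :: "'h set" where B: "infinite B" "complex_vector.independent B"
    using inf by (auto simp: infinite_cdim_def cindependent_def)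
  obtain \<beta> :: "nat \<Rightarrow> 'h" where \<beta>: "inj \<beta>" "range \<beta> \<subseteq> B"
    using infinite_countable_subset[OF B(1)] by blast
  define S where "S = \<beta> ` {..<d}"
  define H where "H = complex_vector.span S"
  define co where "co v i = complex_vector.representation S v (\<beta> i)" for v i
  define ip where "ip v w = (\<Sum>i<d. co v i * cnj (co w i))" for v w
  have "S \<subseteq> B" using \<beta> by (auto simp: S_def)
  then have indep: "complex_vector.independent S" using complex_vector.independent_mono[OF B(2)] by blast
  have sub: "csubspace H" unfolding H_def by (rule complex_vector.subspace_span)
  have \<beta>H: "\<beta> i \<in> H" if "i < d" for i
    unfolding H_def S_def using that by (intro complex_vector.span_base) simp
  have co_\<beta>: "co (\<beta> i) j = (if i = j then 1 else 0)" if "i < d" for i j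
    using complex_vector.representation_basis[OF indep, of "\<beta> i"] that inj_eq[OF \<beta>(1)]
    by (auto simp: co_def S_def)
  have expand: "(\<Sum>i<d. co v i *\<^sub>C \<beta> i) = v" if "v \<in> H" for v
  proof -
    have "(\<Sum>b\<in>S. complex_vector.representation S v b *\<^sub>C b) = v"
      using that by (intro complex_vector.sum_representation_eq indep) (auto simp: H_def S_def)
    then show ?thesis unfolding S_def co_def
      by (subst (asm) sum.reindex) (use \<beta>(1) in \<open>auto simp: S_def intro: inj_on_subset\<close>)
  qed
  have co_add: "co (v + w) i = co v i + co w i" if "v \<in> H" "w \<in> H" for v w i
    using that complex_vector.representation_add[OF indep] by (simp add: co_def H_def)
  have co_scale: "co (c *\<^sub>C v) i = c * co v i" if "v \<in> H" for c v i
    using that complex_vector.representation_scale[OF indep] by (simp add: co_def H_def)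
  have co_diff: "co (v - w) i = co v i - co w i" if "v \<in> H" "w \<in> H" for v w i
    using that complex_vector.representation_diff[OF indep] by (simp add: co_def H_def)
  have ip_self: "ip v v = of_real (\<Sum>i<d. (cmod (co v i))\<^sup>2)" for v
    by (simp add: ip_def complex_norm_square flip: of_real_power)
  have hnorm: "hnorm ip v = sqrt (\<Sum>i<d. (cmod (co v i))\<^sup>2)" for v
    by (simp add: hnorm_def ip_self)
  have hilbert: "complex_hilbert_space H ip"
  proof
    show "csubspace H" by (rule sub)
    have "\<beta> 0 \<noteq> 0" using co_\<beta>[of 0 0] d co_scale[of 0 0 0] complex_vector.subspace_0[OF sub] by auto
    then show "H \<noteq> {0}" using \<beta>H[of 0] d by auto
    show "ip (u + v) w = ip u w + ip v w" if "u \<in> H" "v \<in> H" "w \<in> H" for u v w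
      using that by (simp add: ip_def co_add algebra_simps sum.distrib)
    show "ip (c *\<^sub>C u) w = c * ip u w" if "u \<in> H" "w \<in> H" for c u w
      using that by (simp add: ip_def co_scale sum_distrib_left mult.assoc)
    show "ip w u = cnj (ip u w)" for u w
      by (simp add: ip_def mult.commute)
    show "0 < Re (ip u u)" if "u \<in> H" "u \<noteq> 0" for u
    proof -
      have "\<exists>i<d. co u i \<noteq> 0"
      proof (rule ccontr)
        assume "\<not> (\<exists>i<d. co u i \<noteq> 0)"
        then show False using expand[OF that(1)] that(2) by simp
      qed
      then obtain i where "i < d" "co u i \<noteq> 0" by blast
      then have "0 < (\<Sum>i<d. (cmod (co u i))\<^sup>2)" by (intro sum_pos2[of _ i]) auto
      then show ?thesis by (simp add: ip_self)
    qed
    fix s :: "nat \<Rightarrow> 'h"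
    assume s: "\<And>k. s k \<in> H"
      and Cau: "\<And>\<epsilon>. 0 < \<epsilon> \<Longrightarrow> \<exists>N. \<forall>i\<ge>N. \<forall>j\<ge>N. hnorm ip (s i - s j) < \<epsilon>"
    have "\<exists>l. (\<lambda>k. co (s k) i) \<longlonglongrightarrow> l" if i: "i < d" for i
    proof -
      have "Cauchy (\<lambda>k. co (s k) i)" unfolding Cauchy_def
      proof (intro allI impI)
        fix \<epsilon> :: real assume "0 < \<epsilon>"
        then obtain N where N: "\<And>a b. a \<ge> N \<Longrightarrow> b \<ge> N \<Longrightarrow> hnorm ip (s a - s b) < \<epsilon>" using Cau by blast
        have "dist (co (s a) i) (co (s b) i) < \<epsilon>" if "a \<ge> N" "b \<ge> N" for a b
        proof -
          have "cmod (co (s a - s b) i) \<le> hnorm ip (s a - s b)"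
            unfolding hnorm using i by (intro real_le_rsqrt member_le_sum) auto
          then show ?thesis using N[OF that] s by (simp add: dist_norm co_diff)
        qed
        then show "\<exists>N. \<forall>a\<ge>N. \<forall>b\<ge>N. dist (co (s a) i) (co (s b) i) < \<epsilon>" by blast
      qed
      then show ?thesis by (simp add: Cauchy_convergent_iff convergent_def)
    qed
    then obtain l where l: "\<And>i. i < d \<Longrightarrow> (\<lambda>k. co (s k) i) \<longlonglongrightarrow> l i" by metis
    let ?l = "\<Sum>i<d. l i *\<^sub>C \<beta> i"
    have lH: "?l \<in> H"
      by (intro complex_vector.subspace_sum[OF sub] complex_vector.subspace_scale[OF sub]) (simp add: \<beta>H)
    have co_l: "co ?l i = l i" if i: "i < d" for i
    proof -
      have "co ?l i = (\<Sum>j<d. co (l j *\<^sub>C \<beta> j) i)" unfolding co_def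
        by (subst complex_vector.representation_sum[OF indep])
          (use \<beta>H in \<open>auto simp: H_def intro: complex_vector.span_scale\<close>)
      also have "\<dots> = (\<Sum>j<d. if j = i then l i else 0)"
        by (rule sum.cong) (auto simp: co_scale \<beta>H co_\<beta>)
      finally show ?thesis using i by simp
    qed
    have "(\<lambda>k. sqrt (\<Sum>i<d. (cmod (co (s k) i - l i))\<^sup>2)) \<longlonglongrightarrow> sqrt (\<Sum>i<d. (cmod (l i - l i))\<^sup>2)"
      by (intro tendsto_intros l) auto
    then have "(\<lambda>k. hnorm ip (s k - ?l)) \<longlonglongrightarrow> 0"
      using s lH by (simp add: hnorm co_diff co_l)
    with lH show "\<exists>l\<in>H. (\<lambda>k. hnorm ip (s k - l)) \<longlonglongrightarrow> 0" by blast
  qed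
  show thesis
    by (rule that[of H ip \<beta> co])
      (use hilbert \<beta>H co_\<beta> expand co_add co_scale in \<open>simp_all add: ip_def\<close>)
qed

text \<open>Positivity of \<open>S\<close> is known only on combinations of the \<open>b i\<close>.
  Hence the induction also carries the fact that each \<open>q p\<close> is such a combination: the
  next remainder then stays where \<open>S\<close> is positive and can be normalized.\<close>

lemma gram_schmidt:
  fixes S :: "'a::complex_vector \<Rightarrow> 'a \<Rightarrow> complex" and d :: nat
  assumes S_add: "\<And>u v w. S (u + v) w = S u w + S v w"
    and S_scale: "\<And>c u w. S (c *\<^sub>C u) w = c * S u w"
    and S_herm: "\<And>u v. S v u = cnj (S u v)"
    and pos: "\<And>c. \<exists>i<d. c i \<noteq> 0 \<Longrightarrow> 0 < Re (S (\<Sum>i<d. c i *\<^sub>C b i) (\<Sum>i<d. c i *\<^sub>C b i))"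
  shows "\<exists>q. (\<forall>i<d. \<forall>j<d. S (q i) (q j) = (if i = j then 1 else 0)) \<and>
    (\<forall>i<d. b i = (\<Sum>p<d. S (b i) (q p) *\<^sub>C q p)) \<and> (\<forall>p<d. \<exists>c. q p = (\<Sum>i<d. c i *\<^sub>C b i))"
  using pos
proof (induction d)
  case (Suc d)
  have S_zero: "S 0 w = 0" for w using S_scale[of 0 0 w] by simp
  have S_sum: "S (\<Sum>i\<in>I. u i) w = (\<Sum>i\<in>I. S (u i) w)" for I :: "nat set" and u w
    by (induction I rule: infinite_finite_induct) (simp_all add: S_zero S_add)
  have S_scale_right: "S u (c *\<^sub>C w) = cnj c * S u w" for c u w
    by (subst S_herm, subst (2) S_herm) (simp add: S_scale)
  have "0 < Re (S (\<Sum>i<d. c i *\<^sub>C b i) (\<Sum>i<d. c i *\<^sub>C b i))" if "\<exists>i<d. c i \<noteq> 0" for c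
  proof -
    have "\<exists>i<Suc d. (if i < d then c i else 0) \<noteq> 0" using that by (auto simp: less_Suc_eq)
    from Suc.prems[OF this] show ?thesis by simp
  qed
  from Suc.IH[OF this] obtain q where ortho: "\<And>i j. i < d \<Longrightarrow> j < d \<Longrightarrow> S (q i) (q j) = (if i = j then 1 else 0)"
    and b: "\<And>i. i < d \<Longrightarrow> b i = (\<Sum>p<d. S (b i) (q p) *\<^sub>C q p)"
    and "\<forall>p<d. \<exists>c. q p = (\<Sum>i<d. c i *\<^sub>C b i)" by blast
  then obtain c where c: "\<And>p. p < d \<Longrightarrow> q p = (\<Sum>i<d. c p i *\<^sub>C b i)" by metis
  \<comment> \<open>The part of \<open>b d\<close> orthogonal to the earlier \<open>q p\<close>. Its
    coefficient at \<open>b d\<close> is 1, so it is a nontrivial combination and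
    \<open>S v v\<close> is positive.\<close>
  define v where "v = b d + (\<Sum>p<d. (- S (b d) (q p)) *\<^sub>C q p)"
  have bd: "b d = v + (\<Sum>p<d. S (b d) (q p) *\<^sub>C q p)"
    by (simp add: v_def complex_vector.scale_minus_left sum_negf)
  have Sv: "S v (q j) = 0" if j: "j < d" for j
  proof -
    have "S v (q j) = S (b d) (q j) + (\<Sum>p<d. - S (b d) (q p) * S (q p) (q j))"
      by (simp only: v_def S_add S_sum S_scale)
    also have "(\<Sum>p<d. - S (b d) (q p) * S (q p) (q j)) = (\<Sum>p<d. if p = j then - S (b d) (q j) else 0)"
      by (rule sum.cong) (auto simp: ortho j)
    finally show ?thesis using j by simp
  qed
  have vS: "S (q j) v = 0" if "j < d" for j using S_herm[of "q j" v] Sv[OF that] by simp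
  have v_span: "v = (\<Sum>i<Suc d. (if i = d then 1 else (\<Sum>p<d. - S (b d) (q p) * c p i)) *\<^sub>C b i)"
  proof -
    have "(\<Sum>p<d. (- S (b d) (q p)) *\<^sub>C q p) = (\<Sum>p<d. \<Sum>i<d. (- S (b d) (q p) * c p i) *\<^sub>C b i)"
      by (rule sum.cong) (simp_all add: c complex_vector.scale_sum_right scaleC_scaleC)
    also have "\<dots> = (\<Sum>i<d. (\<Sum>p<d. - S (b d) (q p) * c p i) *\<^sub>C b i)"
      by (subst sum.swap) (simp only: complex_vector.scale_sum_left)
    finally show ?thesis by (simp add: v_def scaleC_one)
  qed
  have pos_v: "0 < Re (S v v)"
  proof -
    let ?c = "\<lambda>i. if i = d then 1 else (\<Sum>p<d. - S (b d) (q p) * c p i)"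
    have "\<exists>i<Suc d. ?c i \<noteq> 0" by (intro exI[of _ d]) simp
    from Suc.prems[of ?c, OF this] show ?thesis unfolding v_span[symmetric] .
  qed
  have Svv: "S v v = of_real (Re (S v v))"
    using arg_cong[OF S_herm[of v v], of Im] by (simp add: complex_eq_iff)
  define r where "r = sqrt (Re (S v v))"
  have r: "0 < r" "S v v = of_real r * of_real r"
    using pos_v Svv by (simp_all add: r_def flip: of_real_mult)
  define q' where "q' = q(d := of_real (1 / r) *\<^sub>C v)"
  have q': "q' i = q i" if "i < d" for i using that by (simp add: q'_def)
  have q'd: "q' d = of_real (1 / r) *\<^sub>C v" by (simp add: q'_def)
  have "S (q' i) (q' j) = (if i = j then 1 else 0)" if "i < Suc d" "j < Suc d" for i j
    using that less_Suc_eq r by (auto simp: q' q'd ortho S_scale S_scale_right Sv vS)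
  moreover have "b i = (\<Sum>p<Suc d. S (b i) (q' p) *\<^sub>C q' p)" if i: "i < Suc d" for i
  proof (cases "i = d")
    case True
    have "S (b d) v = S v v"
      by (subst bd) (simp add: S_add S_sum S_scale vS)
    then have "S (b d) (q' d) *\<^sub>C q' d = v"
      using r by (simp add: q'd S_scale_right scaleC_scaleC scaleC_one)
    then show ?thesis using bd True by (simp add: q' add.commute)
  next
    case False
    then have i: "i < d" using i by simp
    have "S (b i) v = 0" by (subst b[OF i]) (simp add: S_sum S_scale vS)
    then have "S (b i) (q' d) = 0" by (simp add: q'd S_scale_right)
    then show ?thesis using b[OF i] by (simp add: q')
  qed
  moreover have "\<exists>c. q' p = (\<Sum>i<Suc d. c i *\<^sub>C b i)" if p: "p < Suc d" for p
  proof (cases "p = d")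
    case True
    let ?c = "\<lambda>i. if i = d then 1 else (\<Sum>p<d. - S (b d) (q p) * c p i)"
    have "q' p = of_real (1 / r) *\<^sub>C (\<Sum>i<Suc d. ?c i *\<^sub>C b i)"
      using True unfolding v_span[symmetric] by (simp only: q'd)
    also have "\<dots> = (\<Sum>i<Suc d. (of_real (1 / r) * ?c i) *\<^sub>C b i)"
      by (simp only: complex_vector.scale_sum_right scaleC_scaleC)
    finally show ?thesis by (intro exI[of _ "\<lambda>i. of_real (1 / r) * ?c i"])
  next
    case False
    then have p: "p < d" using p by simp
    have "q' p = (\<Sum>i<Suc d. (if i < d then c p i else 0) *\<^sub>C b i)" using p c[OF p] by (simp add: q')
    then show ?thesis by (intro exI[of _ "\<lambda>i. if i < d then c p i else 0"])
  qed
  ultimately show ?case by blast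
qed simp

section \<open>Representing positive functionals by ucc maps\<close>

context uci_map
begin

text \<open>A functional on d by d matrices over the space amounts to a map into operators on a
  d-dimensional space, whose sesquilinear forms are the values of the functional on rank one
  coefficient matrices. Unitality holds because the form at \<open>e\<close> is taken as the inner
  product, which is why it must be definite. Testing a matrix of any size against vectors of that
  space gives a d by d matrix again, so positivity at size d yields contractivity at all
  sizes.\<close>

lemma positive_functional_representation:
  fixes f :: "(nat \<Rightarrow> nat \<Rightarrow> 'b) \<Rightarrow> real"
  assumes inf: "infinite_cdim TYPE('k::complex_vector)" and d: "0 < d"
    and f_add: "\<And>Z W. f (Z + W) = f Z + f W"
    and f_scale: "\<And>r Z. f (complex_of_real r *\<^sub>C Z) = r * f Z"
    and f_pos: "\<And>Z. accretive H ip \<phi> d Z \<Longrightarrow> 0 \<le> f Z"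
    and f_definite: "\<And>u. \<exists>i<d. u i \<noteq> 0 \<Longrightarrow> 0 < f (\<lambda>i j. (cnj (u i) * u j) *\<^sub>C e)"
  shows "\<exists>(H' :: 'k set) ip' \<psi> \<beta>. ucc_map H' ip' \<psi> e nrm \<and> (\<forall>i<d. \<beta> i \<in> H') \<and>
    (\<forall>Z. f Z = quad ip' \<psi> d Z \<beta>) \<and>
    (\<forall>x. (\<forall>c. f (\<lambda>i j. c i j *\<^sub>C x) = 0) \<longrightarrow> x \<in> op_kernel H' \<psi>)"
proof -
  have f_zero: "f 0 = 0" using f_add[of 0 0] by simp
  have f_neg: "f (- Z) = - f Z" for Z using f_add[of Z "- Z"] f_zero by simp
  have f_diff: "f (Z - W) = f Z - f W" for Z W using f_add[of Z "- W"] f_neg by simp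
  have f_sum: "f (\<Sum>i\<in>I. Z i) = (\<Sum>i\<in>I. f (Z i))" for Z and I :: "nat set"
    by (rule additive.sum[OF additive.intro, of f, OF f_add])
  \<comment> \<open>Such a \<open>Z\<close> and its negative are both accretive. This covers changes
    of entries beyond d as well as multiples of the unit by \<i>.\<close>
  have f_null: "f Z = 0" if "\<And>\<xi>. (\<forall>j<d. \<xi> j \<in> H) \<Longrightarrow> quad ip \<phi> d Z \<xi> = 0" for Z
  proof -
    have "quad ip \<phi> d (- Z) \<xi> = 0" if \<xi>: "\<forall>j<d. \<xi> j \<in> H" for \<xi>
      using quad_scale[OF \<xi>, of "-1" Z] \<open>\<And>\<xi>. (\<forall>j<d. \<xi> j \<in> H) \<Longrightarrow> quad ip \<phi> d Z \<xi> = 0\<close>[OF \<xi>]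
      by (simp add: complex_vector.scale_minus_left scaleC_one)
    then have "0 \<le> f (- Z)" "0 \<le> f Z" using that by (auto intro!: f_pos simp: accretive_def)
    then show ?thesis by (simp add: f_neg)
  qed
  have f_cong: "f Z = f W" if eq: "\<And>i j. i < d \<Longrightarrow> j < d \<Longrightarrow> Z i j = W i j" for Z W
  proof -
    have "quad ip \<phi> d (Z - W) \<xi> = 0" if "\<forall>j<d. \<xi> j \<in> H" for \<xi>
      using that unfolding quad_def by (intro sum.neutral ballI) (simp add: eq map_zero)
    then have "f (Z - W) = 0" by (rule f_null)
    then show ?thesis by (simp add: f_diff)
  qed
  have f_complex: "f (c *\<^sub>C Z) = Re c * f Z + Im c * f (\<i> *\<^sub>C Z)" for c Z
  proof -
    have "c *\<^sub>C Z = (complex_of_real (Re c) + complex_of_real (Im c) * \<i>) *\<^sub>C Z"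
      by (simp add: complex_eq mult.commute)
    also have "\<dots> = complex_of_real (Re c) *\<^sub>C Z + complex_of_real (Im c) *\<^sub>C (\<i> *\<^sub>C Z)"
      by (simp only: scaleC_add_left scaleC_scaleC)
    finally show ?thesis by (simp only: f_add f_scale)
  qed
  \<comment> \<open>The usual complexification: the complex linear functional with real part
    \<open>f\<close>, which itself is only real linear.\<close>
  define fC where "fC Z = Complex (f Z) (- f (\<i> *\<^sub>C Z))" for Z
  have fC_add: "fC (Z + W) = fC Z + fC W" for Z W
    by (simp add: fC_def complex_eq_iff scaleC_add_right f_add)
  have fC_scale: "fC (c *\<^sub>C Z) = c * fC Z" for c Z
    by (simp add: fC_def complex_eq_iff scaleC_scaleC f_complex[of c] f_complex[of "\<i> * c"] algebra_simps)
  define F where "F x u v = fC (\<lambda>i j. (cnj (v i) * u j) *\<^sub>C x)" for x and u v :: "nat \<Rightarrow> complex"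
  have Re_F: "Re (F x u v) = f (\<lambda>i j. (cnj (v i) * u j) *\<^sub>C x)" for x u v by (simp add: F_def fC_def)
  have F_add: "F (x + y) u v = F x u v + F y u v" for x y u v
    unfolding F_def fC_add[symmetric] by (simp add: plus_fun_def scaleC_add_right)
  have F_scale: "F (c *\<^sub>C x) u v = c * F x u v" for c x u v
    unfolding F_def fC_scale[symmetric] by (simp add: scaleC_fun_def scaleC_scaleC ac_simps)
  have F_add_u: "F x (u + w) v = F x u v + F x w v" for x u v w
    unfolding F_def fC_add[symmetric] by (simp add: plus_fun_def scaleC_add_left algebra_simps)
  have F_scale_u: "F x (c *\<^sub>C u) v = c * F x u v" for c x u v
    unfolding F_def fC_scale[symmetric] by (simp add: scaleC_fun_def scaleC_scaleC ac_simps)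
  have F_add_v: "F x u (v + w) = F x u v + F x u w" for x u v w
    unfolding F_def fC_add[symmetric] by (simp add: plus_fun_def scaleC_add_left algebra_simps)
  have F_scale_v: "F x u (c *\<^sub>C v) = cnj c * F x u v" for c x u v
    unfolding F_def fC_scale[symmetric] by (simp add: scaleC_fun_def scaleC_scaleC ac_simps)
  have F_sum_u: "F x (\<Sum>i\<in>I. u i) v = (\<Sum>i\<in>I. F x (u i) v)" for x u v and I :: "nat set"
    by (rule additive.sum[OF additive.intro, of "\<lambda>u. F x u v"]) (rule F_add_u)
  have F_sum_v: "F x v (\<Sum>i\<in>I. u i) = (\<Sum>i\<in>I. F x v (u i))" for x u v and I :: "nat set"
    by (rule additive.sum[OF additive.intro, of "\<lambda>u. F x v u"]) (rule F_add_v)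
  have Im_F: "Im (F e u u) = 0" for u
  proof -
    have "f (\<lambda>i j. (cnj (u i) * u j) *\<^sub>C (\<i> *\<^sub>C e)) = 0"
    proof (rule f_null)
      fix \<xi> assume \<xi>: "\<forall>j<d. \<xi> j \<in> H"
      let ?v = "\<Sum>j<d. u j *\<^sub>C \<xi> j"
      have v: "?v \<in> H" using \<xi> by (intro mem_sum mem_scale) auto
      show "quad ip \<phi> d (\<lambda>i j. (cnj (u i) * u j) *\<^sub>C (\<i> *\<^sub>C e)) \<xi> = 0"
        unfolding quad_rank_one[OF \<xi>] using v
        by (subst map_scale[OF v], subst map_unit[OF v], subst ip_scale[OF v v], subst ip_self[OF v]) simp
    qed
    moreover have "(\<lambda>i j. (cnj (u i) * u j) *\<^sub>C (\<i> *\<^sub>C e)) = \<i> *\<^sub>C (\<lambda>i j. (cnj (u i) * u j) *\<^sub>C e)"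
      by (simp add: scaleC_fun_def scaleC_scaleC ac_simps)
    ultimately show ?thesis by (simp add: F_def fC_def)
  qed
  \<comment> \<open>Polarization: the diagonal values are real at \<open>u + v\<close> and at
    \<open>u + \<i> v\<close>, which fixes the imaginary and the real part of the two mixed
    terms.\<close>
  have F_herm: "F e v u = cnj (F e u v)" for u v
    using Im_F[of "u + v"] Im_F[of "u + \<i> *\<^sub>C v"]
    by (simp add: complex_eq_iff F_add_u F_add_v F_scale_u F_scale_v Im_F)
  define \<delta> where "\<delta> i = (\<lambda>j. if j = i then 1 else 0 :: complex)" for i :: nat
  have "\<exists>q. (\<forall>i<d. \<forall>j<d. F e (q i) (q j) = (if i = j then 1 else 0)) \<and>
    (\<forall>i<d. \<delta> i = (\<Sum>p<d. F e (\<delta> i) (q p) *\<^sub>C q p)) \<and> (\<forall>p<d. \<exists>c. q p = (\<Sum>i<d. c i *\<^sub>C \<delta> i))"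
  proof (rule gram_schmidt)
    fix c :: "nat \<Rightarrow> complex" assume "\<exists>i<d. c i \<noteq> 0"
    moreover have "(\<Sum>i<d. c i *\<^sub>C \<delta> i) = (\<lambda>i. if i < d then c i else 0)"
    proof
      fix x
      have "(\<Sum>i<d. c i *\<^sub>C \<delta> i) x = (\<Sum>i<d. if i = x then c x else 0)"
        unfolding sum_fun_apply by (rule sum.cong) (auto simp: \<delta>_def)
      then show "(\<Sum>i<d. c i *\<^sub>C \<delta> i) x = (if x < d then c x else 0)" by simp
    qed
    ultimately show "0 < Re (F e (\<Sum>i<d. c i *\<^sub>C \<delta> i) (\<Sum>i<d. c i *\<^sub>C \<delta> i))"
      unfolding Re_F by (intro f_definite) auto
  qed (rule F_add_u F_scale_u F_herm)+
  then obtain q where q: "\<And>i j. i < d \<Longrightarrow> j < d \<Longrightarrow> F e (q i) (q j) = (if i = j then 1 else 0)"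
    and \<delta>: "\<And>i. i < d \<Longrightarrow> \<delta> i = (\<Sum>p<d. F e (\<delta> i) (q p) *\<^sub>C q p)" by blast
  obtain H' :: "'k set" and ip' \<beta> co where H': "complex_hilbert_space H' ip'"
    and \<beta>: "\<And>i. i < d \<Longrightarrow> \<beta> i \<in> H'"
    and co_\<beta>: "\<And>i j. i < d \<Longrightarrow> j < d \<Longrightarrow> co (\<beta> i) j = (if i = j then 1 else 0)"
    and expand: "\<And>v. v \<in> H' \<Longrightarrow> (\<Sum>i<d. co v i *\<^sub>C \<beta> i) = v"
    and ip': "\<And>v w. v \<in> H' \<Longrightarrow> w \<in> H' \<Longrightarrow> ip' v w = (\<Sum>i<d. co v i * cnj (co w i))"
    and co_add: "\<And>v w i. v \<in> H' \<Longrightarrow> w \<in> H' \<Longrightarrow> co (v + w) i = co v i + co w i"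
    and co_scale: "\<And>c v i. v \<in> H' \<Longrightarrow> co (c *\<^sub>C v) i = c * co v i"
  proof (rule finite_dim_hilbert_space[OF inf d], goal_cases)
    case (1 H ip \<beta> co)
    show ?case by (rule 1(1)) (fact 1)+
  qed
  interpret H': complex_hilbert_space H' ip' by (rule H')
  have co_sum: "co (\<Sum>i<d. c i *\<^sub>C \<beta> i) j = c j" if j: "j < d" for c j
  proof -
    have "co (\<Sum>i\<in>I. c i *\<^sub>C \<beta> i) j = (\<Sum>i\<in>I. c i * co (\<beta> i) j)" if "I \<subseteq> {..<d}" for I
      using finite_subset[OF that finite_lessThan] that
    proof (induction I rule: finite_induct)
      case empty show ?case using co_scale[of 0 0 j] by simp
    next
      case (insert i I)
      then have "\<beta> i \<in> H'" "(\<Sum>i\<in>I. c i *\<^sub>C \<beta> i) \<in> H'"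
        using \<beta> by (auto intro!: H'.mem_sum H'.mem_scale)
      with insert show ?case by (simp add: co_add co_scale H'.mem_scale)
    qed
    then have "co (\<Sum>i<d. c i *\<^sub>C \<beta> i) j = (\<Sum>i<d. c i * co (\<beta> i) j)" by simp
    also have "\<dots> = (\<Sum>i<d. if i = j then c j else 0)" by (rule sum.cong) (auto simp: co_\<beta> j)
    finally show ?thesis using j by simp
  qed
  \<comment> \<open>Sends the orthonormal basis \<open>\<beta>\<close> to \<open>q\<close>. It
    identifies \<open>H'\<close> isometrically with coefficient vectors under the form
    \<open>F e\<close>, so \<open>\<psi> x\<close> is the operator whose form is
    \<open>F x\<close>.\<close>
  define cv where "cv v = (\<Sum>p<d. co v p *\<^sub>C q p)" for v
  have cv_add: "cv (v + w) = cv v + cv w" if "v \<in> H'" "w \<in> H'" for v w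
    using that by (simp add: cv_def co_add scaleC_add_left sum.distrib)
  have cv_scale: "cv (c *\<^sub>C v) = c *\<^sub>C cv v" if "v \<in> H'" for c v
    using that by (simp add: cv_def co_scale complex_vector.scale_sum_right scaleC_scaleC)
  define \<psi> where "\<psi> x v = (\<Sum>p<d. F x (cv v) (q p) *\<^sub>C \<beta> p)" for x v
  have \<psi>_mem: "\<psi> x v \<in> H'" for x v
    unfolding \<psi>_def using \<beta> by (intro H'.mem_sum H'.mem_scale) auto
  have ip_\<psi>: "ip' (\<psi> x v) w = F x (cv v) (cv w)" if "w \<in> H'" for x v w
    using that \<psi>_mem[of x v] unfolding cv_def[of w]
    by (simp add: ip' F_sum_v F_scale_v) (simp add: \<psi>_def co_sum mult.commute)
  have F_e: "F e (cv v) (q p) = co v p" if p: "p < d" for v p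
  proof -
    have "F e (cv v) (q p) = (\<Sum>i<d. if i = p then co v p else 0)"
      unfolding cv_def F_sum_u by (rule sum.cong) (auto simp: F_scale_u q p)
    then show ?thesis using p by simp
  qed
  have \<psi>_e: "\<psi> e v = v" if "v \<in> H'" for v
  proof -
    have "\<psi> e v = (\<Sum>p<d. co v p *\<^sub>C \<beta> p)" unfolding \<psi>_def by (rule sum.cong) (simp_all add: F_e)
    then show ?thesis using expand[OF that] by simp
  qed
  have hnorm': "(hnorm ip' v)\<^sup>2 = f (\<lambda>i j. (cnj (cv v i) * cv v j) *\<^sub>C e)" if "v \<in> H'" for v
    using ip_\<psi>[of v e v] that by (simp add: H'.hnorm_sq \<psi>_e Re_F)
  have bilinear: "0 \<le> 2 * (\<Sum>i<m. \<Sum>j<k. Re (ip' (\<psi> (B i j) (\<xi> j)) (\<eta> i)))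
      + nrm (to_mat m k B) * (sq_norm ip' k \<xi> + sq_norm ip' m \<eta>)"
    if m: "0 < m" and k: "0 < k" and \<xi>: "\<forall>j<k. \<xi> j \<in> H'" and \<eta>: "\<forall>i<m. \<eta> i \<in> H'" for m k B \<xi> \<eta>
  proof -
    define s where "s = nrm (to_mat m k B)"
    have s: "0 \<le> s" unfolding s_def using m k by (intro nrm_nonneg) auto
    let ?R = "\<lambda>x v w i j. (cnj (cv w i) * cv v j) *\<^sub>C x"
    define Z1 where "Z1 = (\<Sum>i<m. \<Sum>j<k. ?R (B i j) (\<xi> j) (\<eta> i))"
    define Z2 where "Z2 = (\<Sum>j<k. ?R e (\<xi> j) (\<xi> j))"
    define Z3 where "Z3 = (\<Sum>i<m. ?R e (\<eta> i) (\<eta> i))"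
    \<comment> \<open>On a column \<open>\<zeta>\<close> the form of \<open>?Z\<close> is the
      expression of \<open>bilinear_bound\<close> for the columns \<open>X\<close> and
      \<open>Y\<close> obtained by combining the \<open>\<zeta> i\<close>. Thus contractivity of the
      given isometric map becomes accretivity of one d by d matrix, to which \<open>f\<close>
      applies.\<close>
    let ?Z = "complex_of_real 2 *\<^sub>C Z1 + complex_of_real s *\<^sub>C (Z2 + Z3)"
    have "accretive H ip \<phi> d ?Z" unfolding accretive_def
    proof (intro allI impI)
      fix \<zeta> assume \<zeta>: "\<forall>j<d. \<zeta> j \<in> H"
      define X where "X j = (\<Sum>i<d. cv (\<xi> j) i *\<^sub>C \<zeta> i)" for j
      define Y where "Y j = (\<Sum>i<d. cv (\<eta> j) i *\<^sub>C \<zeta> i)" for j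
      have X: "X j \<in> H" and Y: "Y j \<in> H" for j
        unfolding X_def Y_def using \<zeta> by (auto intro!: mem_sum mem_scale)
      have aX: "fun_act \<phi> k B X i \<in> H" for i using X by (simp add: fun_act_mem)
      have q1: "quad ip \<phi> d Z1 \<zeta> = (\<Sum>i<m. \<Sum>j<k. Re (ip (\<phi> (B i j) (X j)) (Y i)))"
        by (simp only: Z1_def quad_sum[OF \<zeta>] quad_rank_one[OF \<zeta>] X_def Y_def)
      also have "\<dots> = (\<Sum>i<m. Re (ip (fun_act \<phi> k B X i) (Y i)))"
        unfolding fun_act_def using X Y by (simp add: ip_sum_left map_mem)
      finally have q1: "quad ip \<phi> d Z1 \<zeta> = (\<Sum>i<m. Re (ip (fun_act \<phi> k B X i) (Y i)))" .
      have q2: "quad ip \<phi> d (Z2 + Z3) \<zeta> = sq_norm ip k X + sq_norm ip m Y"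
      proof -
        have "quad ip \<phi> d (Z2 + Z3) \<zeta> = (\<Sum>j<k. Re (ip (\<phi> e (X j)) (X j))) + (\<Sum>j<m. Re (ip (\<phi> e (Y j)) (Y j)))"
          by (simp only: quad_add[OF \<zeta>, of Z2 Z3], simp only: Z2_def Z3_def quad_sum[OF \<zeta>] quad_rank_one[OF \<zeta>] X_def Y_def)
        then show ?thesis using X Y by (simp add: map_unit sq_norm_def hnorm_sq)
      qed
      have bound: "sq_norm ip m (fun_act \<phi> k B X) \<le> s\<^sup>2 * sq_norm ip k X"
        unfolding s_def using X by (intro fun_act_le m k) simp
      have "0 \<le> 2 * (\<Sum>i<m. Re (ip (fun_act \<phi> k B X i) (Y i))) + s * (sq_norm ip k X + sq_norm ip m Y)"
        using aX Y s bound by (rule bilinear_bound)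
      then show "0 \<le> quad ip \<phi> d ?Z \<zeta>" 
        by (simp only: quad_add[OF \<zeta>, of "complex_of_real 2 *\<^sub>C Z1" "complex_of_real s *\<^sub>C (Z2 + Z3)"]
            quad_scale[OF \<zeta>, of _ Z1] quad_scale[OF \<zeta>, of _ "Z2 + Z3"] q1 q2)
    qed
    then have "0 \<le> f ?Z" by (rule f_pos)
    also have "f ?Z = 2 * (\<Sum>i<m. \<Sum>j<k. f (?R (B i j) (\<xi> j) (\<eta> i)))
        + s * ((\<Sum>j<k. f (?R e (\<xi> j) (\<xi> j))) + (\<Sum>i<m. f (?R e (\<eta> i) (\<eta> i))))"
      by (simp only: f_add[of "complex_of_real 2 *\<^sub>C Z1" "complex_of_real s *\<^sub>C (Z2 + Z3)"]
          f_scale[of _ Z1] f_scale[of _ "Z2 + Z3"] f_add[of Z2 Z3], simp only: Z1_def Z2_def Z3_def f_sum)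
    also have "\<dots> = 2 * (\<Sum>i<m. \<Sum>j<k. Re (ip' (\<psi> (B i j) (\<xi> j)) (\<eta> i)))
      + s * (sq_norm ip' k \<xi> + sq_norm ip' m \<eta>)"
      using \<xi> \<eta> by (simp add: sq_norm_def hnorm' ip_\<psi> Re_F)
    finally show ?thesis by (simp only: s_def)
  qed
  have contr: "sq_norm ip' m (fun_act \<psi> k B \<xi>) \<le> (nrm (to_mat m k B))\<^sup>2 * sq_norm ip' k \<xi>"
    if m: "0 < m" and k: "0 < k" and \<xi>: "\<forall>j<k. \<xi> j \<in> H'" for m k B \<xi>
  proof -
    define s where "s = nrm (to_mat m k B)"
    have s: "0 \<le> s" unfolding s_def using m k by (intro nrm_nonneg) auto
    let ?a = "fun_act \<psi> k B \<xi>"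
    have a: "?a i \<in> H'" for i unfolding fun_act_def by (intro H'.mem_sum \<psi>_mem)
    have ineq: "2 * t * sq_norm ip' m ?a \<le> s * sq_norm ip' k \<xi> + s * t\<^sup>2 * sq_norm ip' m ?a" for t
    proof -
      \<comment> \<open>Testing against a negative multiple of the image itself turns the bilinear
        inequality into a norm estimate. For \<open>s > 0\<close> the best parameter is
        \<open>t = 1 / s\<close>; for \<open>s = 0\<close> any positive \<open>t\<close> forces the
        image to have norm zero.\<close>
      let ?\<eta> = "\<lambda>i. complex_of_real (- t) *\<^sub>C ?a i"
      have "0 \<le> 2 * (\<Sum>i<m. \<Sum>j<k. Re (ip' (\<psi> (B i j) (\<xi> j)) (?\<eta> i)))
        + s * (sq_norm ip' k \<xi> + sq_norm ip' m ?\<eta>)"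
        unfolding s_def by (intro bilinear m k \<xi> allI impI H'.mem_scale a)
      also have "(\<Sum>i<m. \<Sum>j<k. Re (ip' (\<psi> (B i j) (\<xi> j)) (?\<eta> i))) = (\<Sum>i<m. - t * (hnorm ip' (?a i))\<^sup>2)"
      proof (rule sum.cong[OF refl])
        fix i
        have "(\<Sum>j<k. ip' (\<psi> (B i j) (\<xi> j)) (?\<eta> i)) = ip' (?a i) (?\<eta> i)"
          unfolding fun_act_def[of \<psi> k B \<xi>]
          by (rule H'.ip_sum_left[symmetric]) (intro ballI H'.mem_scale H'.mem_sum \<psi>_mem)+
        also have "\<dots> = of_real (- t) * ip' (?a i) (?a i)" using a by (subst H'.ip_scale_right) auto
        finally have "Re (\<Sum>j<k. ip' (\<psi> (B i j) (\<xi> j)) (?\<eta> i)) = - t * Re (ip' (?a i) (?a i))" by simp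
        then show "(\<Sum>j<k. Re (ip' (\<psi> (B i j) (\<xi> j)) (?\<eta> i))) = - t * (hnorm ip' (?a i))\<^sup>2"
          using a by (simp only: Re_sum H'.hnorm_sq)
      qed
      also have "\<dots> = - t * sq_norm ip' m ?a" by (simp add: sq_norm_def sum_distrib_left)
      also have "sq_norm ip' m ?\<eta> = t\<^sup>2 * sq_norm ip' m ?a" using a by (subst H'.sq_norm_scale) auto
      finally show ?thesis by (simp add: algebra_simps)
    qed
    show ?thesis
    proof (cases "s = 0")
      case True
      then show ?thesis using ineq[of 1] by (simp add: s_def)
    next
      case False
      with s have s0: "0 < s" by simp
      have "2 * (1 / s) * sq_norm ip' m ?a \<le> s * sq_norm ip' k \<xi> + (1 / s) * sq_norm ip' m ?a"
        using ineq[of "1 / s"] s0 by (simp add: power2_eq_square)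
      then have "sq_norm ip' m ?a / s \<le> s * sq_norm ip' k \<xi>" by simp
      then show ?thesis using s0 by (simp add: divide_le_eq power2_eq_square ac_simps flip: s_def)
    qed
  qed
  have lin: "op_linear H' ip' \<psi>" unfolding op_linear_def
  proof (intro conjI allI ballI)
    show "\<psi> (x + y) v = \<psi> x v + \<psi> y v" if "v \<in> H'" for x y v
      by (simp add: \<psi>_def F_add scaleC_add_left sum.distrib)
    show "\<psi> (c *\<^sub>C x) v = c *\<^sub>C \<psi> x v" if "v \<in> H'" for c x v
      by (simp add: \<psi>_def F_scale complex_vector.scale_sum_right scaleC_scaleC)
    show "bounded_op H' ip' (\<psi> x)" for x unfolding bounded_op_def
    proof (intro conjI allI ballI)
      show "\<psi> x v \<in> H'" for v by (rule \<psi>_mem)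
      show "\<psi> x (u + v) = \<psi> x u + \<psi> x v" if "u \<in> H'" "v \<in> H'" for u v
        using that by (simp add: \<psi>_def cv_add F_add_u scaleC_add_left sum.distrib)
      show "\<psi> x (c *\<^sub>C v) = c *\<^sub>C \<psi> x v" if "v \<in> H'" for c v
        using that by (simp add: \<psi>_def cv_scale F_scale_u complex_vector.scale_sum_right scaleC_scaleC)
      let ?s = "nrm (to_mat 1 1 (\<lambda>_ _. x))"
      have "hnorm ip' (\<psi> x v) \<le> ?s * hnorm ip' v" if v: "v \<in> H'" for v
      proof (rule power2_le_imp_le)
        show "(hnorm ip' (\<psi> x v))\<^sup>2 \<le> (?s * hnorm ip' v)\<^sup>2"
          using contr[of 1 1 "\<lambda>_. v" "\<lambda>_ _. x"] v
          by (simp add: sq_norm_def fun_act_def power_mult_distrib)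
        show "0 \<le> ?s * hnorm ip' v" using v by (intro mult_nonneg_nonneg nrm_nonneg H'.hnorm_nonneg) auto
      qed
      then show "\<exists>C. \<forall>v\<in>H'. hnorm ip' (\<psi> x v) \<le> C * hnorm ip' v" by blast
    qed
  qed
  interpret \<psi>: op_map H' ip' \<psi> by unfold_locales (rule lin)
  have "ucc_map H' ip' \<psi> e nrm"
  proof
    show "op_unital H' e \<psi>" by (simp add: op_unital_def \<psi>_e)
    show "completely_contractive H' ip' nrm \<psi>" unfolding completely_contractive_def
    proof (intro allI impI)
      fix A :: "'b mat" assume A: "0 < dim_row A" "0 < dim_col A"
      have eq: "to_mat (dim_row A) (dim_col A) (\<lambda>i j. A $$ (i, j)) = A" by (rule eq_matI) auto
      show "op_mat_norm H' ip' (map_mat \<psi> A) \<le> nrm A"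
        using contr[OF A, of _ "\<lambda>i j. A $$ (i, j)", unfolded eq] A
        by (intro H'.op_mat_norm_le nrm_nonneg) (simp_all add: \<psi>.sq_norm_mat_act)
    qed
  qed
  moreover
  \<comment> \<open>The preimage under \<open>cv\<close> of the standard unit vector
    \<open>\<delta> i\<close>. Expanding \<open>Z\<close> in matrix units, which are of rank one,
    then gives \<open>f\<close> as the quadratic form at \<open>\<gamma>\<close>.\<close>
  define \<gamma> where "\<gamma> i = (\<Sum>p<d. F e (\<delta> i) (q p) *\<^sub>C \<beta> p)" for i
  have \<gamma>: "\<gamma> i \<in> H'" for i unfolding \<gamma>_def using \<beta> by (intro H'.mem_sum H'.mem_scale) auto
  have cv_\<gamma>: "cv (\<gamma> i) = \<delta> i" if "i < d" for i
    unfolding cv_def \<gamma>_def by (rule trans[OF _ \<delta>[OF that, symmetric]]) (simp add: co_sum)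
  have "f Z = quad ip' \<psi> d Z \<gamma>" for Z
  proof -
    have "f Z = f (\<Sum>i<d. \<Sum>j<d. (\<lambda>a b. (cnj (\<delta> i a) * \<delta> j b) *\<^sub>C Z i j))"
    proof (rule f_cong)
      fix a b assume ab: "a < d" "b < d"
      have "(\<Sum>i<d. \<Sum>j<d. (cnj (\<delta> i a) * \<delta> j b) *\<^sub>C Z i j) = (\<Sum>i<d. if i = a then Z a b else 0)"
      proof (rule sum.cong[OF refl])
        fix i
        have "(\<Sum>j<d. (cnj (\<delta> i a) * \<delta> j b) *\<^sub>C Z i j) = (\<Sum>j<d. if j = b then (if i = a then Z a b else 0) else 0)"
          by (rule sum.cong) (auto simp: \<delta>_def scaleC_one)
        then show "(\<Sum>j<d. (cnj (\<delta> i a) * \<delta> j b) *\<^sub>C Z i j) = (if i = a then Z a b else 0)"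
          using ab by simp
      qed
      then show "Z a b = (\<Sum>i<d. \<Sum>j<d. (\<lambda>a b. (cnj (\<delta> i a) * \<delta> j b) *\<^sub>C Z i j)) a b"
        using ab by (simp add: sum_fun_apply)
    qed
    also have "\<dots> = (\<Sum>i<d. \<Sum>j<d. Re (F (Z i j) (\<delta> j) (\<delta> i)))" by (simp only: f_sum Re_F)
    also have "\<dots> = quad ip' \<psi> d Z \<gamma>" unfolding quad_def
      by (intro sum.cong refl) (simp add: ip_\<psi> \<gamma> cv_\<gamma>)
    finally show ?thesis .
  qed
  moreover have "x \<in> op_kernel H' \<psi>" if x: "\<forall>c. f (\<lambda>i j. c i j *\<^sub>C x) = 0" for x
  proof -
    have "F x u v = 0" for u v
      using x[rule_format, of "\<lambda>i j. cnj (v i) * u j"] x[rule_format, of "\<lambda>i j. \<i> * (cnj (v i) * u j)"]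
      by (simp add: F_def fC_def scaleC_fun_def scaleC_scaleC complex_eq_iff)
    then show ?thesis by (simp add: op_kernel_def \<psi>_def)
  qed
  ultimately show ?thesis using \<gamma> by blast
qed

end

section \<open>The algebra of words\<close>

lemma free_algebra_induct [case_names single add]:
  assumes single: "\<And>w c. P (Poly_Mapping.single w c)" and add: "\<And>p q. P p \<Longrightarrow> P q \<Longrightarrow> P (p + q)"
  shows "P (p :: 'w free_algebra)"
proof -
  have "P (\<Sum>w\<in>I. Poly_Mapping.single w (Poly_Mapping.lookup p w))" for I
  proof (induction I rule: infinite_finite_induct)
    case (insert w I) then show ?case by (simp add: single add)
  qed (use single[of 0 0] in simp_all)
  moreover have "(\<Sum>w\<in>Poly_Mapping.keys p. Poly_Mapping.single w (Poly_Mapping.lookup p w)) = p"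
    by (rule poly_mapping_eqI) (auto simp: lookup_sum lookup_single when_def in_keys_iff)
  ultimately show ?thesis by metis
qed

lemma mat_prod_carrier:
  assumes "Xs \<noteq> []" "successively (\<lambda>X Y. dim_col X = dim_row Y) Xs"
  shows "mat_prod Xs \<in> carrier_mat (dim_row (hd Xs)) (dim_col (last Xs))"
  using assms by (induction Xs rule: mat_prod.induct) auto

lemma composable_Cons:
  "Xs \<noteq> [] \<Longrightarrow> composable W (X # Xs) \<longleftrightarrow>
    X \<in> mats_over (vcarrier W) \<and> dim_col X = dim_row (hd Xs) \<and> composable W Xs"
  by (cases Xs) (auto simp: composable_def)

lemma composable_dims:
  "composable W Xs \<Longrightarrow> 0 < dim_row (hd Xs) \<and> 0 < dim_col (last Xs)"
  unfolding composable_def mats_over_def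
  by (metis (mono_tags, lifting) hd_in_set last_in_set mem_Collect_eq subsetD)

lemma mat_prod_gen_carrier:
  assumes "composable W Xs"
  shows "mat_prod (map (map_mat gen) Xs) \<in> carrier_mat (dim_row (hd Xs)) (dim_col (last Xs))"
proof -
  have ne: "Xs \<noteq> []" and "successively (\<lambda>X Y. dim_col X = dim_row Y) Xs"
    using assms by (auto simp: composable_def)
  then have "successively (\<lambda>X Y. dim_col X = dim_row Y) (map (map_mat gen) Xs)"
    by (simp add: successively_map)
  from mat_prod_carrier[OF _ this] ne show ?thesis by (simp add: hd_map last_map)
qed

lemma mat_prod_Cons: "Xs \<noteq> [] \<Longrightarrow> mat_prod (X # Xs) = X * mat_prod Xs"
  by (cases Xs) auto

context
  fixes K :: "'x::complex_vector set"
  assumes K: "csubspace K"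
begin

lemma coset_add: "(x +o K) + (y +o K) = (x + y) +o K"
proof -
  have "K + K = K"
    using complex_vector.subspace_add[OF K] complex_vector.subspace_0[OF K]
    by (auto simp: set_plus_def) (metis add_0)
  then show ?thesis by (simp add: set_plus_rearrange)
qed

lemma coset_scale: "(scaleC c ` (x +o K)) + K = (c *\<^sub>C x) +o K"
proof (intro subset_antisym subsetI)
  fix z assume "z \<in> (scaleC c ` (x +o K)) + K"
  then obtain k k' where "k \<in> K" "k' \<in> K" "z = c *\<^sub>C (x + k) + k'"
    by (auto simp: set_plus_def elt_set_plus_def)
  then show "z \<in> (c *\<^sub>C x) +o K"
    using complex_vector.subspace_add[OF K complex_vector.subspace_scale[OF K]]
    by (auto simp: elt_set_plus_def scaleC_add_right add.assoc)
next
  fix z assume "z \<in> (c *\<^sub>C x) +o K"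
  then obtain k where k: "k \<in> K" "z = c *\<^sub>C x + k" by (auto simp: elt_set_plus_def)
  have "x \<in> x +o K" using complex_vector.subspace_0[OF K] by (force simp: elt_set_plus_def)
  then show "z \<in> (scaleC c ` (x +o K)) + K" using k by (auto simp: set_plus_def)
qed

lemma some_in_coset: "(SOME y. y \<in> x +o K) - x \<in> K"
proof -
  have "x \<in> x +o K" using complex_vector.subspace_0[OF K] by (force simp: elt_set_plus_def)
  then have "(SOME y. y \<in> x +o K) \<in> x +o K" by (rule someI)
  then show ?thesis by (auto simp: elt_set_plus_def)
qed

lemma mats_over_coset:
  "X \<in> mats_over (vcarrier (quotient_space K)) \<longleftrightarrow>
    0 < dim_row X \<and> 0 < dim_col X \<and> (\<exists>B. coset_mat K B = X)"
proof -
  have "\<exists>B. coset_mat K B = X" if el: "elements_mat X \<subseteq> range (\<lambda>x. x +o K)"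
  proof -
    have "\<exists>x. X $$ (i, j) = x +o K" if "i < dim_row X" "j < dim_col X" for i j
      using el elements_matI[OF carrier_matI[OF refl refl] that refl] by blast
    then obtain b where b: "\<And>i j. i < dim_row X \<Longrightarrow> j < dim_col X \<Longrightarrow> X $$ (i, j) = b i j +o K" by metis
    have "coset_mat K (mat (dim_row X) (dim_col X) (\<lambda>(i, j). b i j)) = X"
      by (rule eq_matI) (simp_all add: coset_mat_def b)
    then show ?thesis ..
  qed
  moreover have "elements_mat (coset_mat K B) \<subseteq> range (\<lambda>x. x +o K)" for B :: "'x mat"
    by (auto simp: coset_mat_def elements_mat_def)
  ultimately show ?thesis by (auto simp: mats_over_def quotient_space_def)
qed

end

section \<open>Evaluating words in a ucc map\<close>

context ucc_map
begin

lemma osp_norm_nonneg: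
  assumes K: "csubspace K" and "X \<in> mats_over (vcarrier (quotient_space K))"
  shows "0 \<le> osp_norm nrm K X"
proof -
  obtain B where X: "0 < dim_row X" "0 < dim_col X" and B: "coset_mat K B = X"
    using assms(2) mats_over_coset[OF K] by blast
  show ?thesis unfolding osp_norm_def
  proof (rule cInf_greatest)
    show "{nrm A | A. coset_mat K A = X} \<noteq> {}" using B by blast
    fix r assume "r \<in> {nrm A | A. coset_mat K A = X}"
    then obtain A where "r = nrm A" "coset_mat K A = X" by blast
    then show "0 \<le> r" using X nrm_nonneg[of A] by (auto simp: coset_mat_def)
  qed
qed

lemma osp_norm_le:
  assumes "0 < dim_row A" "0 < dim_col A"
  shows "osp_norm nrm K (coset_mat K A) \<le> nrm A"
  unfolding osp_norm_def
proof (rule cInf_lower)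
  show "bdd_below {nrm B | B. coset_mat K B = coset_mat K A}"
  proof (rule bdd_belowI[of _ 0], clarify)
    fix B assume B: "coset_mat K B = coset_mat K A"
    have "dim_row B = dim_row A" "dim_col B = dim_col A"
      using arg_cong[OF B, of dim_row] arg_cong[OF B, of dim_col] by (simp_all add: coset_mat_def)
    then show "0 \<le> nrm B" using assms by (intro nrm_nonneg) simp_all
  qed
qed blast

end

locale quotient_ucc_map = ucc_map +
  fixes K
  assumes K_subspace: "csubspace K" and K_kernel: "K \<subseteq> op_kernel H \<phi>"
begin

text \<open>A representative is chosen so that every set over the type acts as a bounded operator
  and all words can be evaluated. On cosets the choice is immaterial because the map kills
  \<open>K\<close>.\<close>

definition coset_op :: "'b set \<Rightarrow> 'a \<Rightarrow> 'a" where
  "coset_op S = \<phi> (SOME x. x \<in> S)"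

definition word_op :: "'b set word \<Rightarrow> 'a \<Rightarrow> 'a" where
  "word_op w v = foldr coset_op (letters w) v"

definition ev :: "'b set free_algebra \<Rightarrow> 'a \<Rightarrow> 'a" where
  "ev p v = (\<Sum>w\<in>Poly_Mapping.keys p. Poly_Mapping.lookup p w *\<^sub>C word_op w v)"

lemma coset_op_coset: "v \<in> H \<Longrightarrow> coset_op (x +o K) v = \<phi> x v"
proof -
  assume v: "v \<in> H"
  have "\<phi> ((SOME y. y \<in> x +o K) - x) v = 0"
    using some_in_coset[OF K_subspace] K_kernel v by (auto simp: op_kernel_def)
  then show ?thesis using v by (simp add: coset_op_def map_diff)
qed

lemma coset_op_bounded: "bounded_op H ip (coset_op S)"
  by (simp add: coset_op_def map_bounded)

lemma foldr_coset_op_mem: "v \<in> H \<Longrightarrow> foldr coset_op ws v \<in> H"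
  by (induction ws) (auto intro: bounded_op_mem[OF coset_op_bounded])

lemma word_op_mem: "v \<in> H \<Longrightarrow> word_op w v \<in> H"
  by (simp add: word_op_def foldr_coset_op_mem)

lemma word_op_add: "u \<in> H \<Longrightarrow> v \<in> H \<Longrightarrow> word_op w (u + v) = word_op w u + word_op w v"
proof -
  assume uv: "u \<in> H" "v \<in> H"
  have "foldr coset_op ws (u + v) = foldr coset_op ws u + foldr coset_op ws v" for ws
    by (induction ws) (simp_all add: bounded_op_add[OF coset_op_bounded] foldr_coset_op_mem uv)
  then show ?thesis by (simp add: word_op_def)
qed

lemma word_op_scale: "v \<in> H \<Longrightarrow> word_op w (c *\<^sub>C v) = c *\<^sub>C word_op w v"
proof -
  assume v: "v \<in> H"
  have "foldr coset_op ws (c *\<^sub>C v) = c *\<^sub>C foldr coset_op ws v" for ws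
    by (induction ws) (simp_all add: bounded_op_scale[OF coset_op_bounded] foldr_coset_op_mem v)
  then show ?thesis by (simp add: word_op_def)
qed

lemma word_op_plus: "word_op (w + w') v = word_op w (word_op w' v)"
  by (simp add: word_op_def plus_word_def)

lemma ev_single: "ev (Poly_Mapping.single w c) v = c *\<^sub>C word_op w v"
  by (simp add: ev_def)

lemma ev_add: "ev (p + q) v = ev p v + ev q v"
  unfolding ev_def
  by (rule setsum_keys_plus_distrib[where f = "\<lambda>w c. c *\<^sub>C word_op w v"]) (simp_all add: scaleC_add_left)

lemma ev_zero: "ev 0 v = 0"
  by (simp add: ev_def)

lemma ev_diff: "ev (p - q) v = ev p v - ev q v"
  using ev_add[of "p - q" q v] by simp

lemma ev_sum: "ev (\<Sum>i\<in>I. p i) v = (\<Sum>i\<in>I. ev (p i) v)"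
  by (induction I rule: infinite_finite_induct) (simp_all add: ev_zero ev_add)

lemma ev_mem: "v \<in> H \<Longrightarrow> ev p v \<in> H"
  unfolding ev_def by (intro mem_sum mem_scale word_op_mem)

lemma ev_vec_add: "u \<in> H \<Longrightarrow> v \<in> H \<Longrightarrow> ev p (u + v) = ev p u + ev p v"
  by (simp add: ev_def word_op_add scaleC_add_right sum.distrib)

lemma ev_vec_zero: "ev p 0 = 0"
proof -
  have "word_op w 0 = 0" for w using word_op_scale[of 0 w 0] by simp
  then show ?thesis by (simp add: ev_def)
qed

lemma ev_mult: "v \<in> H \<Longrightarrow> ev (p * q) v = ev p (ev q v)"
proof (induction p rule: free_algebra_induct)
  case (single w c)
  then show ?case
  proof (induction q rule: free_algebra_induct)
    case (single w' c')
    then show ?case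
      by (simp add: mult_single ev_single word_op_plus word_op_scale word_op_mem scaleC_scaleC)
  next
    case (add q q')
    then show ?case by (simp add: distrib_left ev_add ev_vec_add ev_mem)
  qed
next
  case (add p p')
  then show ?case by (simp add: distrib_right ev_add)
qed

lemma ev_gen: "ev (gen S) v = coset_op S v"
  by (simp add: gen_def ev_single word_op_def scaleC_one)

lemma ev_one: "ev 1 v = v"
  unfolding single_one[symmetric] ev_single by (simp add: word_op_def zero_word_def scaleC_one)

lemma ev_scalar: "ev (scalar c) v = c *\<^sub>C v"
  by (simp add: scalar_def ev_single word_op_def zero_word_def)

lemma ev_relator: "g \<in> relators (quotient_space K) (e +o K) \<Longrightarrow> v \<in> H \<Longrightarrow> ev g v = 0"
  by (auto simp: relators_def quotient_space_def ev_diff ev_add ev_gen ev_mult ev_scalar ev_one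
      coset_add[OF K_subspace] coset_scale[OF K_subspace] coset_op_coset map_add map_scale map_unit map_mem)

lemma ev_ideal:
  assumes "s \<in> two_sided_ideal R (relators (quotient_space K) (e +o K))" and v: "v \<in> H"
  shows "ev s v = 0"
  using assms(1)
proof (induction rule: two_sided_ideal.induct)
  case (step s a g b)
  then show ?case using v by (simp add: ev_add ev_mult ev_relator ev_mem ev_vec_zero)
qed (simp add: ev_zero)

lemma ev_cong: "Fm_eq (quotient_space K) (e +o K) p q \<Longrightarrow> v \<in> H \<Longrightarrow> ev p v = ev q v"
  using ev_ideal[of "p - q"] by (simp add: Fm_eq_def ev_diff)

text \<open>Every lift of \<open>X\<close> acts on the column in the same way, so each lift gives a
  bound. These bounds are linear in the norm of the lift once square roots are taken, which allows
  passing to the infimum.\<close>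

lemma coset_op_act_le:
  assumes X: "X \<in> mats_over (vcarrier (quotient_space K))" and \<xi>: "\<forall>j<dim_col X. \<xi> j \<in> H"
  shows "sq_norm ip (dim_row X) (\<lambda>i. \<Sum>j<dim_col X. coset_op (X $$ (i, j)) (\<xi> j))
    \<le> (osp_norm nrm K X)\<^sup>2 * sq_norm ip (dim_col X) \<xi>" (is "?a \<le> _ * ?b")
proof -
  obtain B0 where dims: "0 < dim_row X" "0 < dim_col X" and B0: "coset_mat K B0 = X"
    using X mats_over_coset[OF K_subspace] by blast
  have le: "sqrt ?a \<le> nrm B * sqrt ?b" if B: "coset_mat K B = X" for B
  proof -
    have dB: "dim_row B = dim_row X" "dim_col B = dim_col X"
      using arg_cong[OF B, of dim_row] arg_cong[OF B, of dim_col] by (simp_all add: coset_mat_def)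
    have entry: "X $$ (i, j) = B $$ (i, j) +o K" if "i < dim_row X" "j < dim_col X" for i j
      using that unfolding B[symmetric] by (simp add: coset_mat_def)
    have "?a = sq_norm ip (dim_row B) (mat_act (map_mat \<phi> B) \<xi>)"
      unfolding sq_norm_def dB
    proof (intro sum.cong refl arg_cong[of _ _ "\<lambda>v. (hnorm ip v)\<^sup>2"])
      fix i assume "i \<in> {..<dim_row X}"
      then show "(\<Sum>j<dim_col X. coset_op (X $$ (i, j)) (\<xi> j)) = mat_act (map_mat \<phi> B) \<xi> i"
        unfolding mat_act_def using \<xi> by (simp add: dB entry coset_op_coset)
    qed
    also have "\<dots> \<le> (op_mat_norm H ip (map_mat \<phi> B))\<^sup>2 * ?b"
      using mat_act_le[OF op_mat_map, of B \<xi>] \<xi> by (simp add: dB)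
    also have "\<dots> \<le> (nrm B)\<^sup>2 * ?b"
      using dims by (intro mult_right_mono power_mono op_mat_norm_le_nrm op_mat_norm_nonneg op_mat_map)
        (simp_all add: dB)
    finally have "sqrt ?a \<le> sqrt ((nrm B)\<^sup>2 * ?b)" by simp
    also have "\<dots> = nrm B * sqrt ?b"
      using nrm_nonneg[of B] dims by (simp add: real_sqrt_mult dB)
    finally show ?thesis .
  qed
  have "sqrt ?a \<le> osp_norm nrm K X * sqrt ?b"
  proof (cases "?b = 0")
    case True then show ?thesis using le[OF B0] by simp
  next
    case False
    then have b: "0 < sqrt ?b" by (simp add: order_less_le)
    have "sqrt ?a / sqrt ?b \<le> osp_norm nrm K X" unfolding osp_norm_def
    proof (rule cInf_greatest)
      show "{nrm A | A. coset_mat K A = X} \<noteq> {}" using B0 by blast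
    qed (use le b in \<open>auto simp: divide_le_eq\<close>)
    then show ?thesis using b by (simp add: divide_le_eq)
  qed
  then have "(sqrt ?a)\<^sup>2 \<le> (osp_norm nrm K X * sqrt ?b)\<^sup>2" by (intro power_mono) simp_all
  then show ?thesis by (simp add: power_mult_distrib)
qed

lemma mat_prod_act_le:
  assumes "composable (quotient_space K) Xs" and "\<forall>j<dim_col (last Xs). \<xi> j \<in> H"
  shows "sq_norm ip (dim_row (hd Xs))
      (\<lambda>i. \<Sum>j<dim_col (last Xs). ev (mat_prod (map (map_mat gen) Xs) $$ (i, j)) (\<xi> j))
    \<le> (prod_list (map (osp_norm nrm K) Xs))\<^sup>2 * sq_norm ip (dim_col (last Xs)) \<xi>"
  using assms
proof (induction Xs)
  case (Cons X Xs)
  show ?case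
  proof (cases "Xs = []")
    case True
    have "sq_norm ip (dim_row X) (\<lambda>i. \<Sum>j<dim_col X. ev (map_mat gen X $$ (i, j)) (\<xi> j))
      = sq_norm ip (dim_row X) (\<lambda>i. \<Sum>j<dim_col X. coset_op (X $$ (i, j)) (\<xi> j))"
      unfolding sq_norm_def by (simp add: ev_gen)
    also have "\<dots> \<le> (osp_norm nrm K X)\<^sup>2 * sq_norm ip (dim_col X) \<xi>"
      using Cons.prems True by (intro coset_op_act_le) (auto simp: composable_def)
    finally show ?thesis using True by simp
  next
    case False
    have X: "X \<in> mats_over (vcarrier (quotient_space K))" and dX: "dim_col X = dim_row (hd Xs)"
      and comp: "composable (quotient_space K) Xs"
      using Cons.prems(1) composable_Cons[OF False] by auto
    let ?P = "mat_prod (map (map_mat gen) Xs)" and ?k = "dim_col (last Xs)"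
    let ?\<eta> = "\<lambda>t. \<Sum>j<?k. ev (?P $$ (t, j)) (\<xi> j)"
    have \<xi>: "\<forall>j<?k. \<xi> j \<in> H" using Cons.prems(2) False by simp
    have \<eta>: "?\<eta> t \<in> H" for t using \<xi> by (intro mem_sum ev_mem) auto
    have P: "?P \<in> carrier_mat (dim_col X) ?k" using mat_prod_gen_carrier[OF comp] dX by simp
    have "(\<Sum>j<?k. ev ((map_mat gen X * ?P) $$ (i, j)) (\<xi> j)) = (\<Sum>t<dim_col X. coset_op (X $$ (i, t)) (?\<eta> t))"
      if i: "i < dim_row X" for i
    proof -
      have "ev ((map_mat gen X * ?P) $$ (i, j)) (\<xi> j) = (\<Sum>t<dim_col X. coset_op (X $$ (i, t)) (ev (?P $$ (t, j)) (\<xi> j)))"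
        if j: "j < ?k" for j
      proof -
        have "(map_mat gen X * ?P) $$ (i, j) = (\<Sum>t<dim_col X. gen (X $$ (i, t)) * ?P $$ (t, j))"
          using i j P by (auto simp: scalar_prod_def atLeast0LessThan intro!: sum.cong)
        then show ?thesis using \<xi> j by (simp add: ev_sum ev_mult ev_gen)
      qed
      then have "(\<Sum>j<?k. ev ((map_mat gen X * ?P) $$ (i, j)) (\<xi> j))
        = (\<Sum>j<?k. \<Sum>t<dim_col X. coset_op (X $$ (i, t)) (ev (?P $$ (t, j)) (\<xi> j)))" by simp
      also have "\<dots> = (\<Sum>t<dim_col X. coset_op (X $$ (i, t)) (?\<eta> t))"
        using \<xi> by (subst sum.swap) (simp add: bounded_op_sum[OF coset_op_bounded] ev_mem)
      finally show ?thesis .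
    qed
    then have "sq_norm ip (dim_row X) (\<lambda>i. \<Sum>j<?k. ev ((map_mat gen X * ?P) $$ (i, j)) (\<xi> j))
      = sq_norm ip (dim_row X) (\<lambda>i. \<Sum>t<dim_col X. coset_op (X $$ (i, t)) (?\<eta> t))"
      unfolding sq_norm_def by simp
    also have "\<dots> \<le> (osp_norm nrm K X)\<^sup>2 * sq_norm ip (dim_col X) ?\<eta>"
      using \<eta> by (intro coset_op_act_le X) simp
    also have "\<dots> \<le> (osp_norm nrm K X)\<^sup>2 * ((prod_list (map (osp_norm nrm K) Xs))\<^sup>2 * sq_norm ip ?k \<xi>)"
      unfolding dX by (intro mult_left_mono Cons.IH comp \<xi>) simp
    finally show ?thesis using False by (simp add: mat_prod_Cons power_mult_distrib mult.assoc)
  qed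
qed (simp add: composable_def)

lemma op_mat_norm_le_prod:
  assumes comp: "composable (quotient_space K) Xs"
    and prod: "product_is (quotient_space K) (e +o K) Xs (coset_mat K A)"
  shows "op_mat_norm H ip (map_mat \<phi> A) \<le> prod_list (map (osp_norm nrm K) Xs)"
proof (rule op_mat_norm_le)
  have "\<forall>X\<in>set Xs. 0 \<le> osp_norm nrm K X"
    using comp osp_norm_nonneg[OF K_subspace] by (auto simp: composable_def)
  then show "0 \<le> prod_list (map (osp_norm nrm K) Xs)" by (induction Xs) simp_all
next
  fix \<xi> assume "\<forall>j<dim_col (map_mat \<phi> A). \<xi> j \<in> H"
  then have \<xi>: "\<forall>j<dim_col A. \<xi> j \<in> H" by simp
  have dims: "dim_row A = dim_row (hd Xs)" "dim_col A = dim_col (last Xs)"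
    using prod by (auto simp: product_is_def coset_mat_def)
  have eq: "ev (mat_prod (map (map_mat gen) Xs) $$ (i, j)) (\<xi> j) = \<phi> (A $$ (i, j)) (\<xi> j)"
    if ij: "i < dim_row A" "j < dim_col A" for i j
  proof -
    have "Fm_eq (quotient_space K) (e +o K) (mat_prod (map (map_mat gen) Xs) $$ (i, j)) (gen (A $$ (i, j) +o K))"
      using prod ij by (simp add: product_is_def coset_mat_def)
    from ev_cong[OF this, of "\<xi> j"] \<xi> ij show ?thesis by (simp add: ev_gen coset_op_coset)
  qed
  have "sq_norm ip (dim_row A) (mat_act (map_mat \<phi> A) \<xi>)
    = sq_norm ip (dim_row A) (\<lambda>i. \<Sum>j<dim_col A. ev (mat_prod (map (map_mat gen) Xs) $$ (i, j)) (\<xi> j))"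
    unfolding sq_norm_def mat_act_def by (simp add: eq)
  also have "\<dots> \<le> (prod_list (map (osp_norm nrm K) Xs))\<^sup>2 * sq_norm ip (dim_col A) \<xi>"
    using mat_prod_act_le[OF comp] \<xi> unfolding dims by blast
  finally show "sq_norm ip (dim_row (map_mat \<phi> A)) (mat_act (map_mat \<phi> A) \<xi>)
    \<le> (prod_list (map (osp_norm nrm K) Xs))\<^sup>2 * sq_norm ip (dim_col (map_mat \<phi> A)) \<xi>" by simp
qed

end

section \<open>Calculating with permissible products\<close>

lemma two_sided_ideal_add:
  assumes "t \<in> two_sided_ideal R G" "s \<in> two_sided_ideal R G"
  shows "s + t \<in> two_sided_ideal R G"
  using assms(1)
proof (induction rule: two_sided_ideal.induct)
  case (step t a g b)
  then show ?case using two_sided_ideal.step[of "s + t" R G a g b] by (simp add: add.assoc)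
qed (simp add: assms(2))

lemma two_sided_ideal_gen: "g \<in> G \<Longrightarrow> 1 \<in> R \<Longrightarrow> g \<in> two_sided_ideal R G"
  using two_sided_ideal.step[OF two_sided_ideal.zero, of 1 R g G 1] by simp

lemma
  assumes s: "s \<in> two_sided_ideal R G" and R: "\<And>x y. x \<in> R \<Longrightarrow> y \<in> R \<Longrightarrow> x * y \<in> R" and a: "a \<in> R"
  shows two_sided_ideal_mult_left: "a * s \<in> two_sided_ideal R G"
    and two_sided_ideal_mult_right: "s * a \<in> two_sided_ideal R G"
proof -
  show "a * s \<in> two_sided_ideal R G" using s
  proof (induction rule: two_sided_ideal.induct)
    case (step t b g c)
    then show ?case using two_sided_ideal.step[of "a * t" R G "a * b" g c] R[OF a]
      by (simp add: distrib_left mult.assoc)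
  qed (simp add: two_sided_ideal.zero)
  show "s * a \<in> two_sided_ideal R G" using s
  proof (induction rule: two_sided_ideal.induct)
    case (step t b g c)
    then show ?case using two_sided_ideal.step[of "t * a" R G b g "c * a"] R[OF _ a]
      by (simp add: distrib_right mult.assoc)
  qed (simp add: two_sided_ideal.zero)
qed

lemma free_algebra_on_mult:
  assumes "p \<in> free_algebra_on S" "q \<in> free_algebra_on S"
  shows "p * q \<in> free_algebra_on S"
  unfolding free_algebra_on_def
proof (intro CollectI ballI)
  fix w assume "w \<in> Poly_Mapping.keys (p * q)"
  then obtain u v where "w = u + v" "u \<in> Poly_Mapping.keys p" "v \<in> Poly_Mapping.keys q"
    using keys_mult[of p q] by blast
  then show "set (letters w) \<subseteq> S" using assms by (auto simp: free_algebra_on_def plus_word_def)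
qed

lemma free_algebra_on_scalar: "scalar c \<in> free_algebra_on S"
  by (simp add: free_algebra_on_def scalar_def zero_word_def)

lemma free_algebra_on_gen: "x \<in> S \<Longrightarrow> gen x \<in> free_algebra_on S"
  by (simp add: free_algebra_on_def gen_def)

lemma scalar_one: "scalar 1 = 1"
  by (simp add: scalar_def)

lemma scalar_commute: "scalar c * p = p * scalar c"
proof (induction p rule: free_algebra_induct)
  case (single w a) then show ?case by (simp add: scalar_def mult_single mult.commute)
qed (simp add: distrib_left distrib_right)

text \<open>
  The column \<open>(x A, y I)\<close>, on which the upper triangular matrices below act like
  \<open>2 \<times> 2\<close> scalar matrices.
\<close>

definition corner_col :: "'x::complex_vector \<Rightarrow> nat \<Rightarrow> 'x mat \<Rightarrow> complex \<Rightarrow> complex \<Rightarrow> nat \<Rightarrow> nat \<Rightarrow> 'x" where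
  "corner_col e n A x y i j = (if i < n then x *\<^sub>C (A $$ (i, j)) else (if i = n + j then y else 0) *\<^sub>C e)"

text \<open>The block matrix [[a I, b A], [0, c I]] with \<open>e\<close> as the entry 1. Outside
  the upper right block every entry is a multiple of \<open>e\<close>.\<close>

definition upper :: "'x::complex_vector \<Rightarrow> nat \<Rightarrow> 'x mat \<Rightarrow> complex \<Rightarrow> complex \<Rightarrow> complex \<Rightarrow> nat \<Rightarrow> nat \<Rightarrow> 'x" where
  "upper e n A a b c i t =
    (if i < n \<and> n \<le> t then b *\<^sub>C (A $$ (i, t - n)) else (if i = t then (if i < n then a else c) else 0) *\<^sub>C e)"

locale trivial_product =
  fixes K :: "'x::complex_vector set" and e :: 'x
  assumes K: "csubspace K"
begin

abbreviation R where "R \<equiv> free_algebra_on (vcarrier (quotient_space K))"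

abbreviation Fm (infix \<open>\<approx>\<close> 50) where "p \<approx> q \<equiv> Fm_eq (quotient_space K) (e +o K) p q"

abbreviation q :: "'x \<Rightarrow> 'x set free_algebra" where "q x \<equiv> gen (x +o K)"

lemma q_R: "q x \<in> R"
  by (rule free_algebra_on_gen) (simp add: quotient_space_def)

lemma one_R: "1 \<in> R"
  using free_algebra_on_scalar[of 1] by (simp add: scalar_one)

lemma Fm_relator: "p - r \<in> relators (quotient_space K) (e +o K) \<Longrightarrow> p \<approx> r"
  unfolding Fm_eq_def by (rule two_sided_ideal_gen[OF _ one_R])

section \<open>Congruence modulo the relations of the trivial product\<close>

lemma Fm_refl: "p \<approx> p"
  by (simp add: Fm_eq_def two_sided_ideal.zero)

lemma Fm_sym: "p \<approx> r \<Longrightarrow> r \<approx> p"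
proof -
  assume "p \<approx> r"
  moreover have "scalar (-1) \<in> R" by (rule free_algebra_on_scalar)
  ultimately have "scalar (-1) * (p - r) \<in> two_sided_ideal R (relators (quotient_space K) (e +o K))"
    unfolding Fm_eq_def by (intro two_sided_ideal_mult_left free_algebra_on_mult)
  then show "r \<approx> p"
    by (simp add: Fm_eq_def scalar_def single_uminus)
qed

lemma Fm_add: "p \<approx> r \<Longrightarrow> p' \<approx> r' \<Longrightarrow> p + p' \<approx> r + r'"
  unfolding Fm_eq_def using two_sided_ideal_add[of "p' - r'" R _ "p - r"] by (simp add: algebra_simps)

lemma Fm_trans [trans]: "p \<approx> r \<Longrightarrow> r \<approx> s \<Longrightarrow> p \<approx> s"
  unfolding Fm_eq_def using two_sided_ideal_add[of "r - s" R _ "p - r"] by simp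

lemma Fm_mult_left: "p \<approx> r \<Longrightarrow> a \<in> R \<Longrightarrow> a * p \<approx> a * r"
  unfolding Fm_eq_def right_diff_distrib[symmetric]
  by (intro two_sided_ideal_mult_left free_algebra_on_mult)

lemma Fm_mult_right: "p \<approx> r \<Longrightarrow> a \<in> R \<Longrightarrow> p * a \<approx> r * a"
  unfolding Fm_eq_def left_diff_distrib[symmetric]
  by (intro two_sided_ideal_mult_right free_algebra_on_mult)

lemma q_add: "q (x + y) \<approx> q x + q y"
proof (rule Fm_relator)
  show "q (x + y) - (q x + q y) \<in> relators (quotient_space K) (e +o K)"
    unfolding relators_def
    by (rule UnI1, rule UnI1, rule CollectI, rule exI[of _ "x +o K"], rule exI[of _ "y +o K"])
      (simp add: quotient_space_def coset_add[OF K])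
qed

lemma q_scale: "q (c *\<^sub>C x) \<approx> scalar c * q x"
proof (rule Fm_relator)
  show "q (c *\<^sub>C x) - scalar c * q x \<in> relators (quotient_space K) (e +o K)"
    unfolding relators_def
    by (rule UnI1, rule UnI2, rule CollectI, rule exI[of _ c], rule exI[of _ "x +o K"])
      (simp add: quotient_space_def coset_scale[OF K])
qed

lemma q_unit: "q e \<approx> 1"
  by (rule Fm_relator) (simp add: relators_def)

lemma q_zero: "q 0 \<approx> 0"
  using q_scale[of 0 0] by (simp add: scalar_def)

lemma q_sum: "finite I \<Longrightarrow> (\<Sum>i\<in>I. q (w i)) \<approx> q (\<Sum>i\<in>I. w i)"
proof (induction I rule: finite_induct)
  case (insert i I)
  have "q (w i) + (\<Sum>i\<in>I. q (w i)) \<approx> q (w i) + q (\<Sum>i\<in>I. w i)" by (rule Fm_add[OF Fm_refl insert.IH])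
  also have "\<dots> \<approx> q (w i + (\<Sum>i\<in>I. w i))" by (rule Fm_sym[OF q_add])
  finally show ?case using insert by simp
qed (simp only: sum.empty Fm_sym[OF q_zero])

lemma Fm_sum: "(\<And>i. i \<in> I \<Longrightarrow> p i \<approx> r i) \<Longrightarrow> (\<Sum>i\<in>I. p i) \<approx> (\<Sum>i\<in>I. r i)"
  by (induction I rule: infinite_finite_induct) (simp_all add: Fm_refl Fm_add)

lemma q_scalar: "q (c *\<^sub>C e) \<approx> scalar c"
  using Fm_trans[OF q_scale Fm_mult_left[OF q_unit free_algebra_on_scalar]] by simp

lemma q_mult_scalar_left: "q (c *\<^sub>C e) * q x \<approx> q (c *\<^sub>C x)"
  by (rule Fm_trans[OF Fm_mult_right[OF q_scalar q_R] Fm_sym[OF q_scale]])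

lemma q_mult_scalar_right: "q x * q (c *\<^sub>C e) \<approx> q (c *\<^sub>C x)"
  by (rule Fm_trans[OF Fm_mult_left[OF q_scalar q_R]])
    (simp only: scalar_commute[symmetric] Fm_sym[OF q_scale])

text \<open>The invariant of the construction: a composable list whose product is congruent to the
  matrix \<open>c\<close> over the space, together with an upper bound \<open>B\<close> for its
  cost. A bound instead of the exact cost lets the estimates be made factor by factor.\<close>

definition represents :: "('x mat \<Rightarrow> real) \<Rightarrow> 'x set mat list \<Rightarrow> nat \<Rightarrow> nat \<Rightarrow> (nat \<Rightarrow> nat \<Rightarrow> 'x) \<Rightarrow> real \<Rightarrow> bool" where
  "represents nrm Xs m l c B \<longleftrightarrow> composable (quotient_space K) Xs \<and> dim_row (hd Xs) = m \<and>
    dim_col (last Xs) = l \<and> prod_list (map (osp_norm nrm K) Xs) \<le> B \<and>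
    (\<forall>i<m. \<forall>j<l. mat_prod (map (map_mat gen) Xs) $$ (i, j) \<approx> q (c i j))"

lemma represents_cong:
  "represents nrm Xs m l c B \<Longrightarrow> (\<And>i j. i < m \<Longrightarrow> j < l \<Longrightarrow> c i j = c' i j) \<Longrightarrow> represents nrm Xs m l c' B"
  by (simp add: represents_def)

lemma represents_single:
  assumes "0 < m" "0 < l" "osp_norm nrm K (coset_mat K (to_mat m l c)) \<le> B"
  shows "represents nrm [coset_mat K (to_mat m l c)] m l c B"
  using assms mats_over_coset[OF K, of "coset_mat K (to_mat m l c)"]
  by (auto simp: represents_def composable_def coset_mat_def Fm_refl)

text \<open>The last assumption asks that each single product of entries collapse into the space, as
  it does when one factor is a multiple of \<open>e\<close>. A sum of such products then stays in
  the space, which keeps the list permissible.\<close>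

lemma represents_Cons:
  assumes Xs: "represents nrm Xs k l c C" and m: "0 < m"
    and B: "osp_norm nrm K (coset_mat K (to_mat m k X)) \<le> B"
    and nonneg: "0 \<le> osp_norm nrm K (coset_mat K (to_mat m k X))" "0 \<le> C"
    and w: "\<And>i t j. i < m \<Longrightarrow> t < k \<Longrightarrow> j < l \<Longrightarrow> q (X i t) * q (c t j) \<approx> q (w i t j)"
  shows "represents nrm (coset_mat K (to_mat m k X) # Xs) m l (\<lambda>i j. \<Sum>t<k. w i t j) (B * C)"
proof -
  let ?X = "coset_mat K (to_mat m k X)" and ?P = "mat_prod (map (map_mat gen) Xs)"
  have comp: "composable (quotient_space K) Xs" and d: "dim_row (hd Xs) = k" "dim_col (last Xs) = l"
    and P: "\<And>i j. i < k \<Longrightarrow> j < l \<Longrightarrow> ?P $$ (i, j) \<approx> q (c i j)"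
    using Xs by (auto simp: represents_def)
  have ne: "Xs \<noteq> []" using comp by (simp add: composable_def)
  have k: "0 < k" using composable_dims[OF comp] d by simp
  have X: "?X \<in> mats_over (vcarrier (quotient_space K))"
    using mats_over_coset[OF K, of ?X] m k by (auto simp: coset_mat_def)
  have Pc: "?P \<in> carrier_mat k l" using mat_prod_gen_carrier[OF comp] d by simp
  have "(map_mat gen ?X * ?P) $$ (i, j) \<approx> q (\<Sum>t<k. w i t j)" if ij: "i < m" "j < l" for i j
  proof -
    have "(map_mat gen ?X * ?P) $$ (i, j) = (\<Sum>t<k. q (X i t) * ?P $$ (t, j))"
      using ij Pc by (auto simp: scalar_prod_def atLeast0LessThan coset_mat_def intro!: sum.cong)
    also have "\<dots> \<approx> (\<Sum>t<k. q (X i t) * q (c t j))"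
      by (rule Fm_sum, rule Fm_mult_left[OF P q_R]) (use ij in auto)
    also have "\<dots> \<approx> (\<Sum>t<k. q (w i t j))" by (rule Fm_sum, rule w) (use ij in auto)
    also have "\<dots> \<approx> q (\<Sum>t<k. w i t j)" by (rule q_sum) simp
    finally show ?thesis .
  qed
  moreover have "osp_norm nrm K ?X * prod_list (map (osp_norm nrm K) Xs) \<le> B * C"
  proof -
    have "osp_norm nrm K ?X * prod_list (map (osp_norm nrm K) Xs) \<le> osp_norm nrm K ?X * C"
      using Xs nonneg by (intro mult_left_mono) (auto simp: represents_def)
    also have "\<dots> \<le> B * C" using B nonneg by (intro mult_right_mono)
    finally show ?thesis .
  qed
  moreover have "composable (quotient_space K) (?X # Xs)"
    using composable_Cons[OF ne] X comp d by (simp add: coset_mat_def)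
  ultimately show ?thesis using ne d
    by (auto simp: represents_def mat_prod_Cons coset_mat_def)
qed

text \<open>No two entries of \<open>A\<close> are ever multiplied: the upper right block meets only
  the scalar lower half of the column, and all other entries of the matrix are scalar. What remains
  is [[a, b], [0, c]] acting on (x, y).\<close>

lemma represents_upper:
  assumes Xs: "represents nrm Xs (2 * n) n (corner_col e n A x y) C" and n: "0 < n"
    and B: "osp_norm nrm K (coset_mat K (to_mat (2 * n) (2 * n) (upper e n A a b c))) \<le> B"
    and nonneg: "0 \<le> osp_norm nrm K (coset_mat K (to_mat (2 * n) (2 * n) (upper e n A a b c)))" "0 \<le> C"
  shows "represents nrm (coset_mat K (to_mat (2 * n) (2 * n) (upper e n A a b c)) # Xs) (2 * n) n
    (corner_col e n A (a * x + b * y) (c * y)) (B * C)"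
proof -
  define w where "w i t j = (if i < n \<and> n \<le> t then ((if t = n + j then y else 0) * b) *\<^sub>C (A $$ (i, t - n))
    else (if i = t then (if i < n then a else c) else 0) *\<^sub>C corner_col e n A x y t j)" for i t j
  have "represents nrm (coset_mat K (to_mat (2 * n) (2 * n) (upper e n A a b c)) # Xs) (2 * n) n
    (\<lambda>i j. \<Sum>t<2*n. w i t j) (B * C)"
  proof (rule represents_Cons[OF Xs _ B nonneg])
    fix i t j assume "i < 2 * n" "t < 2 * n" "j < n"
    show "q (upper e n A a b c i t) * q (corner_col e n A x y t j) \<approx> q (w i t j)"
    proof (cases "i < n \<and> n \<le> t")
      case True
      then have "upper e n A a b c i t = b *\<^sub>C (A $$ (i, t - n))"
        and "corner_col e n A x y t j = (if t = n + j then y else 0) *\<^sub>C e"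
        and "w i t j = (if t = n + j then y else 0) *\<^sub>C (b *\<^sub>C (A $$ (i, t - n)))"
        by (simp_all add: upper_def corner_col_def w_def scaleC_scaleC)
      then show ?thesis by (simp only: q_mult_scalar_right)
    next
      case False
      then have "upper e n A a b c i t = (if i = t then (if i < n then a else c) else 0) *\<^sub>C e"
        and "w i t j = (if i = t then (if i < n then a else c) else 0) *\<^sub>C corner_col e n A x y t j"
        by (simp_all only: upper_def w_def if_False)
      then show ?thesis by (simp only: q_mult_scalar_left)
    qed
  qed (use n in simp)
  moreover have "(\<Sum>t<2*n. w i t j) = corner_col e n A (a * x + b * y) (c * y) i j" if ij: "i < 2 * n" "j < n" for i j
  proof (cases "i < n")
    case True
    have "w i t j = (if t = i then (a * x) *\<^sub>C (A $$ (i, j)) else 0) + (if t = n + j then (b * y) *\<^sub>C (A $$ (i, j)) else 0)"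
      if "t < 2 * n" for t
      using True ij that by (auto simp: w_def corner_col_def scaleC_scaleC mult.commute)
    then have "(\<Sum>t<2*n. w i t j) = (a * x) *\<^sub>C (A $$ (i, j)) + (b * y) *\<^sub>C (A $$ (i, j))"
      using ij by (simp add: sum.distrib)
    then show ?thesis using True by (simp add: corner_col_def scaleC_add_left)
  next
    case False
    have "w i t j = (if t = i then (if i = n + j then c * y else 0) *\<^sub>C e else 0)" if "t < 2 * n" for t
      using False that by (auto simp: w_def corner_col_def scaleC_scaleC)
    then show ?thesis using ij False by (simp add: corner_col_def)
  qed
  ultimately show ?thesis using represents_cong by blast
qed

text \<open>The row (1/x I, 0) discards the lower block and rescales the upper one to
  \<open>A\<close>. Its cost is where the final constant arises, so x should be as large as
  possible.\<close>

lemma represents_corner: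
  assumes Xs: "represents nrm Xs (2 * n) n (corner_col e n A x y) C" and n: "0 < n" and x: "x \<noteq> 0"
    and B: "osp_norm nrm K (coset_mat K (to_mat n (2 * n) (\<lambda>i t. (if i = t then 1 / x else 0) *\<^sub>C e))) \<le> B"
    and nonneg: "0 \<le> osp_norm nrm K (coset_mat K (to_mat n (2 * n) (\<lambda>i t. (if i = t then 1 / x else 0) *\<^sub>C e)))" "0 \<le> C"
  shows "\<exists>Ys. represents nrm Ys n n (\<lambda>i j. A $$ (i, j)) (B * C)"
proof -
  have rep: "represents nrm (coset_mat K (to_mat n (2 * n) (\<lambda>i t. (if i = t then 1 / x else 0) *\<^sub>C e)) # Xs) n n
    (\<lambda>i j. \<Sum>t<2*n. (if i = t then 1 / x else 0) *\<^sub>C corner_col e n A x y t j) (B * C)"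
    by (rule represents_Cons[OF Xs n B nonneg]) (rule q_mult_scalar_left)
  have eq: "(\<Sum>t<2*n. (if i = t then 1 / x else 0) *\<^sub>C corner_col e n A x y t j) = A $$ (i, j)" if "i < n" for i j
  proof -
    have "(\<Sum>t<2*n. (if i = t then 1 / x else 0) *\<^sub>C corner_col e n A x y t j) = (\<Sum>t<2*n. if i = t then A $$ (i, j) else 0)"
      using that x by (intro sum.cong) (auto simp: corner_col_def scaleC_scaleC scaleC_one)
    then show ?thesis using that by simp
  qed
  show ?thesis by (rule exI, rule represents_cong[OF rep eq])
qed

end

section \<open>From accretive matrices to factorizations\<close>

lemma sum_lessThan_plus:
  fixes f :: "nat \<Rightarrow> 'a::comm_monoid_add"
  shows "(\<Sum>i<n + m. f i) = (\<Sum>i<n. f i) + (\<Sum>i<m. f (n + i))"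
  by (induction m) (simp_all add: add.assoc)

lemma sum_lessThan_double:
  fixes f :: "nat \<Rightarrow> 'a::comm_monoid_add"
  shows "(\<Sum>i<2 * n. f i) = (\<Sum>i<n. f i) + (\<Sum>i<n. f (n + i))"
  using sum_lessThan_plus[of f n n] by (simp add: mult_2)

text \<open>For the step weights: the lower bound guarantees enough progress in x, the upper bound
  keeps each step small.\<close>

lemma one_minus_sqrt_bounds:
  fixes u :: real
  assumes "0 \<le> u" "u \<le> 1"
  shows "u / 2 \<le> 1 - sqrt (1 - u)" "1 - sqrt (1 - u) \<le> u"
proof -
  have "sqrt (1 - u) \<le> sqrt ((1 - u / 2)\<^sup>2)"
    by (intro real_sqrt_le_mono) (simp add: power2_eq_square algebra_simps)
  then show "u / 2 \<le> 1 - sqrt (1 - u)" using assms by simp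
  have "sqrt ((1 - u)\<^sup>2) \<le> sqrt (1 - u)"
    using mult_left_mono[of "1 - u" 1 "1 - u"] assms
    by (intro real_sqrt_le_mono) (simp add: power2_eq_square)
  then show "1 - sqrt (1 - u) \<le> u" using assms by simp
qed

locale quotient_setting = uci_map H ip \<phi> e nrm + trivial_product K e
  for H :: "'h::complex_vector set" and ip and \<phi> :: "'x::complex_vector \<Rightarrow> 'h \<Rightarrow> 'h" and e nrm K
begin

lemma coset_mat_cong:
  "(\<And>i j. i < m \<Longrightarrow> j < k \<Longrightarrow> Z i j - W i j \<in> K) \<Longrightarrow> coset_mat K (to_mat m k Z) = coset_mat K (to_mat m k W)"
  unfolding coset_mat_def by (rule eq_matI) (simp_all add: coset_eq_iff[OF K])

lemma osp_norm_to_mat_le: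
  assumes "0 < m" "0 < k" "nrm (to_mat m k Z) \<le> B"
  shows "osp_norm nrm K (coset_mat K (to_mat m k Z)) \<le> B"
  using osp_norm_le[of "to_mat m k Z" K] assms by simp

lemma osp_norm_to_mat_nonneg:
  "0 < m \<Longrightarrow> 0 < k \<Longrightarrow> 0 \<le> osp_norm nrm K (coset_mat K (to_mat m k Z))"
  by (rule osp_norm_nonneg[OF K])
    (auto simp: mats_over_coset[OF K] coset_mat_def)

lemma represents_start:
  assumes n: "0 < n"
  shows "represents nrm [coset_mat K (to_mat (2 * n) n (corner_col e n A 0 1))] (2 * n) n (corner_col e n A 0 1) 1"
proof (rule represents_single)
  show "osp_norm nrm K (coset_mat K (to_mat (2 * n) n (corner_col e n A 0 1))) \<le> 1"
  proof (rule osp_norm_to_mat_le)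
    show "nrm (to_mat (2 * n) n (corner_col e n A 0 1)) \<le> 1"
    proof (rule nrm_le)
      fix \<xi> assume \<xi>: "\<forall>j<n. \<xi> j \<in> H"
      have "fun_act \<phi> n (corner_col e n A 0 1) \<xi> i = 0" if "i < n" for i
        unfolding fun_act_def using that \<xi> by (intro sum.neutral) (simp add: corner_col_def map_zero)
      moreover have "fun_act \<phi> n (corner_col e n A 0 1) \<xi> (n + i) = \<xi> i" if "i < n" for i
      proof -
        have "fun_act \<phi> n (corner_col e n A 0 1) \<xi> (n + i) = (\<Sum>j<n. if j = i then \<xi> i else 0)"
          unfolding fun_act_def
          by (rule sum.cong) (use \<xi> in \<open>auto simp: corner_col_def map_unit map_zero scaleC_one\<close>)
        then show ?thesis using that by simp
      qed
      ultimately show "sq_norm ip (2 * n) (fun_act \<phi> n (corner_col e n A 0 1) \<xi>) \<le> 1\<^sup>2 * sq_norm ip n \<xi>"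
        by (simp add: sq_norm_def sum_lessThan_double)
    qed (use n in simp_all)
  qed (use n in simp_all)
qed (use n in simp_all)

lemma osp_norm_row_le:
  assumes n: "0 < n" and r: "cmod r \<le> B"
  shows "osp_norm nrm K (coset_mat K (to_mat n (2 * n) (\<lambda>i t. (if i = t then r else 0) *\<^sub>C e))) \<le> B"
    (is "osp_norm nrm K (coset_mat K (to_mat n (2 * n) ?Z)) \<le> B")
proof (rule osp_norm_to_mat_le)
  show "nrm (to_mat n (2 * n) ?Z) \<le> B"
  proof (rule nrm_le)
    fix \<xi> assume \<xi>: "\<forall>j<2 * n. \<xi> j \<in> H"
    have "fun_act \<phi> (2 * n) ?Z \<xi> i = r *\<^sub>C \<xi> i" if i: "i < n" for i
    proof -
      have "fun_act \<phi> (2 * n) ?Z \<xi> i = (\<Sum>j<2*n. if j = i then r *\<^sub>C \<xi> i else 0)"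
        unfolding fun_act_def
        by (rule sum.cong) (use \<xi> i in \<open>auto simp: map_unit map_zero map_scale\<close>)
      then show ?thesis using i by simp
    qed
    then have "sq_norm ip n (fun_act \<phi> (2 * n) ?Z \<xi>) = sq_norm ip n (\<lambda>i. r *\<^sub>C \<xi> i)"
      by (simp add: sq_norm_def)
    also have "\<dots> = (cmod r)\<^sup>2 * sq_norm ip n \<xi>" using \<xi> by (intro sq_norm_scale) simp
    also have "\<dots> \<le> B\<^sup>2 * sq_norm ip (2 * n) \<xi>"
      using r by (intro mult_mono power_mono) (auto simp: sq_norm_def intro!: sum_mono2 sum_nonneg)
    finally show "sq_norm ip n (fun_act \<phi> (2 * n) ?Z \<xi>) \<le> B\<^sup>2 * sq_norm ip (2 * n) \<xi>" .
  qed (use n order_trans[OF norm_ge_zero r] in simp_all)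
qed (use n in simp_all)

text \<open>
  The generator \<open>T\<close> is accretive, hence so are its congruences by positive diagonal
  matrices \<open>D\<close>, and \<open>I - D T D\<close> has norm \<open>1\<close> up to second order in \<open>D\<^sup>2\<close>.
\<close>

lemma represents_step:
  assumes n: "0 < n" and c: "0 < c" and acc: "accretive H ip \<phi> (2 * n) T"
    and T: "\<And>i j. i < 2 * n \<Longrightarrow> j < 2 * n \<Longrightarrow> T i j - upper e n A (of_real c) 1 (of_real c) i j \<in> K"
    and p: "0 \<le> p" "p \<le> g" and r: "0 \<le> r" "r \<le> g" and C: "0 \<le> C"
    and Xs: "represents nrm Xs (2 * n) n (corner_col e n A (of_real (- x)) (of_real y)) C"
  shows "\<exists>Ys. represents nrm Ys (2 * n) n
    (corner_col e n A (of_real (- ((1 - p * c) * x + sqrt p * sqrt r * y))) (of_real ((1 - r * c) * y)))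
    (sqrt (1 + (g * nrm (to_mat (2 * n) (2 * n) T))\<^sup>2) * C)"
proof -
  \<comment> \<open>The diagonal of D: speed \<open>p\<close> on the upper block and
    \<open>r\<close> on the lower. Modulo \<open>K\<close> the factor \<open>I - D T D\<close> is
    the matrix \<open>M\<close> below. Its corner is negative, which explains the sign convention
    \<open>- x\<close>.\<close>
  define s where "s i = (if i < n then sqrt p else sqrt r)" for i
  define M where "M = upper e n A (of_real (1 - p * c)) (of_real (- (sqrt p * sqrt r))) (of_real (1 - r * c))"
  let ?D = "\<lambda>i j. complex_of_real (s i * s j) *\<^sub>C T i j"
  let ?B = "sqrt (1 + (g * nrm (to_mat (2 * n) (2 * n) T))\<^sup>2)"
  have "(unit_mat e - ?D) i j - M i j \<in> K" if ij: "i < 2 * n" "j < 2 * n" for i j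
  proof -
    have "unit_mat e i j - complex_of_real (s i * s j) *\<^sub>C upper e n A (of_real c) 1 (of_real c) i j = M i j"
    proof -
      have pp: "complex_of_real (sqrt p) * complex_of_real (sqrt p) = of_real p"
        "complex_of_real (sqrt r) * complex_of_real (sqrt r) = of_real r"
        using p r by (simp_all flip: of_real_mult)
      show ?thesis
        by (auto simp: M_def upper_def s_def scaleC_scaleC pp complex_vector.scale_left_diff_distrib
            complex_vector.scale_minus_left scaleC_one)
    qed
    then have eq0: "(unit_mat e - ?D) i j - M i j =
      (- complex_of_real (s i * s j)) *\<^sub>C (T i j - upper e n A (of_real c) 1 (of_real c) i j)"
      unfolding complex_vector.scale_minus_left complex_vector.scale_right_diff_distrib
      by (simp add: fun_diff_def algebra_simps)
    show ?thesis unfolding eq0 by (rule complex_vector.subspace_scale[OF K T[OF ij]])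
  qed
  then have eq: "coset_mat K (to_mat (2 * n) (2 * n) (unit_mat e - ?D)) = coset_mat K (to_mat (2 * n) (2 * n) M)"
    by (rule coset_mat_cong)
  have "osp_norm nrm K (coset_mat K (to_mat (2 * n) (2 * n) M)) \<le> ?B"
    unfolding eq[symmetric]
  proof (rule osp_norm_to_mat_le)
    show "nrm (to_mat (2 * n) (2 * n) (unit_mat e - ?D)) \<le> ?B"
      by (rule nrm_step[OF _ acc]) (use n p r in \<open>auto simp: s_def\<close>)
  qed (use n in simp_all)
  from represents_upper[OF Xs n this[unfolded M_def] osp_norm_to_mat_nonneg C] n
  have "represents nrm (coset_mat K (to_mat (2 * n) (2 * n) M) # Xs) (2 * n) n
    (corner_col e n A (of_real (1 - p * c) * of_real (- x) + of_real (- (sqrt p * sqrt r)) * of_real y)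
      (of_real (1 - r * c) * of_real y)) (?B * C)"
    by (simp only: M_def)
  moreover have "of_real (1 - p * c) * of_real (- x) + of_real (- (sqrt p * sqrt r)) * of_real y
    = complex_of_real (- ((1 - p * c) * x + sqrt p * sqrt r * y))"
    unfolding of_real_mult[symmetric] of_real_add[symmetric] by (rule arg_cong[of _ _ complex_of_real]) simp
  ultimately show ?thesis unfolding of_real_mult[symmetric] by metis
qed

text \<open>
  The weights are those for which \<open>y\<^sup>2\<close> decreases linearly in the number of steps \<open>k\<close> and
  \<open>p\<close>, \<open>r\<close> satisfy \<open>(1 - p c)\<^sup>2 = (L + k) / (L + k + 1)\<close>,
  \<open>(1 - r c)\<^sup>2 = (M - k - 1) / (M - k)\<close>. Then \<open>\<surd>(L + k) x\<close> increases linearly in \<open>k\<close>,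
  while the cutoff \<open>L\<close> keeps every single step small.
\<close>

lemma represents_chain:
  assumes n: "0 < n" and c: "0 < c" and acc: "accretive H ip \<phi> (2 * n) T"
    and T: "\<And>i j. i < 2 * n \<Longrightarrow> j < 2 * n \<Longrightarrow> T i j - upper e n A (of_real c) 1 (of_real c) i j \<in> K"
    and L: "0 < L" "k + L \<le> M"
  shows "\<exists>Xs x. represents nrm Xs (2 * n) n
      (corner_col e n A (of_real (- x)) (of_real (sqrt (real (M - k) / real M))))
      (sqrt (1 + (1 / (c * real L) * nrm (to_mat (2 * n) (2 * n) T))\<^sup>2) ^ k) \<and>
    real k / (2 * c * sqrt (real M)) \<le> sqrt (real (L + k)) * x"
  using L(2)
proof (induction k)
  case 0
  have "represents nrm [coset_mat K (to_mat (2 * n) n (corner_col e n A 0 1))] (2 * n) n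
    (corner_col e n A (of_real (- 0)) (of_real (sqrt (real (M - 0) / real M)))) 1"
    using represents_start[OF n, of A] L 0 by simp
  then show ?case by (intro exI[of _ "[coset_mat K (to_mat (2 * n) n (corner_col e n A 0 1))]"] exI[of _ 0]) simp
next
  case (Suc k)
  define g where "g = 1 / (c * real L)"
  define \<kappa> where "\<kappa> = sqrt (1 + (g * nrm (to_mat (2 * n) (2 * n) T))\<^sup>2)"
  have \<kappa>: "0 \<le> \<kappa>" by (simp add: \<kappa>_def)
  define a where "a = real (L + k)"
  define b where "b = real (M - k)"
  have a: "0 < a" "real L \<le> a" and b: "1 \<le> b" "real L \<le> b" and M: "0 < real M"
    using Suc.prems L by (auto simp: a_def b_def)
  have Suc_a: "real (L + Suc k) = a + 1" and Suc_b: "real (M - Suc k) = b - 1"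
    using Suc.prems L by (auto simp: a_def b_def of_nat_diff)
  obtain Xs x where Xs: "represents nrm Xs (2 * n) n
      (corner_col e n A (of_real (- x)) (of_real (sqrt (b / real M)))) (\<kappa> ^ k)"
    and x: "real k / (2 * c * sqrt (real M)) \<le> sqrt a * x"
    using Suc unfolding \<kappa>_def g_def a_def b_def by auto
  define p where "p = (1 - sqrt (1 - 1 / (a + 1))) / c"
  define r where "r = (1 - sqrt (1 - 1 / b)) / c"
  have ua: "0 \<le> 1 / (a + 1)" "1 / (a + 1) \<le> 1" and ub: "0 \<le> 1 / b" "1 / b \<le> 1" using a b by auto
  note p_bounds = one_minus_sqrt_bounds[OF ua] and r_bounds = one_minus_sqrt_bounds[OF ub]
  have p_lower: "1 / (2 * c * (a + 1)) \<le> p" and r_lower: "1 / (2 * c * b) \<le> r"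
    using divide_right_mono[OF p_bounds(1), of c] divide_right_mono[OF r_bounds(1), of c] c
    by (simp_all add: p_def r_def mult.commute mult.left_commute)
  have "p \<le> 1 / (a + 1) / c" "r \<le> 1 / b / c"
    using divide_right_mono[OF p_bounds(2), of c] divide_right_mono[OF r_bounds(2), of c] c
    by (simp_all add: p_def r_def)
  moreover have "1 / (a + 1) / c \<le> g" "1 / b / c \<le> g"
    using a b c L by (simp_all add: g_def frac_le)
  ultimately have p_upper: "p \<le> g" and r_upper: "r \<le> g" by linarith+
  have "0 \<le> 1 / (2 * c * (a + 1))" "0 \<le> 1 / (2 * c * b)" using a b c by simp_all
  with p_lower r_lower have p0: "0 \<le> p" and r0: "0 \<le> r" by linarith+
  \<comment> \<open>The next x: the old value shrinks by the factor \<open>1 - p * c\<close> and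
    gains what the corner of the step transfers from y.\<close>
  define x' where "x' = (1 - p * c) * x + sqrt p * sqrt r * sqrt (b / real M)"
  obtain Ys where Ys: "represents nrm Ys (2 * n) n
    (corner_col e n A (of_real (- x')) (of_real ((1 - r * c) * sqrt (b / real M)))) (\<kappa> * \<kappa> ^ k)"
    using represents_step[OF n c acc T p0 p_upper r0 r_upper _ Xs] \<kappa> unfolding x'_def \<kappa>_def by auto
  have pc: "1 - p * c = sqrt (a / (a + 1))"
    using a c by (simp add: p_def field_simps)
  have rc: "1 - r * c = sqrt ((b - 1) / b)"
    using b c by (simp add: r_def field_simps)
  have "(1 - r * c) * sqrt (b / real M) = sqrt (real (M - Suc k) / real M)"
    unfolding rc Suc_b using b by (simp flip: real_sqrt_mult)
  moreover have "real (Suc k) / (2 * c * sqrt (real M)) \<le> sqrt (real (L + Suc k)) * x'"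
  proof -
    \<comment> \<open>The gain of one step. The weights make both \<open>(a + 1) * p\<close> and
      \<open>r * b\<close> at least \<open>1 / (2 * c)\<close>, and the remaining factors cancel
      against y, so this lower bound does not depend on \<open>k\<close>.\<close>
    have "1 / (2 * c) * (1 / sqrt (real M)) \<le> sqrt ((a + 1) * p) * sqrt (r * b) * (1 / sqrt (real M))"
    proof (rule mult_right_mono)
      have "1 / (2 * c) \<le> (a + 1) * p"
        using mult_left_mono[OF p_lower, of "a + 1"] a c by (simp add: divide_simps)
      moreover have "1 / (2 * c) \<le> r * b"
        using mult_right_mono[OF r_lower, of b] b c by (simp add: divide_simps)
      ultimately have "sqrt (1 / (2 * c)) * sqrt (1 / (2 * c)) \<le> sqrt ((a + 1) * p) * sqrt (r * b)"
        using c a b p0 r0 by (intro mult_mono real_sqrt_le_mono real_sqrt_ge_zero) simp_all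
      then show "1 / (2 * c) \<le> sqrt ((a + 1) * p) * sqrt (r * b)" using c by simp
    qed simp
    also have "\<dots> = sqrt (a + 1) * (sqrt p * sqrt r * sqrt (b / real M))"
      by (simp add: real_sqrt_mult real_sqrt_divide)
    finally have 1: "1 / (2 * c) * (1 / sqrt (real M)) \<le> sqrt (a + 1) * (sqrt p * sqrt r * sqrt (b / real M))" .
    \<comment> \<open>The rescaling by \<open>sqrt a\<close> absorbs the shrinking of x exactly, so
      that the gains of all steps simply add up.\<close>
    have 2: "sqrt (a + 1) * ((1 - p * c) * x) = sqrt a * x"
      unfolding pc using a by (simp add: real_sqrt_divide)
    have "real (Suc k) / (2 * c * sqrt (real M)) = real k / (2 * c * sqrt (real M)) + 1 / (2 * c) * (1 / sqrt (real M))"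
      by (simp add: add_divide_distrib)
    also have "\<dots> \<le> sqrt a * x + sqrt (a + 1) * (sqrt p * sqrt r * sqrt (b / real M))"
      using x 1 by (rule add_mono)
    also have "\<dots> = sqrt (real (L + Suc k)) * x'"
      unfolding x'_def Suc_a distrib_left 2 ..
    finally show ?thesis .
  qed
  ultimately show ?case using Ys unfolding \<kappa>_def g_def by auto
qed

lemma factorization_norm_le:
  assumes Ys: "represents nrm Ys n n (\<lambda>i j. A $$ (i, j)) B" and A: "A \<in> carrier_mat n n"
  shows "factorization_norm (quotient_space K) (e +o K) (osp_norm nrm K) (coset_mat K A) \<le> B"
proof -
  have comp: "composable (quotient_space K) Ys" using Ys by (simp add: represents_def)
  have prod: "product_is (quotient_space K) (e +o K) Ys (coset_mat K A)"
    using Ys A by (auto simp: represents_def product_is_def coset_mat_def)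
  have "0 < n" using composable_dims[OF comp] Ys by (simp add: represents_def)
  then have "coset_mat K A \<in> mats_over (vcarrier (quotient_space K))"
    using A by (auto simp: mats_over_coset[OF K] coset_mat_def)
  with comp prod have perm: "permissible (quotient_space K) (e +o K) Ys"
    by (auto simp: permissible_def)
  have "factorization_norm (quotient_space K) (e +o K) (osp_norm nrm K) (coset_mat K A)
    \<le> prod_list (map (osp_norm nrm K) Ys)"
    unfolding factorization_norm_def
  proof (rule cInf_lower)
    show "bdd_below {prod_list (map (osp_norm nrm K) Xs) | Xs.
      permissible (quotient_space K) (e +o K) Xs \<and> product_is (quotient_space K) (e +o K) Xs (coset_mat K A)}"
    proof (rule bdd_belowI[of _ 0], clarify)
      fix Xs assume "permissible (quotient_space K) (e +o K) Xs"
      then have "\<forall>X\<in>set Xs. 0 \<le> osp_norm nrm K X"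
        using osp_norm_nonneg[OF K] by (auto simp: permissible_def composable_def)
      then show "0 \<le> prod_list (map (osp_norm nrm K) Xs)" by (induction Xs) simp_all
    qed
  qed (use perm prod in blast)
  also have "\<dots> \<le> B" using Ys by (simp add: represents_def)
  finally show ?thesis .
qed

text \<open>The cost is the reciprocal of the final x times the product of the step norms. Both the
  loss in x and the excess of the step norms vanish as the discretization is refined, leaving
  \<open>2 * c\<close>.\<close>

lemma factorization_norm_le_accretive:
  assumes n: "0 < n" and c: "0 < c" and acc: "accretive H ip \<phi> (2 * n) T"
    and T: "\<And>i j. i < 2 * n \<Longrightarrow> j < 2 * n \<Longrightarrow> T i j - upper e n A (of_real c) 1 (of_real c) i j \<in> K"
    and A: "A \<in> carrier_mat n n"
  shows "factorization_norm (quotient_space K) (e +o K) (osp_norm nrm K) (coset_mat K A) \<le> 2 * c"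
    (is "?F \<le> _")
proof -
  define N where "N = nrm (to_mat (2 * n) (2 * n) T)"
  define \<beta> where "\<beta> = N\<^sup>2 / (2 * c\<^sup>2)"
  have bound: "?F \<le> 2 * c / (1 - 1 / real m) * exp (\<beta> * (1 / real m))" if m: "2 \<le> m" for m
  proof -
    \<comment> \<open>With about M steps of size at most \<open>1 / (c * L)\<close>, the second
      order costs add up to order M / L^2, while stopping L steps early and starting at offset L
      loses the fraction L / M of x. The choice L = m^2, M = m^3 makes both of order 1 / m.\<close>
    define L where "L = m\<^sup>2"
    define M where "M = m ^ 3"
    define k where "k = M - L"
    define \<kappa> where "\<kappa> = sqrt (1 + (1 / (c * real L) * N)\<^sup>2)"
    have LM: "0 < L" "L < M" using m by (auto simp: L_def M_def intro!: power_strict_increasing)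
    have kLM: "k + L \<le> M" "L + k = M" using LM by (auto simp: k_def)
    obtain Xs x where Xs: "represents nrm Xs (2 * n) n
        (corner_col e n A (of_real (- x)) (of_real (sqrt (real (M - k) / real M)))) (\<kappa> ^ k)"
      and x: "real k / (2 * c * sqrt (real M)) \<le> sqrt (real (L + k)) * x"
      using represents_chain[OF n c acc T LM(1) kLM(1)] unfolding \<kappa>_def N_def by blast
    have M: "0 < real M" using LM by simp
    have "real k / (2 * c) = real k / (2 * c * sqrt (real M)) * sqrt (real M)" using M by simp
    also have "\<dots> \<le> sqrt (real M) * x * sqrt (real M)"
      using x unfolding kLM(2) by (intro mult_right_mono) simp_all
    also have "\<dots> = real M * x" using M by simp
    finally have "real k / (2 * c) / real M \<le> x" unfolding pos_divide_le_eq[OF M] by (simp only: mult.commute)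
    moreover have "real k / real M = 1 - 1 / real m"
      using LM m by (simp add: k_def of_nat_diff diff_divide_distrib) (simp add: L_def M_def power3_eq_cube power2_eq_square)
    moreover have "real k / (2 * c) / real M = real k / real M / (2 * c)" by (simp add: mult.commute)
    ultimately have x_lower: "(1 - 1 / real m) / (2 * c) \<le> x" by (simp only:)
    have m1: "0 < 1 - 1 / real m" using m by simp
    then have x0: "0 < x" using x_lower c by (meson divide_pos_pos less_le_trans mult_pos_pos zero_less_numeral)
    have \<kappa>0: "0 \<le> \<kappa>" by (simp add: \<kappa>_def)
    obtain Ys where Ys: "represents nrm Ys n n (\<lambda>i j. A $$ (i, j)) (1 / x * \<kappa> ^ k)"
    proof -
      have "\<exists>Ys. represents nrm Ys n n (\<lambda>i j. A $$ (i, j)) (1 / x * \<kappa> ^ k)"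
        by (rule represents_corner[OF Xs n _ osp_norm_row_le osp_norm_to_mat_nonneg])
          (use n x0 \<kappa>0 in \<open>simp_all add: norm_divide\<close>)
      then show ?thesis using that by blast
    qed
    have "?F \<le> 1 / x * \<kappa> ^ k" by (rule factorization_norm_le[OF Ys A])
    also have "\<dots> \<le> 2 * c / (1 - 1 / real m) * exp (\<beta> * (1 / real m))"
    proof (rule mult_mono)
      have "1 / x \<le> 1 / ((1 - 1 / real m) / (2 * c))"
        using x_lower m1 c by (intro divide_left_mono) (simp_all add: x0)
      then show "1 / x \<le> 2 * c / (1 - 1 / real m)" by simp
      \<comment> \<open>The estimate 1 + 2 t \<le> exp (2 t) with t =
        \<open>\<beta> / real m ^ 4\<close>, where \<open>\<beta>\<close> was chosen to make the
        left side equal to the square of \<open>\<kappa>\<close>.\<close>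
      have "\<kappa> \<le> sqrt ((exp (\<beta> / real m ^ 4))\<^sup>2)" unfolding \<kappa>_def
      proof (rule real_sqrt_le_mono)
        have "(1 / (c * real L) * N)\<^sup>2 = 2 * (\<beta> / real m ^ 4)"
          by (simp add: \<beta>_def L_def power_mult_distrib power_divide flip: power_mult)
        then have "1 + (1 / (c * real L) * N)\<^sup>2 \<le> exp (2 * (\<beta> / real m ^ 4))" by simp
        then show "1 + (1 / (c * real L) * N)\<^sup>2 \<le> (exp (\<beta> / real m ^ 4))\<^sup>2" by (simp only: exp_double)
      qed
      then have "\<kappa> ^ k \<le> exp (\<beta> / real m ^ 4) ^ k" using \<kappa>0 by (intro power_mono) simp_all
      also have "\<dots> = exp (real k * (\<beta> / real m ^ 4))" by (rule exp_of_nat_mult[symmetric])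
      also have "\<dots> \<le> exp (real M * (\<beta> / real m ^ 4))"
        by (simp only: exp_le_cancel_iff, rule mult_right_mono) (simp_all add: k_def \<beta>_def)
      also have "real M * (\<beta> / real m ^ 4) = \<beta> * (1 / real m)"
        using m by (simp add: M_def eval_nat_numeral)
      finally show "\<kappa> ^ k \<le> exp (\<beta> * (1 / real m))" .
    qed (use c m1 \<kappa>0 in simp_all)
    finally show ?thesis .
  qed
  have "(\<lambda>m. 2 * c / (1 - 1 / real m) * exp (\<beta> * (1 / real m))) \<longlonglongrightarrow> 2 * c / (1 - 0) * exp (\<beta> * 0)"
    by (intro tendsto_intros lim_1_over_n) simp
  then have "(\<lambda>m. 2 * c / (1 - 1 / real m) * exp (\<beta> * (1 / real m))) \<longlonglongrightarrow> 2 * c" by simp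
  then show ?thesis by (rule LIMSEQ_le_const) (use bound in blast)
qed

end

section \<open>From the unital quotient norm to accretive matrices\<close>

lemma ucc_map_iff: "ucc_map H ip \<phi> e nrm \<longleftrightarrow> ucc H ip nrm e \<phi>"
  by (auto simp: ucc_def ucc_map_def ucc_map_axioms_def unital_op_map_def unital_op_map_axioms_def
      op_map_def op_map_axioms_def)

lemma (in op_map) op_kernel_subspace: "csubspace (op_kernel H \<phi>)"
  by (rule complex_vector.subspaceI) (auto simp: op_kernel_def map_zero map_add map_scale)

lemma (in op_map) accretive_add:
  assumes "accretive H ip \<phi> d Z" "accretive H ip \<phi> d W"
  shows "accretive H ip \<phi> d (Z + W)"
  unfolding accretive_def
proof (intro allI impI)
  fix \<xi> assume \<xi>: "\<forall>j<d. \<xi> j \<in> H"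
  then have "0 \<le> quad ip \<phi> d Z \<xi>" "0 \<le> quad ip \<phi> d W \<xi>" using assms by (simp_all add: accretive_def)
  then show "0 \<le> quad ip \<phi> d (Z + W) \<xi>" using quad_add[OF \<xi>, of Z W] by linarith
qed

lemma (in op_map) accretive_scale:
  assumes "accretive H ip \<phi> d Z" "0 \<le> r"
  shows "accretive H ip \<phi> d (complex_of_real r *\<^sub>C Z)"
  unfolding accretive_def
proof (intro allI impI)
  fix \<xi> assume \<xi>: "\<forall>j<d. \<xi> j \<in> H"
  then have "0 \<le> quad ip \<phi> d Z \<xi>" using assms(1) by (simp add: accretive_def)
  then show "0 \<le> quad ip \<phi> d (complex_of_real r *\<^sub>C Z) \<xi>"
    using quad_scale[OF \<xi>, of r Z] assms(2) by simp
qed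

lemma (in unital_op_map) quad_upper:
  assumes \<xi>: "\<forall>j<2 * n. \<xi> j \<in> H"
  shows "quad ip \<phi> (2 * n) (upper e n A (of_real c) 1 (of_real c)) \<xi> =
    c * sq_norm ip (2 * n) \<xi> +
    (\<Sum>i<n. Re (ip (fun_act \<phi> n (\<lambda>i j. A $$ (i, j)) (\<lambda>j. \<xi> (n + j)) i) (\<xi> i)))"
proof -
  have \<xi>1: "\<And>j. j < n \<Longrightarrow> \<xi> j \<in> H" and \<xi>2: "\<And>j. j < n \<Longrightarrow> \<xi> (n + j) \<in> H" using \<xi> by auto
  define Z where "Z i t = (if i < n \<and> n \<le> t then A $$ (i, t - n) else 0)" for i t
  have "upper e n A (of_real c) 1 (of_real c) = of_real c *\<^sub>C unit_mat e + Z"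
    by (intro ext) (auto simp: upper_def Z_def scaleC_one)
  then have "quad ip \<phi> (2 * n) (upper e n A (of_real c) 1 (of_real c)) \<xi> =
    c * sq_norm ip (2 * n) \<xi> + quad ip \<phi> (2 * n) Z \<xi>"
    by (simp only: quad_add[OF \<xi>, of _ Z] quad_scale[OF \<xi>, of _ "unit_mat e"] quad_unit[OF \<xi>])
  moreover have "quad ip \<phi> (2 * n) Z \<xi> = (\<Sum>i<n. \<Sum>j<n. Re (ip (\<phi> (A $$ (i, j)) (\<xi> (n + j))) (\<xi> i)))"
    using \<xi>1 \<xi>2 by (simp add: quad_def sum_lessThan_double Z_def map_zero)
  moreover have "\<dots> = (\<Sum>i<n. Re (ip (fun_act \<phi> n (\<lambda>i j. A $$ (i, j)) (\<lambda>j. \<xi> (n + j)) i) (\<xi> i)))"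
    unfolding fun_act_def using \<xi>1 \<xi>2 by (intro sum.cong refl) (simp add: ip_sum_left map_mem)
  ultimately show ?thesis by simp
qed

context quotient_setting
begin

text \<open>
  Adding a small multiple of this functional to a positive functional makes it definite, so that
  the Hilbert space constructed from it needs no quotient.
\<close>

definition state_trace :: "('l \<Rightarrow> 'l \<Rightarrow> complex) \<Rightarrow> ('x \<Rightarrow> 'l \<Rightarrow> 'l) \<Rightarrow> 'l::zero \<Rightarrow> nat \<Rightarrow> (nat \<Rightarrow> nat \<Rightarrow> 'x) \<Rightarrow> real" where
  "state_trace ip' \<theta> v d Z = (\<Sum>i<d. quad ip' \<theta> d Z (\<lambda>j. if j = i then v else 0))"

lemma state_trace:
  assumes \<theta>: "ucc_map H' ip' \<theta> e nrm" and v: "v \<in> H'" "v \<noteq> 0"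
  shows "state_trace ip' \<theta> v d (Z + W) = state_trace ip' \<theta> v d Z + state_trace ip' \<theta> v d W"
    and "state_trace ip' \<theta> v d (complex_of_real r *\<^sub>C Z) = r * state_trace ip' \<theta> v d Z"
    and "accretive H ip \<phi> d Z \<Longrightarrow> 0 \<le> state_trace ip' \<theta> v d Z"
    and "\<exists>i<d. u i \<noteq> 0 \<Longrightarrow> 0 < state_trace ip' \<theta> v d (\<lambda>i j. (cnj (u i) * u j) *\<^sub>C e)"
    and "x \<in> op_kernel H' \<theta> \<Longrightarrow> state_trace ip' \<theta> v d (\<lambda>i j. a i j *\<^sub>C x) = 0"
proof -
  interpret \<theta>: ucc_map H' ip' \<theta> e nrm by (rule \<theta>)
  have mem: "\<forall>j<d. (if j = i then v else 0) \<in> H'" for i using v by simp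
  show "state_trace ip' \<theta> v d (Z + W) = state_trace ip' \<theta> v d Z + state_trace ip' \<theta> v d W"
    unfolding state_trace_def by (simp only: \<theta>.quad_add[OF mem, of Z W] sum.distrib)
  show "state_trace ip' \<theta> v d (complex_of_real r *\<^sub>C Z) = r * state_trace ip' \<theta> v d Z"
    unfolding state_trace_def by (simp only: \<theta>.quad_scale[OF mem, of r Z] sum_distrib_left)
  show "0 \<le> state_trace ip' \<theta> v d Z" if "accretive H ip \<phi> d Z"
    unfolding state_trace_def
    by (rule sum_nonneg, rule accretive_ucc[OF that \<theta>, unfolded accretive_def, rule_format]) (use v in simp)
  show "0 < state_trace ip' \<theta> v d (\<lambda>i j. (cnj (u i) * u j) *\<^sub>C e)" if u: "\<exists>i<d. u i \<noteq> 0"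
  proof -
    have eq: "quad ip' \<theta> d (\<lambda>i j. (cnj (u i) * u j) *\<^sub>C e) (\<lambda>j. if j = i then v else 0)
      = (cmod (u i))\<^sup>2 * Re (ip' v v)" if i: "i < d" for i
    proof -
      have "(\<Sum>j<d. u j *\<^sub>C (if j = i then v else 0)) = (\<Sum>j<d. if j = i then u i *\<^sub>C v else 0)"
        by (rule sum.cong) auto
      also have "\<dots> = u i *\<^sub>C v" using i by simp
      finally show ?thesis unfolding \<theta>.quad_rank_one[OF mem]
        using v \<theta>.hnorm_scale[of v "u i"] by (simp add: \<theta>.map_unit \<theta>.mem_scale \<theta>.hnorm_sq)
    qed
    obtain i where i: "i < d" "u i \<noteq> 0" using u by blast
    have "0 < (\<Sum>i<d. (cmod (u i))\<^sup>2 * Re (ip' v v))"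
      using i v \<theta>.ip_pos[OF v] by (intro sum_pos2[of _ i]) auto
    then show ?thesis unfolding state_trace_def by (simp add: eq)
  qed
  show "state_trace ip' \<theta> v d (\<lambda>i j. a i j *\<^sub>C x) = 0" if "x \<in> op_kernel H' \<theta>"
    using that v unfolding state_trace_def quad_def
    by (intro sum.neutral ballI) (auto simp: \<theta>.map_scale op_kernel_def)
qed

text \<open>The map that provides \<open>K\<close> may live in another ambient type. Representing a
  vector state of it, the case d = 1 of the representation, moves it into the given universe, so
  that the supremum in the unital quotient norm is over a nonempty set.\<close>

lemma exists_ucc:
  assumes \<theta>: "ucc_map H0 ip0 \<theta> e nrm" and K\<theta>: "K \<subseteq> op_kernel H0 \<theta>"
    and inf: "infinite_cdim TYPE('k::complex_vector)"
  shows "\<exists>(H' :: 'k set) ip' \<psi>. ucc_map H' ip' \<psi> e nrm \<and> K \<subseteq> op_kernel H' \<psi>"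
proof -
  interpret \<theta>: ucc_map H0 ip0 \<theta> e nrm by (rule \<theta>)
  obtain v where v: "v \<in> H0" "v \<noteq> 0" using \<theta>.nontrivial \<theta>.mem_zero by blast
  obtain H' :: "'k set" and ip' \<psi> where \<psi>: "ucc_map H' ip' \<psi> e nrm"
    and ker: "\<And>x. (\<forall>c. state_trace ip0 \<theta> v 1 (\<lambda>i j. c i j *\<^sub>C x) = 0) \<Longrightarrow> x \<in> op_kernel H' \<psi>"
    using positive_functional_representation[OF inf, of 1 "state_trace ip0 \<theta> v 1"]
      state_trace[OF \<theta> v, where d = 1] by auto
  moreover have "K \<subseteq> op_kernel H' \<psi>" 
    by (rule subsetI, rule ker, rule allI, rule state_trace(5)[OF \<theta> v]) (use K\<theta> in blast)
  ultimately show ?thesis by blast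
qed

text \<open>If the matrix were outside the cone of matrices accretive modulo \<open>K\<close>, a
  separating functional would be represented, after a small perturbation, by a ucc map killing
  \<open>K\<close>. The bound \<open>s\<close> for that map gives the matrix real part at least
  \<open>c - s / 2\<close>, and this positive gap survives when the perturbation tends to 0.\<close>

lemma accretive_lift_exists:
  assumes \<theta>: "ucc_map H0 ip0 \<theta> e nrm" and K\<theta>: "K \<subseteq> op_kernel H0 \<theta>"
    and inf: "infinite_cdim TYPE('k::complex_vector)" and n: "0 < n" and A: "A \<in> carrier_mat n n"
    and ub: "\<And>(H' :: 'k set) ip' \<psi>. ucc_map H' ip' \<psi> e nrm \<Longrightarrow> K \<subseteq> op_kernel H' \<psi> \<Longrightarrow>
      op_mat_norm H' ip' (map_mat \<psi> A) \<le> s"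
    and s: "0 \<le> s" "s < 2 * c"
  shows "\<exists>T. accretive H ip \<phi> (2 * n) T \<and>
    (\<forall>i<2 * n. \<forall>j<2 * n. T i j - upper e n A (of_real c) 1 (of_real c) i j \<in> K)"
proof -
  define d where "d = 2 * n"
  define E where "E = upper e n A (of_real c) 1 (of_real c)"
  have d: "0 < d" using n by (simp add: d_def)
  define C where "C = {Z. \<exists>Y. (\<forall>i<d. \<forall>j<d. Y i j \<in> K) \<and> accretive H ip \<phi> d (Z + Y)}"
  have accC: "Z \<in> C" if "accretive H ip \<phi> d Z" for Z
    unfolding C_def using that complex_vector.subspace_0[OF K]
    by (intro CollectI exI[of _ 0]) simp
  have C_add: "Z + W \<in> C" if ZW: "Z \<in> C" "W \<in> C" for Z W
  proof -
    obtain Y Y' where Y: "\<forall>i<d. \<forall>j<d. Y i j \<in> K" "accretive H ip \<phi> d (Z + Y)"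
      "\<forall>i<d. \<forall>j<d. Y' i j \<in> K" "accretive H ip \<phi> d (W + Y')" using ZW unfolding C_def by blast
    have "Z + W + (Y + Y') = (Z + Y) + (W + Y')" by (simp only: add_ac)
    then have "accretive H ip \<phi> d (Z + W + (Y + Y'))"
      using accretive_add[OF Y(2,4)] by (simp only:)
    moreover have "\<forall>i<d. \<forall>j<d. (Y + Y') i j \<in> K" using Y complex_vector.subspace_add[OF K] by simp
    ultimately show ?thesis unfolding C_def by blast
  qed
  have C_scale: "complex_of_real r *\<^sub>C Z \<in> C" if r: "0 \<le> r" and Z: "Z \<in> C" for r Z
  proof -
    obtain Y where Y: "\<forall>i<d. \<forall>j<d. Y i j \<in> K" "accretive H ip \<phi> d (Z + Y)" using Z unfolding C_def by blast
    have "accretive H ip \<phi> d (complex_of_real r *\<^sub>C (Z + Y))"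
      by (rule accretive_scale[OF Y(2) r])
    moreover have "\<forall>i<d. \<forall>j<d. (complex_of_real r *\<^sub>C Y) i j \<in> K"
      using Y complex_vector.subspace_scale[OF K] by simp
    ultimately show ?thesis unfolding C_def scaleC_add_right by blast
  qed
  have unit_acc: "accretive H ip \<phi> d (unit_mat e)" by (simp add: accretive_def quad_unit)
  have C_unit: "\<exists>t. Z + complex_of_real t *\<^sub>C unit_mat e \<in> C" for Z
  proof -
    define N where "N = nrm (to_mat d d Z)"
    \<comment> \<open>The constant is what \<open>quad_ge\<close> leaves once the image of the
      column is bounded by \<open>N\<close> times its norm.\<close>
    have "accretive H ip \<phi> d (Z + complex_of_real ((N\<^sup>2 + 1) / 2) *\<^sub>C unit_mat e)"
      unfolding accretive_def
    proof (intro allI impI)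
      fix \<xi> assume \<xi>: "\<forall>j<d. \<xi> j \<in> H"
      have ge: "- (N\<^sup>2 * sq_norm ip d \<xi> + sq_norm ip d \<xi>) \<le> 2 * quad ip \<phi> d Z \<xi>"
        using quad_ge[OF \<xi>, of Z] fun_act_le[OF d d \<xi>, of Z] unfolding N_def by linarith
      have eq: "(N\<^sup>2 + 1) / 2 * sq_norm ip d \<xi> = (N\<^sup>2 * sq_norm ip d \<xi> + sq_norm ip d \<xi>) / 2"
        by (simp add: algebra_simps)
      have "0 \<le> quad ip \<phi> d Z \<xi> + (N\<^sup>2 + 1) / 2 * sq_norm ip d \<xi>"
        unfolding eq using ge by (simp add: field_simps)
      then show "0 \<le> quad ip \<phi> d (Z + complex_of_real ((N\<^sup>2 + 1) / 2) *\<^sub>C unit_mat e) \<xi>"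
        by (simp only: quad_add[OF \<xi>, of Z] quad_scale[OF \<xi>, of _ "unit_mat e"] quad_unit[OF \<xi>])
    qed
    then show ?thesis using accC by blast
  qed
  have "E \<in> C"
  proof (rule ccontr)
    assume "E \<notin> C"
    from cone_separation[OF C_add C_scale C_unit accC[OF unit_acc] this]
    obtain f :: "(nat \<Rightarrow> nat \<Rightarrow> 'x) \<Rightarrow> real" where f_add: "\<And>Z W. f (Z + W) = f Z + f W"
      and f_scale: "\<And>r Z. f (complex_of_real r *\<^sub>C Z) = r * f Z"
      and f_pos: "\<And>Z. Z \<in> C \<Longrightarrow> 0 \<le> f Z" and f_unit: "f (unit_mat e) = 1" and f_E: "f E \<le> 0" by blast
    \<comment> \<open>The cone contains matrices over \<open>K\<close> together with their
      negatives, so a functional that is nonnegative on the cone vanishes on them.\<close>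
    have f_K: "f (\<lambda>i j. a i j *\<^sub>C x) = 0" if x: "x \<in> K" for a x
    proof -
      define Y where "Y = (\<lambda>i j. a i j *\<^sub>C x)"
      have YK: "Y i j \<in> K" "(- Y) i j \<in> K" for i j
        using complex_vector.subspace_scale[OF K x] complex_vector.subspace_neg[OF K] by (simp_all add: Y_def)
      have acc0: "accretive H ip \<phi> d 0" by (simp add: accretive_def quad_zero)
      have "Y \<in> C" unfolding C_def using YK acc0 by (intro CollectI exI[of _ "- Y"]) simp
      moreover have "- Y \<in> C" unfolding C_def using YK acc0 by (intro CollectI exI[of _ Y]) simp
      moreover have "f Y + f (- Y) = 0" using f_add[of Y "- Y"] f_add[of 0 0] by simp
      ultimately have "f Y = 0" using f_pos[of Y] f_pos[of "- Y"] by linarith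
      then show ?thesis by (simp add: Y_def)
    qed
    interpret \<theta>: ucc_map H0 ip0 \<theta> e nrm by (rule \<theta>)
    obtain v where v: "v \<in> H0" "v \<noteq> 0" using \<theta>.nontrivial \<theta>.mem_zero by blast
    define f0 where "f0 = state_trace ip0 \<theta> v d"
    note f0 = state_trace[OF \<theta> v, where d = d, folded f0_def]
    \<comment> \<open>The multiple \<open>\<eta>\<close> of \<open>f0\<close> makes the functional
      definite without leaving the accretive dual or the annihilator of \<open>K\<close>. Since
      \<open>f E\<close> is nonpositive, only the perturbation can account for a positive value at
      \<open>E\<close>.\<close>
    have key: "c - s / 2 \<le> \<eta> * f0 E" if \<eta>: "0 < \<eta>" for \<eta>
    proof -
      define f' where "f' Z = f Z + \<eta> * f0 Z" for Z
      have f'_pos: "0 < f' (\<lambda>i j. (cnj (u i) * u j) *\<^sub>C e)" if u: "\<exists>i<d. u i \<noteq> 0" for u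
      proof -
        have "accretive H ip \<phi> d (\<lambda>i j. (cnj (u i) * u j) *\<^sub>C e)" unfolding accretive_def
        proof (intro allI impI)
          fix \<xi> assume \<xi>: "\<forall>j<d. \<xi> j \<in> H"
          have "(\<Sum>j<d. u j *\<^sub>C \<xi> j) \<in> H" using \<xi> by (intro mem_sum mem_scale) simp
          then show "0 \<le> quad ip \<phi> d (\<lambda>i j. (cnj (u i) * u j) *\<^sub>C e) \<xi>"
            unfolding quad_rank_one[OF \<xi>] by (simp add: map_unit Re_ip_nonneg)
        qed
        then have "0 \<le> f (\<lambda>i j. (cnj (u i) * u j) *\<^sub>C e)" by (intro f_pos accC)
        moreover have "0 < \<eta> * f0 (\<lambda>i j. (cnj (u i) * u j) *\<^sub>C e)" using f0(4)[OF u] \<eta> by simp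
        ultimately show ?thesis unfolding f'_def by linarith
      qed
      have "\<exists>(H' :: 'k set) ip' \<psi> \<beta>. ucc_map H' ip' \<psi> e nrm \<and> (\<forall>i<d. \<beta> i \<in> H') \<and>
        (\<forall>Z. f' Z = quad ip' \<psi> d Z \<beta>) \<and> (\<forall>x. (\<forall>c. f' (\<lambda>i j. c i j *\<^sub>C x) = 0) \<longrightarrow> x \<in> op_kernel H' \<psi>)"
      proof (rule positive_functional_representation[OF inf d])
        show "f' (Z + W) = f' Z + f' W" for Z W
          unfolding f'_def by (simp only: f_add f0(1)) (simp add: algebra_simps)
        show "f' (complex_of_real r *\<^sub>C Z) = r * f' Z" for r Z
          unfolding f'_def by (simp only: f_scale f0(2)) (simp add: algebra_simps)
        show "0 \<le> f' Z" if "accretive H ip \<phi> d Z" for Z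
          unfolding f'_def using f_pos[OF accC[OF that]] f0(3)[OF that] \<eta> by simp
      qed (rule f'_pos)
      then obtain H' :: "'k set" and ip' \<psi> \<beta> where \<psi>: "ucc_map H' ip' \<psi> e nrm" and \<beta>: "\<forall>i<d. \<beta> i \<in> H'"
        and rep: "\<And>Z. f' Z = quad ip' \<psi> d Z \<beta>"
        and ker: "\<And>x. (\<forall>c. f' (\<lambda>i j. c i j *\<^sub>C x) = 0) \<Longrightarrow> x \<in> op_kernel H' \<psi>" by blast
      interpret \<psi>: ucc_map H' ip' \<psi> e nrm by (rule \<psi>)
      have "f' (\<lambda>i j. a i j *\<^sub>C x) = 0" if "x \<in> K" for a x
        unfolding f'_def using f_K[OF that, of a] f0(5)[of x a] that K\<theta> by auto
      then have "K \<subseteq> op_kernel H' \<psi>" by (intro subsetI ker allI)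
      from ub[OF \<psi> this] have norm_s: "op_mat_norm H' ip' (map_mat \<psi> A) \<le> s" .
      \<comment> \<open>\<open>bilinear_bound\<close> takes columns lying in the space at all
        indices, hence the extension by 0 beyond d.\<close>
      define \<gamma> where "\<gamma> i = (if i < d then \<beta> i else 0)" for i
      have \<gamma>: "\<gamma> i \<in> H'" for i using \<beta> by (simp add: \<gamma>_def)
      have rep\<gamma>: "f' Z = quad ip' \<psi> d Z \<gamma>" for Z unfolding rep quad_def by (simp add: \<gamma>_def)
      let ?a = "fun_act \<psi> n (\<lambda>i j. A $$ (i, j)) (\<lambda>j. \<gamma> (n + j))"
      have a: "?a i \<in> H'" for i using \<gamma> by (simp add: \<psi>.fun_act_mem)
      have "sq_norm ip' n ?a \<le> (op_mat_norm H' ip' (map_mat \<psi> A))\<^sup>2 * sq_norm ip' n (\<lambda>j. \<gamma> (n + j))"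
        using \<psi>.mat_act_le[OF \<psi>.op_mat_map, of A "\<lambda>j. \<gamma> (n + j)"] A \<gamma> \<psi>.sq_norm_mat_act[of A] by simp
      also have "\<dots> \<le> s\<^sup>2 * sq_norm ip' n (\<lambda>j. \<gamma> (n + j))"
        by (intro mult_right_mono power_mono norm_s \<psi>.op_mat_norm_nonneg \<psi>.op_mat_map) simp
      finally have "0 \<le> 2 * (\<Sum>i<n. Re (ip' (?a i) (\<gamma> i))) + s * (sq_norm ip' n (\<lambda>j. \<gamma> (n + j)) + sq_norm ip' n \<gamma>)"
        by (intro \<psi>.bilinear_bound a \<gamma> s(1))
      moreover have "sq_norm ip' d \<gamma> = sq_norm ip' n \<gamma> + sq_norm ip' n (\<lambda>j. \<gamma> (n + j))"
        unfolding d_def sq_norm_def by (rule sum_lessThan_double)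
      moreover have "f' E = c * sq_norm ip' d \<gamma> + (\<Sum>i<n. Re (ip' (?a i) (\<gamma> i)))"
        unfolding rep\<gamma> E_def d_def by (rule \<psi>.quad_upper) (simp add: \<gamma>)
      ultimately have "(c - s / 2) * sq_norm ip' d \<gamma> \<le> f' E" by (simp add: algebra_simps)
      moreover have "1 \<le> sq_norm ip' d \<gamma>"
      proof -
        have "sq_norm ip' d \<gamma> = f' (unit_mat e)"
          unfolding rep\<gamma> by (rule \<psi>.quad_unit[symmetric]) (simp add: \<gamma>)
        moreover have "0 \<le> f0 (unit_mat e)" by (rule f0(3)[OF unit_acc])
        ultimately show ?thesis using f_unit \<eta> unfolding f'_def by simp
      qed
      then have "(c - s / 2) * 1 \<le> (c - s / 2) * sq_norm ip' d \<gamma>" using s by (intro mult_left_mono) simp_all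
      ultimately show ?thesis using f_E unfolding f'_def by simp
    qed
    have "c - s / 2 \<le> 0"
    proof (rule field_le_epsilon)
      fix \<epsilon> :: real assume \<epsilon>: "0 < \<epsilon>"
      \<comment> \<open>The value of \<open>\<eta>\<close> that keeps the perturbation at
        \<open>E\<close> below \<epsilon>, whatever \<open>f0 E\<close> is.\<close>
      have "c - s / 2 \<le> \<epsilon> / (\<bar>f0 E\<bar> + 1) * f0 E" using \<epsilon> by (intro key divide_pos_pos) simp_all
      also have "\<dots> \<le> \<epsilon> / (\<bar>f0 E\<bar> + 1) * (\<bar>f0 E\<bar> + 1)" using \<epsilon> by (intro mult_left_mono) simp_all
      also have "\<dots> = 0 + \<epsilon>" by simp
      finally show "c - s / 2 \<le> 0 + \<epsilon>" .
    qed
    then show False using s by simp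
  qed
  then obtain Y where "\<forall>i<d. \<forall>j<d. Y i j \<in> K" "accretive H ip \<phi> d (E + Y)" unfolding C_def by blast
  then show ?thesis unfolding d_def E_def
    by (intro exI[of _ "upper e n A (of_real c) 1 (of_real c) + Y"]) simp
qed

end

theorem corollary6p6:
  fixes nrm :: "'x::complex_vector mat \<Rightarrow> real"
    and e :: 'x and K :: "'x set" and n :: nat and A :: "'x mat"
  assumes "unital_operator_space TYPE('g::complex_vector) nrm e"
    and "ucc_kernel TYPE('l::complex_vector) nrm e K"
    and "infinite_cdim TYPE('h::complex_vector)"
    and "1 \<le> n"
    and "A \<in> carrier_mat n n"
  shows "usp_norm TYPE('h) nrm e K A =
    factorization_norm (quotient_space K) (e +o K) (osp_norm nrm K) (coset_mat K A)"
proof -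
  obtain G :: "'g set" and ipG \<Phi> where "complex_hilbert_space G ipG" "op_linear G ipG \<Phi>"
    "completely_isometric G ipG nrm \<Phi>" "op_unital G e \<Phi>"
    using assms(1) by (auto simp: unital_operator_space_def)
  then have "uci_map G ipG \<Phi> e nrm"
    by (simp add: uci_map_def uci_map_axioms_def unital_op_map_def unital_op_map_axioms_def
        op_map_def op_map_axioms_def)
  then interpret uci_map G ipG \<Phi> e nrm .
  obtain L :: "'l set" and ipL \<theta> where \<theta>: "ucc_map L ipL \<theta> e nrm" and K_eq: "K = op_kernel L \<theta>"
    using assms(2) by (auto simp: ucc_kernel_def ucc_map_iff)
  interpret \<theta>: ucc_map L ipL \<theta> e nrm by (rule \<theta>)
  have K: "csubspace K" unfolding K_eq by (rule \<theta>.op_kernel_subspace)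
  interpret quotient_setting G ipG \<Phi> e nrm K by unfold_locales (rule K)
  have n: "0 < n" and A: "A \<in> carrier_mat n n" using assms(4,5) by simp_all
  note inf = assms(3)
  let ?F = "factorization_norm (quotient_space K) (e +o K) (osp_norm nrm K) (coset_mat K A)"
  let ?S = "{op_mat_norm H ip (map_mat \<phi> A) | (H :: 'h set) ip \<phi>. ucc H ip nrm e \<phi> \<and> K \<subseteq> op_kernel H \<phi>}"
  have S_nonempty: "?S \<noteq> {}"
    using exists_ucc[OF \<theta> _ inf] unfolding K_eq[symmetric] ucc_map_iff by blast
  have S_nonneg: "0 \<le> r" if rS: "r \<in> ?S" for r
  proof -
    obtain H :: "'h set" and ip \<phi> where r: "r = op_mat_norm H ip (map_mat \<phi> A)" and "ucc H ip nrm e \<phi>"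
      using rS by blast
    then interpret ucc: ucc_map H ip \<phi> e nrm by (simp add: ucc_map_iff)
    show ?thesis unfolding r by (rule ucc.op_mat_norm_nonneg[OF ucc.op_mat_map])
  qed
  \<comment> \<open>Contractivity bounds all the norms by that of \<open>A\<close>, so the supremum
    in \<open>usp_norm\<close> is a genuine one.\<close>
  have S_bdd: "bdd_above ?S"
  proof (rule bdd_aboveI)
    fix r assume "r \<in> ?S"
    then obtain H :: "'h set" and ip \<phi> where r: "r = op_mat_norm H ip (map_mat \<phi> A)" and "ucc H ip nrm e \<phi>"
      by blast
    then interpret ucc: ucc_map H ip \<phi> e nrm by (simp add: ucc_map_iff)
    show "r \<le> nrm A" unfolding r using n A by (intro ucc.op_mat_norm_le_nrm) auto
  qed
  have "usp_norm TYPE('h) nrm e K A \<le> ?F"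
    unfolding usp_norm_def
  proof (rule cSup_least[OF S_nonempty])
    fix r assume "r \<in> ?S"
    then obtain H :: "'h set" and ip \<phi> where r: "r = op_mat_norm H ip (map_mat \<phi> A)"
      and ucc: "ucc H ip nrm e \<phi>" and ker: "K \<subseteq> op_kernel H \<phi>"
      by blast
    interpret quotient_ucc_map H ip \<phi> e nrm K
      using ucc K ker by (simp add: quotient_ucc_map_def quotient_ucc_map_axioms_def ucc_map_iff)
    show "r \<le> ?F" unfolding factorization_norm_def
    proof (rule cInf_greatest)
      \<comment> \<open>The factorization with a single factor shows that the infimum is over a
        nonempty set.\<close>
      have single: "product_is (quotient_space K) (e +o K) [coset_mat K A] (coset_mat K A)"
        by (auto simp: product_is_def coset_mat_def Fm_refl)
      moreover have "coset_mat K A \<in> mats_over (vcarrier (quotient_space K))"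
        using n A by (auto simp: mats_over_coset[OF K] coset_mat_def)
      ultimately have "permissible (quotient_space K) (e +o K) [coset_mat K A]"
        by (auto simp: permissible_def composable_def)
      with single show "{prod_list (map (osp_norm nrm K) Xs) | Xs. permissible (quotient_space K) (e +o K) Xs \<and>
        product_is (quotient_space K) (e +o K) Xs (coset_mat K A)} \<noteq> {}" by blast
    next
      fix t assume "t \<in> {prod_list (map (osp_norm nrm K) Xs) | Xs. permissible (quotient_space K) (e +o K) Xs \<and>
        product_is (quotient_space K) (e +o K) Xs (coset_mat K A)}"
      then show "r \<le> t" unfolding r by (auto simp: permissible_def intro: op_mat_norm_le_prod)
    qed
  qed
  moreover have "?F \<le> usp_norm TYPE('h) nrm e K A"
  \<comment> \<open>Any \<open>r\<close> above the unital quotient norm gives the strict gap that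
    the lifting argument requires, with \<open>c = r / 2\<close>. Nonnegativity of the norm makes
    this \<open>c\<close> positive.\<close>
  proof (rule dense_ge)
    fix r assume r: "usp_norm TYPE('h) nrm e K A < r"
    define s where "s = usp_norm TYPE('h) nrm e K A"
    have ub: "op_mat_norm H ip (map_mat \<phi> A) \<le> s"
      if "ucc_map H ip \<phi> e nrm" "K \<subseteq> op_kernel H \<phi>" for H :: "'h set" and ip \<phi>
      unfolding s_def usp_norm_def using that by (intro cSup_upper S_bdd) (auto simp: ucc_map_iff)
    obtain r0 where "r0 \<in> ?S" using S_nonempty by blast
    then have s0: "0 \<le> s" unfolding s_def usp_norm_def
      using S_nonneg cSup_upper[OF _ S_bdd] by (meson order_trans)
    have sr: "s < 2 * (r / 2)" using r by (simp add: s_def)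
    have "K \<subseteq> op_kernel L \<theta>" by (simp add: K_eq)
    from accretive_lift_exists[OF \<theta> this inf n A ub s0 sr]
    obtain T where T: "accretive G ipG \<Phi> (2 * n) T"
      "\<And>i j. i < 2 * n \<Longrightarrow> j < 2 * n \<Longrightarrow> T i j - upper e n A (of_real (r / 2)) 1 (of_real (r / 2)) i j \<in> K"
      by blast
    have "0 < r / 2" using s0 sr by simp
    from factorization_norm_le_accretive[OF n this T A] show "?F \<le> r" by simp
  qed
  ultimately show ?thesis by simp
qed

end
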